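(* For any map $\iota_X\colon A\to X$ of $\mathcal M$, $$\mathrm{secat}(\iota_X)\leq\mathrm{relcat}(\iota_X)\leq\mathrm{Pushcat}(\iota_X)\leq\mathrm{Relcat}(\iota_X)\leq\mathrm{secat}(\iota_X)+1.$$
   Context: Setting. $\mathcal M$ is a closed model category satisfying the Cube axiom: in any homotopy commutative cube whose bottom face is a homotopy pushout and whose four vertical faces are homotopy pullbacks, the top face is a homotopy pushout. (Main example: the category of well-pointed topological spaces, i.e. pointed spaces whose base point inclusion is a closed cofibration.) Objects are taken cofibrant-fibrant (replacing them if necessary), and $\simeq$ denotes homotopy of maps. A homotopy commutative diagram includes a choice of mutually compatible homotopies. The whisker map is the map (unique up to homotopy once homotopies are fixed) induced out of a homotopy pushout, or into a homotopy pullback, by a homotopy commutative square. Ganea construction. For a map $\iota_X\colon A\to X$, put $G_0=A$, $g_0=\iota_X$, $\alpha_0=\mathrm{id}_A$. Given $g_i\colon G_i\to X$, let $F_i$ be the homotopy pullback of $\iota_X\colon A\to X$ and $g_i\colon G_i\to X$, with maps $\eta_i\colon F_i\to A$, $\beta_i\colon F_i\to G_i$; let $G_{i+1}$ be the homotopy pushout of $\eta_i$ and $\beta_i$, with maps $\alpha_{i+1}\colon A\to G_{i+1}$, $\gamma_i\colon G_i\to G_{i+1}$; and let $g_{i+1}\colon G_{i+1}\to X$ be the whisker map induced by $\iota_X$ and $g_i$. Write $G_i=G_i(\iota_X)$. $\mathrm{secat}(\iota_X)$ (sectional category) is the least integer $n\ge 0$ such that $g_n\colon G_n(\iota_X)\to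 X$ has a homotopy section $\sigma$, i.e. $g_n\circ\sigma\simeq\mathrm{id}_X$. $\mathrm{relcat}(\iota_X)$ (relative category) is the least $n\ge0$ such that $g_n$ has a homotopy section $\sigma$ with $\sigma\circ\iota_X\simeq\alpha_n$. (All invariants are $\infty$ if no such $n$ exists.) $\mathrm{Pushcat}(\iota_X)$ (strong pushout category) is the least $n\ge0$ such that there are objects $X_0,\dots,X_n=X$ and maps $\iota_i\colon A\to X_i$ with: $\iota_0$ has a homotopy inverse; for each $0\le i<n$ there is an object $Z_i$ and a homotopy pushout of maps $Z_i\to A$ and $Z_i\to X_i$ with pushout object $X_{i+1}$ and structure maps $\iota_{i+1}\colon A\to X_{i+1}$ and $\chi_i\colon X_i\to X_{i+1}$, such that $\chi_i\circ\iota_i\simeq\iota_{i+1}$; and $\iota_n\simeq\iota_X$. $\mathrm{Relcat}(\iota_X)$ (strong relative category) is the least $n\ge0$ such that there are objects $X_0,\dots,X_n=X$ and maps $\iota_i\colon A\to X_i$ with: $\iota_0$ has a homotopy inverse; for each $0\le i<n$ there are maps $\rho_i\colon Z_i\to A$ and $\tau_i\colon Z_i\to X_i$ whose homotopy pushout is $X_{i+1}$ with structure maps $\iota_{i+1}\colon A\to X_{i+1}$ and $\chi_i\colon X_i\to X_{i+1}$, and a map $\sigma_i\colon A\to Z_i$ with $\rho_i\circ\sigma_i\simeq\mathrm{id}_A$ and $\tau_i\circ\sigma_i\simeq\iota_i$ (the whole diagram being homotopy commutative); and $\iota_n\simeq\iota_X$. *)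

theory Defs
  imports Main "HOL-Library.Extended_Nat"
begin

section \<open>Categories\<close>

text \<open>A category with three distinguished classes of arrows. Composition is a total function in HOL
  and is only meaningful for composable arrows, so the definitions below carry explicit typing
  conditions.\<close>

record ('o, 'a) model_structure =
  Obj :: "'o set"
  Arr :: "'a set"
  Dom :: "'a \<Rightarrow> 'o"
  Cod :: "'a \<Rightarrow> 'o"
  Idt :: "'o \<Rightarrow> 'a"
  Comp :: "'a \<Rightarrow> 'a \<Rightarrow> 'a"  (infixl \<open>\<cdot>\<index>\<close> 70)
  Weq :: "'a set"
  Fib :: "'a set"
  Cof :: "'a set"

definition hom :: "('o, 'a, 'm) model_structure_scheme \<Rightarrow> 'o \<Rightarrow> 'o \<Rightarrow> 'a set" where
  "hom M A B = {f \<in> Arr M. Dom M f = A \<and> Cod M f = B}"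

locale category =
  fixes M :: "('o, 'a, 'm) model_structure_scheme" (structure)
  assumes Dom_Obj: "f \<in> Arr M \<Longrightarrow> Dom M f \<in> Obj M"
    and Cod_Obj: "f \<in> Arr M \<Longrightarrow> Cod M f \<in> Obj M"
    and Idt_hom: "A \<in> Obj M \<Longrightarrow> Idt M A \<in> hom M A A"
    and Comp_hom: "f \<in> hom M A B \<Longrightarrow> g \<in> hom M B C \<Longrightarrow> g \<cdot> f \<in> hom M A C"
    and Comp_Idt: "f \<in> hom M A B \<Longrightarrow> f \<cdot> Idt M A = f"
    and Idt_Comp: "f \<in> hom M A B \<Longrightarrow> Idt M B \<cdot> f = f"
    and Comp_assoc: "f \<in> hom M A B \<Longrightarrow> g \<in> hom M B C \<Longrightarrow> h \<in> hom M C D \<Longrightarrow>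
      h \<cdot> (g \<cdot> f) = (h \<cdot> g) \<cdot> f"

definition initial_object :: "('o, 'a, 'm) model_structure_scheme \<Rightarrow> 'o \<Rightarrow> bool" where
  "initial_object M I \<longleftrightarrow> I \<in> Obj M \<and> (\<forall>T\<in>Obj M. \<exists>!f. f \<in> hom M I T)"

definition terminal_object :: "('o, 'a, 'm) model_structure_scheme \<Rightarrow> 'o \<Rightarrow> bool" where
  "terminal_object M I \<longleftrightarrow> I \<in> Obj M \<and> (\<forall>T\<in>Obj M. \<exists>!f. f \<in> hom M T I)"

definition coproduct ::
  "('o, 'a, 'm) model_structure_scheme \<Rightarrow> 'o \<Rightarrow> 'o \<Rightarrow> 'o \<Rightarrow> 'a \<Rightarrow> 'a \<Rightarrow> bool" where
  "coproduct M A B S i j \<longleftrightarrow> i \<in> hom M A S \<and> j \<in> hom M B S \<and>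
     (\<forall>T. \<forall>x\<in>hom M A T. \<forall>y\<in>hom M B T. \<exists>!t. t \<in> hom M S T \<and> t \<cdot>\<^bsub>M\<^esub> i = x \<and> t \<cdot>\<^bsub>M\<^esub> j = y)"

definition pushout ::
  "('o, 'a, 'm) model_structure_scheme \<Rightarrow> 'a \<Rightarrow> 'a \<Rightarrow> 'a \<Rightarrow> 'a \<Rightarrow> bool" where
  "pushout M f g u v \<longleftrightarrow>
     f \<in> Arr M \<and> g \<in> Arr M \<and> Dom M f = Dom M g \<and>
     u \<in> hom M (Cod M f) (Cod M u) \<and> v \<in> hom M (Cod M g) (Cod M u) \<and> u \<cdot>\<^bsub>M\<^esub> f = v \<cdot>\<^bsub>M\<^esub> g \<and>
     (\<forall>T. \<forall>x\<in>hom M (Cod M f) T. \<forall>y\<in>hom M (Cod M g) T. x \<cdot>\<^bsub>M\<^esub> f = y \<cdot>\<^bsub>M\<^esub> g \<longrightarrow>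
        (\<exists>!t. t \<in> hom M (Cod M u) T \<and> t \<cdot>\<^bsub>M\<^esub> u = x \<and> t \<cdot>\<^bsub>M\<^esub> v = y))"

definition pullback ::
  "('o, 'a, 'm) model_structure_scheme \<Rightarrow> 'a \<Rightarrow> 'a \<Rightarrow> 'a \<Rightarrow> 'a \<Rightarrow> bool" where
  "pullback M u v f g \<longleftrightarrow>
     u \<in> Arr M \<and> v \<in> Arr M \<and> Cod M u = Cod M v \<and>
     f \<in> hom M (Dom M f) (Dom M u) \<and> g \<in> hom M (Dom M f) (Dom M v) \<and> u \<cdot>\<^bsub>M\<^esub> f = v \<cdot>\<^bsub>M\<^esub> g \<and>
     (\<forall>T. \<forall>x\<in>hom M T (Dom M u). \<forall>y\<in>hom M T (Dom M v). u \<cdot>\<^bsub>M\<^esub> x = v \<cdot>\<^bsub>M\<^esub> y \<longrightarrow>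
        (\<exists>!t. t \<in> hom M T (Dom M f) \<and> f \<cdot>\<^bsub>M\<^esub> t = x \<and> g \<cdot>\<^bsub>M\<^esub> t = y))"


section \<open>Closed model categories\<close>

definition retract_of :: "('o, 'a, 'm) model_structure_scheme \<Rightarrow> 'a \<Rightarrow> 'a \<Rightarrow> bool" where
  "retract_of M f g \<longleftrightarrow> f \<in> Arr M \<and> g \<in> Arr M \<and>
     (\<exists>i r j q. i \<in> hom M (Dom M f) (Dom M g) \<and> r \<in> hom M (Dom M g) (Dom M f) \<and>
        j \<in> hom M (Cod M f) (Cod M g) \<and> q \<in> hom M (Cod M g) (Cod M f) \<and>
        r \<cdot>\<^bsub>M\<^esub> i = Idt M (Dom M f) \<and> q \<cdot>\<^bsub>M\<^esub> j = Idt M (Cod M f) \<and>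
        g \<cdot>\<^bsub>M\<^esub> i = j \<cdot>\<^bsub>M\<^esub> f \<and> f \<cdot>\<^bsub>M\<^esub> r = q \<cdot>\<^bsub>M\<^esub> g)"

definition lifts_against :: "('o, 'a, 'm) model_structure_scheme \<Rightarrow> 'a \<Rightarrow> 'a \<Rightarrow> bool" where
  "lifts_against M i p \<longleftrightarrow>
     (\<forall>x\<in>hom M (Dom M i) (Dom M p). \<forall>y\<in>hom M (Cod M i) (Cod M p). p \<cdot>\<^bsub>M\<^esub> x = y \<cdot>\<^bsub>M\<^esub> i \<longrightarrow>
        (\<exists>l\<in>hom M (Cod M i) (Dom M p). l \<cdot>\<^bsub>M\<^esub> i = x \<and> p \<cdot>\<^bsub>M\<^esub> l = y))"

text \<open>Quillen's axioms. Finite completeness and cocompleteness are stated through terminal object and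
  pullbacks, initial object and pushouts.\<close>

locale closed_model_category = category +
  assumes Weq_Arr: "Weq M \<subseteq> Arr M" and Fib_Arr: "Fib M \<subseteq> Arr M" and Cof_Arr: "Cof M \<subseteq> Arr M"
    and ex_initial: "\<exists>I. initial_object M I"
    and ex_terminal: "\<exists>I. terminal_object M I"
    and ex_pushout: "f \<in> hom M Z A \<Longrightarrow> g \<in> hom M Z B \<Longrightarrow> \<exists>u v. pushout M f g u v"
    and ex_pullback: "u \<in> hom M A W \<Longrightarrow> v \<in> hom M B W \<Longrightarrow> \<exists>f g. pullback M u v f g"
    and Weq_Comp: "f \<in> hom M A B \<Longrightarrow> g \<in> hom M B C \<Longrightarrow> f \<in> Weq M \<Longrightarrow> g \<in> Weq M \<Longrightarrow> g \<cdot> f \<in> Weq M"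
    and Weq_cancel_left:
      "f \<in> hom M A B \<Longrightarrow> g \<in> hom M B C \<Longrightarrow> g \<in> Weq M \<Longrightarrow> g \<cdot> f \<in> Weq M \<Longrightarrow> f \<in> Weq M"
    and Weq_cancel_right:
      "f \<in> hom M A B \<Longrightarrow> g \<in> hom M B C \<Longrightarrow> f \<in> Weq M \<Longrightarrow> g \<cdot> f \<in> Weq M \<Longrightarrow> g \<in> Weq M"
    and Weq_retract: "retract_of M f g \<Longrightarrow> g \<in> Weq M \<Longrightarrow> f \<in> Weq M"
    and Fib_retract: "retract_of M f g \<Longrightarrow> g \<in> Fib M \<Longrightarrow> f \<in> Fib M"
    and Cof_retract: "retract_of M f g \<Longrightarrow> g \<in> Cof M \<Longrightarrow> f \<in> Cof M"
    and lift_triv_cof: "i \<in> Cof M \<inter> Weq M \<Longrightarrow> p \<in> Fib M \<Longrightarrow> lifts_against M i p"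
    and lift_triv_fib: "i \<in> Cof M \<Longrightarrow> p \<in> Fib M \<inter> Weq M \<Longrightarrow> lifts_against M i p"
    and factor_triv_cof: "f \<in> hom M A B \<Longrightarrow>
      \<exists>E. \<exists>i\<in>hom M A E. \<exists>p\<in>hom M E B. i \<in> Cof M \<inter> Weq M \<and> p \<in> Fib M \<and> p \<cdot> i = f"
    and factor_triv_fib: "f \<in> hom M A B \<Longrightarrow>
      \<exists>E. \<exists>i\<in>hom M A E. \<exists>p\<in>hom M E B. i \<in> Cof M \<and> p \<in> Fib M \<inter> Weq M \<and> p \<cdot> i = f"

definition cofibrant :: "('o, 'a, 'm) model_structure_scheme \<Rightarrow> 'o \<Rightarrow> bool" where
  "cofibrant M A \<longleftrightarrow> (\<exists>I. initial_object M I \<and> (\<exists>f\<in>hom M I A. f \<in> Cof M))"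

definition fibrant :: "('o, 'a, 'm) model_structure_scheme \<Rightarrow> 'o \<Rightarrow> bool" where
  "fibrant M A \<longleftrightarrow> (\<exists>I. terminal_object M I \<and> (\<exists>f\<in>hom M A I. f \<in> Fib M))"

definition bifibrant :: "('o, 'a, 'm) model_structure_scheme \<Rightarrow> 'o \<Rightarrow> bool" where
  "bifibrant M A \<longleftrightarrow> cofibrant M A \<and> fibrant M A"


section \<open>Homotopies\<close>

record 'a cylinder =
  cyl0 :: 'a
  cyl1 :: 'a
  cylp :: 'a

abbreviation Cyl :: "('o, 'a, 'm) model_structure_scheme \<Rightarrow> 'a cylinder \<Rightarrow> 'o" where
  "Cyl M C \<equiv> Dom M (cylp C)"

text \<open>Cylinders are very good: the boundary inclusion is a cofibration and the projection is a trivial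
  fibration. For maps from a cofibrant to a fibrant object this gives the usual homotopy relation,
  and any map \<open>z\<close> is covered by a map of cylinders.\<close>

definition is_cylinder :: "('o, 'a, 'm) model_structure_scheme \<Rightarrow> 'o \<Rightarrow> 'a cylinder \<Rightarrow> bool" where
  "is_cylinder M A C \<longleftrightarrow>
     cylp C \<in> hom M (Cyl M C) A \<and> cylp C \<in> Weq M \<inter> Fib M \<and>
     cyl0 C \<in> hom M A (Cyl M C) \<and> cyl1 C \<in> hom M A (Cyl M C) \<and>
     cylp C \<cdot>\<^bsub>M\<^esub> cyl0 C = Idt M A \<and> cylp C \<cdot>\<^bsub>M\<^esub> cyl1 C = Idt M A \<and>
     (\<exists>S i j. coproduct M A A S i j \<and>
        (\<exists>d\<in>hom M S (Cyl M C). d \<in> Cof M \<and> d \<cdot>\<^bsub>M\<^esub> i = cyl0 C \<and> d \<cdot>\<^bsub>M\<^esub> j = cyl1 C))"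

definition homotopy ::
  "('o, 'a, 'm) model_structure_scheme \<Rightarrow> 'a cylinder \<Rightarrow> 'a \<Rightarrow> 'a \<Rightarrow> 'a \<Rightarrow> bool" where
  "homotopy M C h f g \<longleftrightarrow>
     f \<in> Arr M \<and> g \<in> hom M (Dom M f) (Cod M f) \<and> is_cylinder M (Dom M f) C \<and>
     h \<in> hom M (Cyl M C) (Cod M f) \<and> h \<cdot>\<^bsub>M\<^esub> cyl0 C = f \<and> h \<cdot>\<^bsub>M\<^esub> cyl1 C = g"

definition homotopic :: "('o, 'a, 'm) model_structure_scheme \<Rightarrow> 'a \<Rightarrow> 'a \<Rightarrow> bool" where
  "homotopic M f g \<longleftrightarrow> (\<exists>C h. homotopy M C h f g)"

definition homotopy_inverse :: "('o, 'a, 'm) model_structure_scheme \<Rightarrow> 'a \<Rightarrow> 'a \<Rightarrow> bool" where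
  "homotopy_inverse M f r \<longleftrightarrow>
     f \<in> Arr M \<and> r \<in> hom M (Cod M f) (Dom M f) \<and>
     homotopic M (r \<cdot>\<^bsub>M\<^esub> f) (Idt M (Dom M f)) \<and> homotopic M (f \<cdot>\<^bsub>M\<^esub> r) (Idt M (Cod M f))"

text \<open>A homotopy commutative square \<open>Z \<rightarrow> A\<close>, \<open>Z \<rightarrow> B\<close>, \<open>A \<rightarrow> W\<close>, \<open>B \<rightarrow> W\<close> (maps \<open>f\<close>, \<open>g\<close>, \<open>u\<close>, \<open>v\<close>)
  includes its homotopy \<open>h\<close> from \<open>u \<cdot> f\<close> to \<open>v \<cdot> g\<close>.\<close>

definition hsquare ::
  "('o, 'a, 'm) model_structure_scheme \<Rightarrow> 'a cylinder \<Rightarrow> 'a \<Rightarrow> 'a \<Rightarrow> 'a \<Rightarrow> 'a \<Rightarrow> 'a \<Rightarrow> bool" where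
  "hsquare M C f g u v h \<longleftrightarrow>
     (\<exists>Z A B W. bifibrant M Z \<and> bifibrant M A \<and> bifibrant M B \<and> bifibrant M W \<and>
        f \<in> hom M Z A \<and> g \<in> hom M Z B \<and> u \<in> hom M A W \<and> v \<in> hom M B W) \<and>
     homotopy M C h (u \<cdot>\<^bsub>M\<^esub> f) (v \<cdot>\<^bsub>M\<^esub> g)"


section \<open>Homotopy pushouts and whisker maps\<close>

text \<open>The double mapping cylinder of \<open>f: Z \<rightarrow> A\<close> and \<open>g: Z \<rightarrow> B\<close>, i.e. the colimit of
  \<open>A \<leftarrow> Z \<rightarrow> Cyl Z \<leftarrow> Z \<rightarrow> B\<close>, with structure maps \<open>a\<close>, \<open>c\<close>, \<open>b\<close> out of \<open>A\<close>, \<open>Cyl Z\<close>, \<open>B\<close>.\<close>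

definition double_mapping_cylinder ::
  "('o, 'a, 'm) model_structure_scheme \<Rightarrow> 'a cylinder \<Rightarrow> 'a \<Rightarrow> 'a \<Rightarrow> 'a \<Rightarrow> 'a \<Rightarrow> 'a \<Rightarrow> bool" where
  "double_mapping_cylinder M C f g a c b \<longleftrightarrow>
     a \<in> hom M (Cod M f) (Cod M a) \<and> c \<in> hom M (Cyl M C) (Cod M a) \<and> b \<in> hom M (Cod M g) (Cod M a) \<and>
     c \<cdot>\<^bsub>M\<^esub> cyl0 C = a \<cdot>\<^bsub>M\<^esub> f \<and> c \<cdot>\<^bsub>M\<^esub> cyl1 C = b \<cdot>\<^bsub>M\<^esub> g \<and>
     (\<forall>T. \<forall>x\<in>hom M (Cod M f) T. \<forall>k\<in>hom M (Cyl M C) T. \<forall>y\<in>hom M (Cod M g) T.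
        k \<cdot>\<^bsub>M\<^esub> cyl0 C = x \<cdot>\<^bsub>M\<^esub> f \<and> k \<cdot>\<^bsub>M\<^esub> cyl1 C = y \<cdot>\<^bsub>M\<^esub> g \<longrightarrow>
        (\<exists>!t. t \<in> hom M (Cod M a) T \<and> t \<cdot>\<^bsub>M\<^esub> a = x \<and> t \<cdot>\<^bsub>M\<^esub> c = k \<and> t \<cdot>\<^bsub>M\<^esub> b = y))"

definition induced_by ::
  "('o, 'a, 'm) model_structure_scheme \<Rightarrow> 'a \<Rightarrow> 'a \<Rightarrow> 'a \<Rightarrow> 'a \<Rightarrow> 'a \<Rightarrow> 'a \<Rightarrow> 'a \<Rightarrow> bool" where
  "induced_by M a c b x k y t \<longleftrightarrow>
     t \<in> hom M (Cod M a) (Cod M x) \<and> t \<cdot>\<^bsub>M\<^esub> a = x \<and> t \<cdot>\<^bsub>M\<^esub> c = k \<and> t \<cdot>\<^bsub>M\<^esub> b = y"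

definition homotopy_pushout ::
  "('o, 'a, 'm) model_structure_scheme \<Rightarrow> 'a cylinder \<Rightarrow> 'a \<Rightarrow> 'a \<Rightarrow> 'a \<Rightarrow> 'a \<Rightarrow> 'a \<Rightarrow> bool" where
  "homotopy_pushout M C f g u v h \<longleftrightarrow> hsquare M C f g u v h \<and>
     (\<exists>a c b w. double_mapping_cylinder M C f g a c b \<and> induced_by M a c b u h v w \<and> w \<in> Weq M)"

text \<open>\<open>\<phi>\<close> is a whisker map out of the homotopy pushout \<open>(f, g, u, v, h)\<close>, induced by the square
  \<open>(f, g, x, y, k)\<close>: composed with the comparison map \<open>w\<close> from the double mapping cylinder, it is
  homotopic to the map \<open>t\<close> determined by \<open>x\<close>, \<open>k\<close>, \<open>y\<close>.\<close>

definition whisker_map ::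
  "('o, 'a, 'm) model_structure_scheme \<Rightarrow> 'a cylinder \<Rightarrow> 'a \<Rightarrow> 'a \<Rightarrow> 'a \<Rightarrow> 'a \<Rightarrow> 'a \<Rightarrow>
     'a \<Rightarrow> 'a \<Rightarrow> 'a \<Rightarrow> 'a \<Rightarrow> bool" where
  "whisker_map M C f g u v h x y k \<phi> \<longleftrightarrow>
     homotopy_pushout M C f g u v h \<and> hsquare M C f g x y k \<and> \<phi> \<in> hom M (Cod M u) (Cod M x) \<and>
     (\<exists>a c b w t. double_mapping_cylinder M C f g a c b \<and> induced_by M a c b u h v w \<and>
        induced_by M a c b x k y t \<and> homotopic M (\<phi> \<cdot>\<^bsub>M\<^esub> w) t)"


section \<open>Homotopy pullbacks\<close>

text \<open>Replace \<open>v: B \<rightarrow> W\<close> by a fibration \<open>p\<close>, i.e. \<open>v = p \<cdot> j\<close> with \<open>j\<close> a weak equivalence. Lifting the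
  homotopy \<open>h\<close> through \<open>p\<close> to a homotopy \<open>l\<close> ending at \<open>j \<cdot> g\<close> makes the square strictly commutative:
  \<open>u \<cdot> f = p \<cdot> (l \<cdot> cyl0 C)\<close>. The square is a homotopy pullback when the resulting map \<open>w\<close> from \<open>Z\<close>
  into the strict pullback of \<open>u\<close> and \<open>p\<close> is a weak equivalence.\<close>

definition homotopy_pullback ::
  "('o, 'a, 'm) model_structure_scheme \<Rightarrow> 'a cylinder \<Rightarrow> 'a \<Rightarrow> 'a \<Rightarrow> 'a \<Rightarrow> 'a \<Rightarrow> 'a \<Rightarrow> bool" where
  "homotopy_pullback M C f g u v h \<longleftrightarrow> hsquare M C f g u v h \<and>
     (\<exists>E. \<exists>j\<in>hom M (Dom M v) E. \<exists>p\<in>hom M E (Cod M v). \<exists>l\<in>hom M (Cyl M C) E.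
        j \<in> Weq M \<and> p \<in> Fib M \<and> p \<cdot>\<^bsub>M\<^esub> j = v \<and>
        p \<cdot>\<^bsub>M\<^esub> l = h \<and> l \<cdot>\<^bsub>M\<^esub> cyl1 C = j \<cdot>\<^bsub>M\<^esub> g \<and>
        (\<exists>q r. pullback M u p q r \<and>
           (\<exists>w\<in>hom M (Dom M f) (Dom M q). q \<cdot>\<^bsub>M\<^esub> w = f \<and> r \<cdot>\<^bsub>M\<^esub> w = l \<cdot>\<^bsub>M\<^esub> cyl0 C \<and> w \<in> Weq M)))"


section \<open>Homotopy commutative cubes and the Cube axiom\<close>

definition cylinder_map ::
  "('o, 'a, 'm) model_structure_scheme \<Rightarrow> 'a cylinder \<Rightarrow> 'a cylinder \<Rightarrow> 'a \<Rightarrow> 'a \<Rightarrow> bool" where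
  "cylinder_map M C C' z m \<longleftrightarrow> m \<in> hom M (Cyl M C) (Cyl M C') \<and>
     m \<cdot>\<^bsub>M\<^esub> cyl0 C = cyl0 C' \<cdot>\<^bsub>M\<^esub> z \<and> m \<cdot>\<^bsub>M\<^esub> cyl1 C = cyl1 C' \<cdot>\<^bsub>M\<^esub> z \<and> cylp C' \<cdot>\<^bsub>M\<^esub> m = z \<cdot>\<^bsub>M\<^esub> cylp C"

text \<open>Let \<open>h1, h2, h3\<close> and \<open>k1, k2, k3\<close> be two chains of consecutive homotopies (on the cylinder \<open>C\<close> of
  \<open>Z\<close>) with the same first and the same last map. They are compatible if the hexagon they
  form can be filled: it extends over an object \<open>D\<close> that is weakly equivalent to \<open>Z\<close> and receives
  the six edges \<open>d1, d2, d3, e1, e2, e3\<close> of the hexagon over \<open>Z\<close>. (Requiring the hexagon to be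
  cofibrant in \<open>D\<close> would not change this notion, as \<open>D\<close> can be replaced by factorisation.)\<close>

definition compatible_chains ::
  "('o, 'a, 'm) model_structure_scheme \<Rightarrow> 'a cylinder \<Rightarrow> 'a \<Rightarrow> 'a \<Rightarrow> 'a \<Rightarrow> 'a \<Rightarrow> 'a \<Rightarrow> 'a \<Rightarrow> bool" where
  "compatible_chains M C h1 h2 h3 k1 k2 k3 \<longleftrightarrow>
     (\<exists>D. \<exists>s\<in>hom M D (Cod M (cylp C)). \<exists>H\<in>hom M D (Cod M h1).
      \<exists>d1\<in>hom M (Cyl M C) D. \<exists>d2\<in>hom M (Cyl M C) D. \<exists>d3\<in>hom M (Cyl M C) D.
      \<exists>e1\<in>hom M (Cyl M C) D. \<exists>e2\<in>hom M (Cyl M C) D. \<exists>e3\<in>hom M (Cyl M C) D.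
        s \<in> Weq M \<and>
        s \<cdot>\<^bsub>M\<^esub> d1 = cylp C \<and> s \<cdot>\<^bsub>M\<^esub> d2 = cylp C \<and> s \<cdot>\<^bsub>M\<^esub> d3 = cylp C \<and>
        s \<cdot>\<^bsub>M\<^esub> e1 = cylp C \<and> s \<cdot>\<^bsub>M\<^esub> e2 = cylp C \<and> s \<cdot>\<^bsub>M\<^esub> e3 = cylp C \<and>
        d1 \<cdot>\<^bsub>M\<^esub> cyl0 C = e1 \<cdot>\<^bsub>M\<^esub> cyl0 C \<and>
        d1 \<cdot>\<^bsub>M\<^esub> cyl1 C = d2 \<cdot>\<^bsub>M\<^esub> cyl0 C \<and> d2 \<cdot>\<^bsub>M\<^esub> cyl1 C = d3 \<cdot>\<^bsub>M\<^esub> cyl0 C \<and>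
        e1 \<cdot>\<^bsub>M\<^esub> cyl1 C = e2 \<cdot>\<^bsub>M\<^esub> cyl0 C \<and> e2 \<cdot>\<^bsub>M\<^esub> cyl1 C = e3 \<cdot>\<^bsub>M\<^esub> cyl0 C \<and>
        d3 \<cdot>\<^bsub>M\<^esub> cyl1 C = e3 \<cdot>\<^bsub>M\<^esub> cyl1 C \<and>
        H \<cdot>\<^bsub>M\<^esub> d1 = h1 \<and> H \<cdot>\<^bsub>M\<^esub> d2 = h2 \<and> H \<cdot>\<^bsub>M\<^esub> d3 = h3 \<and>
        H \<cdot>\<^bsub>M\<^esub> e1 = k1 \<and> H \<cdot>\<^bsub>M\<^esub> e2 = k2 \<and> H \<cdot>\<^bsub>M\<^esub> e3 = k3)"

text \<open>A homotopy commutative cube with bottom face \<open>f: Z \<rightarrow> A\<close>, \<open>g: Z \<rightarrow> B\<close>, \<open>u: A \<rightarrow> W\<close>, \<open>v: B \<rightarrow> W\<close>, top face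
  \<open>f': Z' \<rightarrow> A'\<close>, \<open>g': Z' \<rightarrow> B'\<close>, \<open>u': A' \<rightarrow> W'\<close>, \<open>v': B' \<rightarrow> W'\<close> and vertical maps \<open>z, a, b, w\<close>. The six
  homotopies assemble into two chains from \<open>w \<cdot> u' \<cdot> f'\<close> to \<open>v \<cdot> g \<cdot> z\<close>:
  \<open>w u' f' \<sim> w v' g' \<sim> v b g' \<sim> v g z\<close> and \<open>w u' f' \<sim> u a f' \<sim> u f z \<sim> v g z\<close>.\<close>

record 'a cube =
  bot_f :: 'a  bot_g :: 'a  bot_u :: 'a  bot_v :: 'a
  top_f :: 'a  top_g :: 'a  top_u :: 'a  top_v :: 'a
  vert_z :: 'a  vert_a :: 'a  vert_b :: 'a  vert_w :: 'a
  cyl_Z :: "'a cylinder"  cyl_Z' :: "'a cylinder"  cyl_A' :: "'a cylinder"  cyl_B' :: "'a cylinder"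
  h_bot :: 'a  h_top :: 'a
  h_ZA :: 'a  h_ZB :: 'a  h_AW :: 'a  h_BW :: 'a

definition homotopy_commutative_cube ::
  "('o, 'a, 'm) model_structure_scheme \<Rightarrow> 'a cube \<Rightarrow> bool" where
  "homotopy_commutative_cube M Q \<longleftrightarrow>
     hsquare M (cyl_Z Q) (bot_f Q) (bot_g Q) (bot_u Q) (bot_v Q) (h_bot Q) \<and>
     hsquare M (cyl_Z' Q) (top_f Q) (top_g Q) (top_u Q) (top_v Q) (h_top Q) \<and>
     hsquare M (cyl_Z' Q) (top_f Q) (vert_z Q) (vert_a Q) (bot_f Q) (h_ZA Q) \<and>
     hsquare M (cyl_Z' Q) (top_g Q) (vert_z Q) (vert_b Q) (bot_g Q) (h_ZB Q) \<and>
     hsquare M (cyl_A' Q) (top_u Q) (vert_a Q) (vert_w Q) (bot_u Q) (h_AW Q) \<and>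
     hsquare M (cyl_B' Q) (top_v Q) (vert_b Q) (vert_w Q) (bot_v Q) (h_BW Q) \<and>
     (\<exists>mz mf mg. cylinder_map M (cyl_Z' Q) (cyl_Z Q) (vert_z Q) mz \<and>
        cylinder_map M (cyl_Z' Q) (cyl_A' Q) (top_f Q) mf \<and>
        cylinder_map M (cyl_Z' Q) (cyl_B' Q) (top_g Q) mg \<and>
        compatible_chains M (cyl_Z' Q)
          (vert_w Q \<cdot>\<^bsub>M\<^esub> h_top Q) (h_BW Q \<cdot>\<^bsub>M\<^esub> mg) (bot_v Q \<cdot>\<^bsub>M\<^esub> h_ZB Q)
          (h_AW Q \<cdot>\<^bsub>M\<^esub> mf) (bot_u Q \<cdot>\<^bsub>M\<^esub> h_ZA Q) (h_bot Q \<cdot>\<^bsub>M\<^esub> mz))"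

locale cube_model_category = closed_model_category +
  assumes cube_axiom:
    "homotopy_commutative_cube M Q \<Longrightarrow>
     homotopy_pushout M (cyl_Z Q) (bot_f Q) (bot_g Q) (bot_u Q) (bot_v Q) (h_bot Q) \<Longrightarrow>
     homotopy_pullback M (cyl_Z' Q) (top_f Q) (vert_z Q) (vert_a Q) (bot_f Q) (h_ZA Q) \<Longrightarrow>
     homotopy_pullback M (cyl_Z' Q) (top_g Q) (vert_z Q) (vert_b Q) (bot_g Q) (h_ZB Q) \<Longrightarrow>
     homotopy_pullback M (cyl_A' Q) (top_u Q) (vert_a Q) (vert_w Q) (bot_u Q) (h_AW Q) \<Longrightarrow>
     homotopy_pullback M (cyl_B' Q) (top_v Q) (vert_b Q) (vert_w Q) (bot_v Q) (h_BW Q) \<Longrightarrow>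
     homotopy_pushout M (cyl_Z' Q) (top_f Q) (top_g Q) (top_u Q) (top_v Q) (h_top Q)"


section \<open>The Ganea construction and the four invariants\<close>

text \<open>\<open>ganea M \<iota> n g \<alpha>\<close>: the maps \<open>g: G \<rightarrow> X\<close> and \<open>\<alpha>: A \<rightarrow> G\<close> arise as \<open>g\<^sub>n\<close> and \<open>\<alpha>\<^sub>n\<close> for some choice of the
  homotopy pullbacks, homotopy pushouts and whisker maps in the Ganea construction of \<open>\<iota>\<close>. The
  homotopy \<open>h\<close> of the homotopy pullback is the one used for the whisker map.\<close>

inductive ganea :: "('o, 'a, 'm) model_structure_scheme \<Rightarrow> 'a \<Rightarrow> nat \<Rightarrow> 'a \<Rightarrow> 'a \<Rightarrow> bool"
  for M :: "('o, 'a, 'm) model_structure_scheme" and \<iota> :: 'a where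
  ganea_0: "ganea M \<iota> 0 \<iota> (Idt M (Dom M \<iota>))"
| ganea_Suc: "ganea M \<iota> n g \<alpha> \<Longrightarrow>
    homotopy_pullback M C \<eta> \<beta> \<iota> g h \<Longrightarrow>
    homotopy_pushout M C \<eta> \<beta> \<alpha>' \<gamma> k \<Longrightarrow>
    whisker_map M C \<eta> \<beta> \<alpha>' \<gamma> k \<iota> g h g' \<Longrightarrow>
    ganea M \<iota> (Suc n) g' \<alpha>'"

definition secat :: "('o, 'a, 'm) model_structure_scheme \<Rightarrow> 'a \<Rightarrow> enat" where
  "secat M \<iota> = Inf (enat ` {n. \<exists>g \<alpha>. ganea M \<iota> n g \<alpha> \<and>
     (\<exists>\<sigma>\<in>hom M (Cod M \<iota>) (Dom M g). homotopic M (g \<cdot>\<^bsub>M\<^esub> \<sigma>) (Idt M (Cod M \<iota>)))})"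

definition relcat :: "('o, 'a, 'm) model_structure_scheme \<Rightarrow> 'a \<Rightarrow> enat" where
  "relcat M \<iota> = Inf (enat ` {n. \<exists>g \<alpha>. ganea M \<iota> n g \<alpha> \<and>
     (\<exists>\<sigma>\<in>hom M (Cod M \<iota>) (Dom M g). homotopic M (g \<cdot>\<^bsub>M\<^esub> \<sigma>) (Idt M (Cod M \<iota>)) \<and>
        homotopic M (\<sigma> \<cdot>\<^bsub>M\<^esub> \<iota>) \<alpha>)})"

definition Pushcat :: "('o, 'a, 'm) model_structure_scheme \<Rightarrow> 'a \<Rightarrow> enat" where
  "Pushcat M \<iota> = Inf (enat ` {n. \<exists>X \<kappa>.
     (\<forall>i\<le>n. bifibrant M (X i) \<and> \<kappa> i \<in> hom M (Dom M \<iota>) (X i)) \<and>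
     (\<exists>r. homotopy_inverse M (\<kappa> 0) r) \<and>
     (\<forall>i<n. \<exists>C Z. \<exists>\<rho>\<in>hom M Z (Dom M \<iota>). \<exists>\<tau>\<in>hom M Z (X i). \<exists>\<chi>\<in>hom M (X i) (X (Suc i)). \<exists>h.
        homotopy_pushout M C \<rho> \<tau> (\<kappa> (Suc i)) \<chi> h \<and>
        homotopic M (\<chi> \<cdot>\<^bsub>M\<^esub> \<kappa> i) (\<kappa> (Suc i))) \<and>
     X n = Cod M \<iota> \<and> homotopic M (\<kappa> n) \<iota>})"

definition Relcat :: "('o, 'a, 'm) model_structure_scheme \<Rightarrow> 'a \<Rightarrow> enat" where
  "Relcat M \<iota> = Inf (enat ` {n. \<exists>X \<kappa>.
     (\<forall>i\<le>n. bifibrant M (X i) \<and> \<kappa> i \<in> hom M (Dom M \<iota>) (X i)) \<and>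
     (\<exists>r. homotopy_inverse M (\<kappa> 0) r) \<and>
     (\<forall>i<n. \<exists>C Z. \<exists>\<rho>\<in>hom M Z (Dom M \<iota>). \<exists>\<tau>\<in>hom M Z (X i). \<exists>\<chi>\<in>hom M (X i) (X (Suc i)). \<exists>h.
        homotopy_pushout M C \<rho> \<tau> (\<kappa> (Suc i)) \<chi> h \<and>
        (\<exists>\<sigma>\<in>hom M (Dom M \<iota>) Z. homotopic M (\<rho> \<cdot>\<^bsub>M\<^esub> \<sigma>) (Idt M (Dom M \<iota>)) \<and>
           homotopic M (\<tau> \<cdot>\<^bsub>M\<^esub> \<sigma>) (\<kappa> i))) \<and>
     X n = Cod M \<iota> \<and> homotopic M (\<kappa> n) \<iota>})"

end

theory Submission
  imports Defs
begin

text \<open>A section as in \<open>relcat\<close> is in particular one as in \<open>secat\<close>. A decomposition as in \<open>Relcat\<close> is one as in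
  \<open>Pushcat\<close>, because \<open>\<chi> \<cdot> \<kappa> i \<sim> \<chi> \<cdot> \<tau> \<cdot> \<sigma> \<sim> \<kappa> (Suc i) \<cdot> \<rho> \<cdot> \<sigma> \<sim> \<kappa> (Suc i)\<close>.

  For \<open>relcat \<le> Pushcat\<close> one climbs a given decomposition \<open>X 0, \<dots>, X n = X\<close> and constructs the objects \<open>G i\<close> of the
  Ganea construction along with maps \<open>X i \<rightarrow> G i\<close>, over \<open>X\<close> and under \<open>A\<close> up to homotopy: the attaching object
  \<open>Z \<rightarrow> A\<close>, \<open>Z \<rightarrow> X i \<rightarrow> G i\<close> maps to the homotopy pullback from which \<open>G (i + 1)\<close> is built
  (\<open>ganea_comparison_step\<close>). The last of these maps is the required section.

  The inequality \<open>Relcat \<le> secat + 1\<close> is the one that needs the Cube axiom. Let \<open>g: G \<rightarrow> X\<close>, \<open>\<alpha>: A \<rightarrow> G\<close> be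
  the \<open>n\<close>-th stage of the Ganea construction and let \<open>s\<close> be a homotopy section of \<open>g\<close>.
  \<^item> The Ganea construction is itself a decomposition of \<open>\<alpha>\<close> of length \<open>n\<close> as in \<open>Relcat\<close>: as \<open>g \<cdot> \<alpha> \<sim> \<iota>\<close>, the
    identity of \<open>A\<close> and \<open>\<alpha>\<close> define a section of each \<open>F \<rightarrow> A\<close> (\<open>ganea_rel_build\<close>).
  \<^item> Pull this decomposition back along \<open>s\<close>. By the Cube axiom the squares stay homotopy pushouts, now of
    objects over \<open>X\<close> with \<open>A\<close> replaced by the homotopy pullback \<open>P\<close> of \<open>\<alpha>\<close> and \<open>s\<close>. Gluing \<open>A\<close> along \<open>P\<close> to all
    objects gives a decomposition of length \<open>n\<close> of \<open>A \<rightarrow> A \<union>\<^sub>P X\<close> (\<open>rel_build_pullback\<close>).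
  \<^item> The map \<open>P \<rightarrow> A\<close> composed with \<open>A \<rightarrow> G \<rightarrow> X\<close> is homotopic to \<open>P \<rightarrow> X\<close>, since \<open>g \<cdot> s \<sim> id\<close>. This gives a map
    \<open>A \<union>\<^sub>P A \<rightarrow> A \<union>\<^sub>P X\<close>, and the homotopy pushout of it along the fold map \<open>A \<union>\<^sub>P A \<rightarrow> A\<close> is \<open>X\<close>. This is the one
    additional step (\<open>rel_build_of_homotopy_section\<close>).

  Homotopies are removed from the argument early. A homotopy commutative square becomes strictly commutative
  once one of its maps is replaced by the inclusion into a mapping cylinder, and whether it is a homotopy
  pushout can then be read off from the strict pushout (\<open>homotopy_pushout_iff_hcocart\<close>). Thus the main part
  works with strictly commuting squares, called \<open>hcocart\<close> and \<open>hcart\<close>, and applies the Cube axiom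
  to cubes with constant homotopies only (\<open>strict_cube\<close>). Lemmas on fibrations, pullbacks and right homotopies
  are obtained from their duals by passing to the opposite model structure.\<close>

section \<open>Composition and pushouts\<close>

context category begin

lemma in_hom: "f \<in> hom M A B \<longleftrightarrow> f \<in> Arr M \<and> Dom M f = A \<and> Cod M f = B"
  by (auto simp: hom_def)

lemma comp_arr:
  assumes "f \<in> Arr M" "g \<in> Arr M" "Cod M f = Dom M g"
  shows "g \<cdot> f \<in> Arr M" "Dom M (g \<cdot> f) = Dom M f" "Cod M (g \<cdot> f) = Cod M g"
  using Comp_hom[of f "Dom M f" "Cod M f" g "Cod M g"] assms by (auto simp: in_hom)

lemma assoc:
  assumes "f \<in> Arr M" "g \<in> Arr M" "h \<in> Arr M" "Cod M f = Dom M g" "Cod M g = Dom M h"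
  shows "(h \<cdot> g) \<cdot> f = h \<cdot> (g \<cdot> f)"
  using Comp_assoc[of f "Dom M f" "Cod M f" g "Cod M g" h "Cod M h"] assms by (auto simp: in_hom)

lemma idt_arr:
  assumes "A \<in> Obj M"
  shows "Idt M A \<in> Arr M" "Dom M (Idt M A) = A" "Cod M (Idt M A) = A"
  using Idt_hom[OF assms] by (auto simp: in_hom)

lemma comp_idt: "f \<in> Arr M \<Longrightarrow> Dom M f = A \<Longrightarrow> f \<cdot> Idt M A = f"
  using Comp_Idt[of f A "Cod M f"] by (auto simp: in_hom)

lemma idt_comp: "f \<in> Arr M \<Longrightarrow> Cod M f = A \<Longrightarrow> Idt M A \<cdot> f = f"
  using Idt_Comp[of f "Dom M f" A] by (auto simp: in_hom)

text \<open>Composites are normalised to the right. In this form, an equation between composites can also be used inside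
  a longer composite.\<close>
lemma comp_ext:
  assumes "g \<cdot> f = k" "z \<in> Arr M" "f \<in> Arr M" "g \<in> Arr M" "Cod M f = Dom M g" "Cod M z = Dom M f"
  shows "g \<cdot> (f \<cdot> z) = k \<cdot> z"
  using assms assoc[of z f g] by simp

lemmas cat = in_hom comp_arr assoc idt_arr comp_idt idt_comp Dom_Obj Cod_Obj

lemma pushout_arr:
  assumes "pushout M f g u v"
  obtains Z A B W where "f \<in> hom M Z A" "g \<in> hom M Z B" "u \<in> hom M A W" "v \<in> hom M B W" "u \<cdot> f = v \<cdot> g"
  using assms by (auto simp: pushout_def in_hom)

lemma pushout_obj:
  assumes "pushout M f g u v" "f \<in> hom M Z A" "g \<in> hom M Z B"
  obtains W where "u \<in> hom M A W" "v \<in> hom M B W" "u \<cdot> f = v \<cdot> g"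
  using assms by (auto simp: pushout_def in_hom)

lemma pushout_induced:
  assumes "pushout M f g u v" "u \<in> hom M A W" "v \<in> hom M B W"
    "x \<in> hom M A T" "y \<in> hom M B T" "x \<cdot> f = y \<cdot> g"
  obtains t where "t \<in> hom M W T" "t \<cdot> u = x" "t \<cdot> v = y"
proof -
  have "Cod M f = A" "Cod M g = B" "Cod M u = W"
    using assms(1-3) by (auto simp: pushout_def in_hom)
  with assms that show thesis unfolding pushout_def by blast
qed

lemma pushout_eqI:
  assumes "pushout M f g u v" "u \<in> hom M A W" "s \<in> hom M W T" "t \<in> hom M W T"
    "s \<cdot> u = t \<cdot> u" "s \<cdot> v = t \<cdot> v"
  shows "s = t"
proof -
  obtain Z B where a: "f \<in> hom M Z A" "g \<in> hom M Z B" "v \<in> hom M B W" "u \<cdot> f = v \<cdot> g"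
    using assms(1,2) by (auto simp: pushout_def in_hom)
  have "t \<cdot> u \<in> hom M A T" "t \<cdot> v \<in> hom M B T" "(t \<cdot> u) \<cdot> f = (t \<cdot> v) \<cdot> g" "Cod M f = A" "Cod M g = B" "Cod M u = W"
    using a assms(2,4) by (auto simp: cat)
  with assms show ?thesis unfolding pushout_def by metis
qed

lemma pushoutI:
  assumes "f \<in> hom M Z A" "g \<in> hom M Z B" "u \<in> hom M A W" "v \<in> hom M B W" "u \<cdot> f = v \<cdot> g"
    and ex: "\<And>T x y. x \<in> hom M A T \<Longrightarrow> y \<in> hom M B T \<Longrightarrow> x \<cdot> f = y \<cdot> g \<Longrightarrow>
        \<exists>t. t \<in> hom M W T \<and> t \<cdot> u = x \<and> t \<cdot> v = y"
    and un: "\<And>T s t. s \<in> hom M W T \<Longrightarrow> t \<in> hom M W T \<Longrightarrow>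
        s \<cdot> u = t \<cdot> u \<Longrightarrow> s \<cdot> v = t \<cdot> v \<Longrightarrow> s = t"
  shows "pushout M f g u v"
proof -
  have o: "Cod M f = A" "Cod M g = B" "Cod M u = W" "Dom M f = Dom M g"
    using assms(1-4) by (auto simp: in_hom)
  show ?thesis unfolding pushout_def o
  proof (intro conjI allI ballI impI)
    fix T x y assume *: "x \<in> hom M A T" "y \<in> hom M B T" "x \<cdot> f = y \<cdot> g"
    obtain t where t: "t \<in> hom M W T \<and> t \<cdot> u = x \<and> t \<cdot> v = y" using ex[OF *] by blast
    show "\<exists>!t. t \<in> hom M W T \<and> t \<cdot> u = x \<and> t \<cdot> v = y"
      by (rule ex1I[of _ t]) (use t in blast, use t un in metis)
  qed (use assms(1-5) in \<open>auto simp: in_hom\<close>)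
qed

lemma pushout_sym: assumes P: "pushout M f g u v" shows "pushout M g f v u"
proof -
  obtain Z A B W where a: "f \<in> hom M Z A" "g \<in> hom M Z B" "u \<in> hom M A W" "v \<in> hom M B W" "u \<cdot> f = v \<cdot> g"
    using pushout_arr[OF P] .
  show ?thesis
  proof (rule pushoutI[OF a(2,1,4,3) a(5)[symmetric]])
    fix T x y assume *: "x \<in> hom M B T" "y \<in> hom M A T" "x \<cdot> g = y \<cdot> f"
    show "\<exists>t. t \<in> hom M W T \<and> t \<cdot> v = x \<and> t \<cdot> u = y"
      using pushout_induced[OF P a(3,4) *(2,1)] *(3) by metis
  qed (use pushout_eqI[OF P a(3)] in blast)
qed

lemma pushout_paste:
  assumes P: "pushout M f g u v" and Q: "pushout M h u x y"
  shows "pushout M (h \<cdot> f) g x (y \<cdot> v)"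
proof -
  obtain Z A B W where a: "f \<in> hom M Z A" "g \<in> hom M Z B" "u \<in> hom M A W" "v \<in> hom M B W" "u \<cdot> f = v \<cdot> g"
    using pushout_arr[OF P] .
  obtain A' W' where b: "h \<in> hom M A A'" "x \<in> hom M A' W'" "y \<in> hom M W W'" "x \<cdot> h = y \<cdot> u"
    using pushout_arr[OF Q] a(3) by (metis in_hom)
  show ?thesis
  proof (rule pushoutI[of _ Z A' _ B _ W'])
    show "x \<cdot> (h \<cdot> f) = (y \<cdot> v) \<cdot> g"
      using a b comp_ext[OF b(4), of f] by (simp add: cat)
  next
    fix T x' y' assume *: "x' \<in> hom M A' T" "y' \<in> hom M B T" "x' \<cdot> (h \<cdot> f) = y' \<cdot> g"
    obtain t where t: "t \<in> hom M W T" "t \<cdot> u = x' \<cdot> h" "t \<cdot> v = y'"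
      by (rule pushout_induced[OF P a(3,4), of "x' \<cdot> h" T y']) (use a b * in \<open>auto simp: cat\<close>)
    obtain s where s: "s \<in> hom M W' T" "s \<cdot> x = x'" "s \<cdot> y = t"
      by (rule pushout_induced[OF Q b(2,3) *(1) t(1) t(2)[symmetric]])
    have "s \<cdot> (y \<cdot> v) = y'" using s t a b comp_ext[OF s(3), of v] by (simp add: cat)
    then show "\<exists>t. t \<in> hom M W' T \<and> t \<cdot> x = x' \<and> t \<cdot> (y \<cdot> v) = y'"
      using s by blast
  next
    fix T s t assume *: "s \<in> hom M W' T" "t \<in> hom M W' T" "s \<cdot> x = t \<cdot> x"
      "s \<cdot> (y \<cdot> v) = t \<cdot> (y \<cdot> v)"
    have "s \<cdot> (y \<cdot> u) = t \<cdot> (y \<cdot> u)"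
      using a b * comp_ext[OF *(3), of h] by (simp add: cat)
    then have "s \<cdot> y = t \<cdot> y"
      by (intro pushout_eqI[OF P a(3), of "s \<cdot> y" T "t \<cdot> y"]) (use a b * in \<open>auto simp: cat\<close>)
    then show "s = t" by (rule pushout_eqI[OF Q b(2) *(1,2,3)])
  qed (use a b in \<open>simp_all add: cat\<close>)
qed

lemma pushout_cancel:
  assumes P: "pushout M f g u v" and Q: "pushout M (h \<cdot> f) g x (y \<cdot> v)"
    and u: "u \<in> hom M A W" and x: "x \<in> hom M A' W'"
    and h: "h \<in> hom M A A'" and y: "y \<in> hom M W W'" and e: "x \<cdot> h = y \<cdot> u"
  shows "pushout M h u x y"
proof -
  obtain Z B where a: "f \<in> hom M Z A" "g \<in> hom M Z B" "v \<in> hom M B W" "u \<cdot> f = v \<cdot> g"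
    using pushout_arr[OF P] u by (metis in_hom)
  have yv: "y \<cdot> v \<in> hom M B W'" using a y by (simp add: cat)
  show ?thesis
  proof (rule pushoutI[OF h u x y e])
    fix T x' y' assume *: "x' \<in> hom M A' T" "y' \<in> hom M W T" "x' \<cdot> h = y' \<cdot> u"
    have "x' \<cdot> (h \<cdot> f) = (y' \<cdot> v) \<cdot> g"
      using a h u * comp_ext[OF *(3), of f] by (simp add: cat)
    then obtain t where t: "t \<in> hom M W' T" "t \<cdot> x = x'" "t \<cdot> (y \<cdot> v) = y' \<cdot> v"
      by (rule pushout_induced[OF Q x yv *(1), of "y' \<cdot> v", rotated 1]) (use a * in \<open>auto simp: cat\<close>)
    have "t \<cdot> y = y'"
    proof (rule pushout_eqI[OF P u _ *(2)])
      show "(t \<cdot> y) \<cdot> u = y' \<cdot> u"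
        using a u x h y e[symmetric] * t comp_ext[OF t(2), of h] by (simp add: cat)
    qed (use a x y h * t in \<open>auto simp: cat\<close>)
    then show "\<exists>t. t \<in> hom M W' T \<and> t \<cdot> x = x' \<and> t \<cdot> y = y'" using t by blast
  next
    fix T s t assume *: "s \<in> hom M W' T" "t \<in> hom M W' T" "s \<cdot> x = t \<cdot> x" "s \<cdot> y = t \<cdot> y"
    show "s = t"
      by (rule pushout_eqI[OF Q x *(1,2,3)]) (use a y * comp_ext[OF *(4), of v] in \<open>auto simp: cat\<close>)
  qed
qed

end

section \<open>The opposite model structure\<close>

text \<open>The opposite category, with fibrations and cofibrations exchanged. Every statement about pushouts and cofibrations
  that holds in all model categories yields one about pullbacks and fibrations.\<close>
definition op_ms :: "('o, 'a) model_structure \<Rightarrow> ('o, 'a) model_structure" where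
  "op_ms M = \<lparr>Obj = Obj M, Arr = Arr M, Dom = Cod M, Cod = Dom M, Idt = Idt M,
     Comp = (\<lambda>g f. Comp M f g), Weq = Weq M, Fib = Cof M, Cof = Fib M\<rparr>"

lemma op_simps:
  "hom (op_ms M) A B = hom M B A"
  "Obj (op_ms M) = Obj M" "Arr (op_ms M) = Arr M" "Dom (op_ms M) = Cod M" "Cod (op_ms M) = Dom M"
  "Idt (op_ms M) = Idt M" "Comp (op_ms M) g f = Comp M f g"
  "Weq (op_ms M) = Weq M" "Fib (op_ms M) = Cof M" "Cof (op_ms M) = Fib M"
  "op_ms (op_ms M) = M"
  "pushout (op_ms M) f g u v \<longleftrightarrow> pullback M f g u v"
  "pullback (op_ms M) u v f g \<longleftrightarrow> pushout M u v f g"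
  "initial_object (op_ms M) = terminal_object M"
  "terminal_object (op_ms M) = initial_object M"
  "cofibrant (op_ms M) = fibrant M"
  "fibrant (op_ms M) = cofibrant M"
proof -
  show hom: "hom (op_ms M) A B = hom M B A" for A B
    by (auto simp: hom_def op_ms_def)
  show sel: "Obj (op_ms M) = Obj M" "Arr (op_ms M) = Arr M" "Dom (op_ms M) = Cod M" "Cod (op_ms M) = Dom M"
    "Idt (op_ms M) = Idt M" "Comp (op_ms M) g f = Comp M f g"
    "Weq (op_ms M) = Weq M" "Fib (op_ms M) = Cof M" "Cof (op_ms M) = Fib M"
    "op_ms (op_ms M) = M" for g f
    by (simp_all add: op_ms_def)
  show i: "initial_object (op_ms M) = terminal_object M" "terminal_object (op_ms M) = initial_object M"
    unfolding fun_eq_iff initial_object_def terminal_object_def hom sel by (rule allI, rule refl)+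
  show "cofibrant (op_ms M) = fibrant M" "fibrant (op_ms M) = cofibrant M"
    unfolding fun_eq_iff cofibrant_def fibrant_def i hom sel by (rule allI, rule refl)+
  show "pushout (op_ms M) f g u v \<longleftrightarrow> pullback M f g u v"
    unfolding pushout_def pullback_def hom sel by (rule refl)
  show "pullback (op_ms M) u v f g \<longleftrightarrow> pushout M u v f g"
    unfolding pushout_def pullback_def hom sel by (rule refl)
qed

lemma op_lifts: "lifts_against (op_ms M) i p \<longleftrightarrow> lifts_against M p i"
  unfolding lifts_against_def op_simps
  by (rule iffI; intro ballI impI; drule (1) bspec; drule (1) bspec; drule mp, erule sym, blast)

lemma op_retract:
  assumes "retract_of (op_ms M) f g" shows "retract_of M f g"
proof -
  from assms obtain i r j q where "f \<in> Arr M" "g \<in> Arr M"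
    "i \<in> hom M (Cod M g) (Cod M f)" "r \<in> hom M (Cod M f) (Cod M g)"
    "j \<in> hom M (Dom M g) (Dom M f)" "q \<in> hom M (Dom M f) (Dom M g)"
    "Comp M i r = Idt M (Cod M f)" "Comp M j q = Idt M (Dom M f)"
    "Comp M i g = Comp M f j" "Comp M r f = Comp M g q"
    unfolding retract_of_def op_simps by blast
  then show ?thesis unfolding retract_of_def by (intro conjI exI[of _ q] exI[of _ j] exI[of _ r] exI[of _ i]) auto
qed

text \<open>The record is not extended here, so that taking the opposite twice gives back the same record.\<close>
locale model_cat = closed_model_category M for M :: "('o, 'a) model_structure" (structure)

lemma (in model_cat) op_model_cat: "model_cat (op_ms M)"
proof (unfold model_cat_def, unfold_locales, unfold op_simps)
  fix f g h A B C D
  show "f \<in> Arr M \<Longrightarrow> Cod M f \<in> Obj M" "f \<in> Arr M \<Longrightarrow> Dom M f \<in> Obj M"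
    by (simp_all add: cat)
  show "A \<in> Obj M \<Longrightarrow> Idt M A \<in> hom M A A" by (simp add: cat)
  show "f \<in> hom M B A \<Longrightarrow> g \<in> hom M C B \<Longrightarrow> f \<cdot> g \<in> hom M C A" by (simp add: cat)
  show "f \<in> hom M B A \<Longrightarrow> Idt M A \<cdot> f = f" "f \<in> hom M B A \<Longrightarrow> f \<cdot> Idt M B = f" by (simp_all add: cat)
  show "f \<in> hom M B A \<Longrightarrow> g \<in> hom M C B \<Longrightarrow> h \<in> hom M D C \<Longrightarrow> f \<cdot> g \<cdot> h = f \<cdot> (g \<cdot> h)" by (simp add: cat)
  show "f \<in> hom M B A \<Longrightarrow> g \<in> hom M C B \<Longrightarrow> f \<in> Weq M \<Longrightarrow> g \<in> Weq M \<Longrightarrow> f \<cdot> g \<in> Weq M"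
    by (rule Weq_Comp)
  show "f \<in> hom M B A \<Longrightarrow> g \<in> hom M C B \<Longrightarrow> g \<in> Weq M \<Longrightarrow> f \<cdot> g \<in> Weq M \<Longrightarrow> f \<in> Weq M"
    by (rule Weq_cancel_right)
  show "f \<in> hom M B A \<Longrightarrow> g \<in> hom M C B \<Longrightarrow> f \<in> Weq M \<Longrightarrow> f \<cdot> g \<in> Weq M \<Longrightarrow> g \<in> Weq M"
    by (rule Weq_cancel_left)
  show "f \<in> hom M B A \<Longrightarrow> \<exists>E. \<exists>i\<in>hom M E A. \<exists>p\<in>hom M B E. i \<in> Fib M \<inter> Weq M \<and> p \<in> Cof M \<and> i \<cdot> p = f"
    using factor_triv_fib[of f B A] by blast
  show "f \<in> hom M B A \<Longrightarrow> \<exists>E. \<exists>i\<in>hom M E A. \<exists>p\<in>hom M B E. i \<in> Fib M \<and> p \<in> Cof M \<inter> Weq M \<and> i \<cdot> p = f"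
    using factor_triv_cof[of f B A] by blast
  show "\<exists>I. terminal_object M I" by (rule ex_terminal)
  show "\<exists>I. initial_object M I" by (rule ex_initial)
  show "f \<in> hom M A D \<Longrightarrow> g \<in> hom M B D \<Longrightarrow> \<exists>u v. pullback M f g u v" by (rule ex_pullback)
  show "f \<in> hom M D A \<Longrightarrow> g \<in> hom M D B \<Longrightarrow> \<exists>u v. pushout M f g u v" by (rule ex_pushout)
  show "Weq M \<subseteq> Arr M" "Fib M \<subseteq> Arr M" "Cof M \<subseteq> Arr M" by (rule Weq_Arr Fib_Arr Cof_Arr)+
  show "retract_of (op_ms M) f g \<Longrightarrow> g \<in> Weq M \<Longrightarrow> f \<in> Weq M"
    "retract_of (op_ms M) f g \<Longrightarrow> g \<in> Cof M \<Longrightarrow> f \<in> Cof M"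
    "retract_of (op_ms M) f g \<Longrightarrow> g \<in> Fib M \<Longrightarrow> f \<in> Fib M"
    by (drule op_retract, (erule Weq_retract Cof_retract Fib_retract, assumption))+
  show "f \<in> Fib M \<inter> Weq M \<Longrightarrow> g \<in> Cof M \<Longrightarrow> lifts_against (op_ms M) f g"
    "f \<in> Fib M \<Longrightarrow> g \<in> Cof M \<inter> Weq M \<Longrightarrow> lifts_against (op_ms M) f g"
    unfolding op_lifts by (rule lift_triv_fib lift_triv_cof; assumption)+
qed

context model_cat begin

section \<open>Lifting properties\<close>

lemma arr_obj: assumes "f \<in> hom M A B" shows "A \<in> Obj M" "B \<in> Obj M"
  using assms Dom_Obj[of f] Cod_Obj[of f] by (auto simp: in_hom)

lemma lift:
  assumes "i \<in> Cof M" "p \<in> Fib M" "i \<in> Weq M \<or> p \<in> Weq M"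
    "i \<in> hom M A B" "p \<in> hom M E W" "x \<in> hom M A E" "y \<in> hom M B W" "p \<cdot> x = y \<cdot> i"
  obtains l where "l \<in> hom M B E" "l \<cdot> i = x" "p \<cdot> l = y"
proof -
  have "lifts_against M i p" using assms(1-3) lift_triv_cof lift_triv_fib by blast
  moreover have "Dom M i = A" "Cod M i = B" "Dom M p = E" "Cod M p = W" using assms by (auto simp: in_hom)
  ultimately show thesis using assms(6-8) that unfolding lifts_against_def by blast
qed

lemma factor_cof:
  assumes "f \<in> hom M A B"
  obtains E i p where "i \<in> hom M A E" "p \<in> hom M E B" "i \<in> Cof M" "p \<in> Fib M" "p \<in> Weq M" "p \<cdot> i = f"
  using factor_triv_fib[OF assms] by blast

lemma factor_fib:
  assumes "f \<in> hom M A B"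
  obtains E i p where "i \<in> hom M A E" "p \<in> hom M E B" "i \<in> Cof M" "i \<in> Weq M" "p \<in> Fib M" "p \<cdot> i = f"
  using factor_triv_cof[OF assms] by blast

lemma pushout_ex:
  assumes "f \<in> hom M Z A" "g \<in> hom M Z B"
  obtains W u v where "pushout M f g u v" "u \<in> hom M A W" "v \<in> hom M B W" "u \<cdot> f = v \<cdot> g"
  using ex_pushout[OF assms] pushout_obj[OF _ assms] by metis

text \<open>A lift of \<open>i\<close> in the square formed by \<open>p \<cdot> i\<close> and \<open>p\<close> exhibits \<open>p \<cdot> i\<close> as a retract of \<open>i\<close>. Together with the
  factorisation axioms this characterises (trivial) cofibrations by their lifting property, which gives their stability
  under composition and pushouts.\<close>
lemma retract_argument:
  assumes "i \<in> hom M A E" "p \<in> hom M E B" "l \<in> hom M B E" "l \<cdot> (p \<cdot> i) = i" "p \<cdot> l = Idt M B"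
  shows "retract_of M (p \<cdot> i) i"
proof -
  note o = arr_obj[OF assms(1)] arr_obj[OF assms(2)]
  show ?thesis
    unfolding retract_of_def
    using assms o
    by (intro conjI exI[of _ "Idt M A"] exI[of _ l] exI[of _ p]) (simp_all add: cat)
qed

lemma cof_if_llp:
  assumes f: "f \<in> hom M A B"
    and l: "\<And>E W p x y. p \<in> Fib M \<Longrightarrow> p \<in> Weq M \<Longrightarrow> p \<in> hom M E W \<Longrightarrow> x \<in> hom M A E \<Longrightarrow> y \<in> hom M B W \<Longrightarrow>
      p \<cdot> x = y \<cdot> f \<Longrightarrow> \<exists>l. l \<in> hom M B E \<and> l \<cdot> f = x \<and> p \<cdot> l = y"
  shows "f \<in> Cof M"
proof -
  obtain E i p where e: "i \<in> hom M A E" "p \<in> hom M E B" "i \<in> Cof M" "p \<in> Fib M" "p \<in> Weq M" "p \<cdot> i = f"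
    using factor_cof[OF f] .
  obtain l where "l \<in> hom M B E" "l \<cdot> f = i" "p \<cdot> l = Idt M B"
    using l[OF e(4,5,2,1), of "Idt M B"] f e arr_obj[OF f] by (auto simp: cat)
  then show ?thesis using retract_argument[of i A E p B l] e Cof_retract by auto
qed

lemma tcof_if_llp:
  assumes f: "f \<in> hom M A B"
    and l: "\<And>E W p x y. p \<in> Fib M \<Longrightarrow> p \<in> hom M E W \<Longrightarrow> x \<in> hom M A E \<Longrightarrow> y \<in> hom M B W \<Longrightarrow>
      p \<cdot> x = y \<cdot> f \<Longrightarrow> \<exists>l. l \<in> hom M B E \<and> l \<cdot> f = x \<and> p \<cdot> l = y"
  shows "f \<in> Cof M" "f \<in> Weq M"
proof -
  obtain E i p where e: "i \<in> hom M A E" "p \<in> hom M E B" "i \<in> Cof M" "i \<in> Weq M" "p \<in> Fib M" "p \<cdot> i = f"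
    using factor_fib[OF f] .
  obtain l where "l \<in> hom M B E" "l \<cdot> f = i" "p \<cdot> l = Idt M B"
    using l[OF e(5,2,1), of "Idt M B"] f e arr_obj[OF f] by (auto simp: cat)
  then show "f \<in> Cof M" "f \<in> Weq M"
    using retract_argument[of i A E p B l] e Cof_retract Weq_retract by auto
qed

lemma iso_tcof:
  assumes "f \<in> hom M A B" "g \<in> hom M B A" "g \<cdot> f = Idt M A" "f \<cdot> g = Idt M B"
  shows "f \<in> Cof M" "f \<in> Weq M"
proof -
  have *: "\<exists>l. l \<in> hom M B E \<and> l \<cdot> f = x \<and> p \<cdot> l = y"
    if "p \<in> hom M E W" "x \<in> hom M A E" "y \<in> hom M B W" "p \<cdot> x = y \<cdot> f" for E W p x y
    using assms that comp_ext[OF that(4), of g] by (intro exI[of _ "x \<cdot> g"]) (simp add: cat)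
  show "f \<in> Cof M" "f \<in> Weq M" by (rule tcof_if_llp[OF assms(1)]; use * in blast)+
qed

lemma idt_tcof: assumes "A \<in> Obj M" shows "Idt M A \<in> Cof M" "Idt M A \<in> Weq M"
  using iso_tcof[of "Idt M A" A A "Idt M A"] assms by (simp_all add: cat)

lemma lift_comp:
  assumes "f \<in> hom M A B" "g \<in> hom M B C"
    and "p \<in> hom M E W" "x \<in> hom M A E" "y \<in> hom M C W" "p \<cdot> x = y \<cdot> (g \<cdot> f)"
    and "\<And>x y. x \<in> hom M A E \<Longrightarrow> y \<in> hom M B W \<Longrightarrow> p \<cdot> x = y \<cdot> f \<Longrightarrow> \<exists>l. l \<in> hom M B E \<and> l \<cdot> f = x \<and> p \<cdot> l = y"
    and "\<And>x y. x \<in> hom M B E \<Longrightarrow> y \<in> hom M C W \<Longrightarrow> p \<cdot> x = y \<cdot> g \<Longrightarrow> \<exists>l. l \<in> hom M C E \<and> l \<cdot> g = x \<and> p \<cdot> l = y"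
  shows "\<exists>l. l \<in> hom M C E \<and> l \<cdot> (g \<cdot> f) = x \<and> p \<cdot> l = y"
proof -
  obtain l where l: "l \<in> hom M B E" "l \<cdot> f = x" "p \<cdot> l = y \<cdot> g"
    using assms(7)[of x "y \<cdot> g"] assms(1-6) by (auto simp: cat)
  obtain k where k: "k \<in> hom M C E" "k \<cdot> g = l" "p \<cdot> k = y"
    using assms(8)[OF l(1) assms(5) l(3)] by auto
  show ?thesis using k l assms(1,2) comp_ext[OF k(2), of f] by (intro exI[of _ k]) (simp add: cat)
qed

lemma cof_comp:
  assumes f: "f \<in> hom M A B" "f \<in> Cof M" and g: "g \<in> hom M B C" "g \<in> Cof M"
  shows "g \<cdot> f \<in> Cof M"
proof (rule cof_if_llp[of _ A C])
  fix E W p x y assume p: "p \<in> Fib M" "p \<in> Weq M" "p \<in> hom M E W" "x \<in> hom M A E" "y \<in> hom M C W" "p \<cdot> x = y \<cdot> (g \<cdot> f)"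
  show "\<exists>l. l \<in> hom M C E \<and> l \<cdot> (g \<cdot> f) = x \<and> p \<cdot> l = y"
    by (rule lift_comp[OF f(1) g(1) p(3-6)])
      (use lift[OF f(2) p(1) disjI2[OF p(2)] f(1) p(3)] lift[OF g(2) p(1) disjI2[OF p(2)] g(1) p(3)] in metis)+
qed (use f g in \<open>simp add: cat\<close>)

lemma lift_pushout:
  assumes P: "pushout M f g u v" and t: "u \<in> hom M A W" "v \<in> hom M B W" "f \<in> hom M Z A" "g \<in> hom M Z B"
    and l: "\<And>x y. x \<in> hom M Z E \<Longrightarrow> y \<in> hom M B V \<Longrightarrow> p \<cdot> x = y \<cdot> g \<Longrightarrow>
      \<exists>l. l \<in> hom M B E \<and> l \<cdot> g = x \<and> p \<cdot> l = y"
    and h: "p \<in> hom M E V" "x \<in> hom M A E" "y \<in> hom M W V" "p \<cdot> x = y \<cdot> u"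
  shows "\<exists>l. l \<in> hom M W E \<and> l \<cdot> u = x \<and> p \<cdot> l = y"
proof -
  have e: "u \<cdot> f = v \<cdot> g" using P by (simp add: pushout_def)
  obtain l where l: "l \<in> hom M B E" "l \<cdot> g = x \<cdot> f" "p \<cdot> l = y \<cdot> v"
    using l[of "x \<cdot> f" "y \<cdot> v"] h t comp_ext[OF h(4), of f] e by (auto simp: cat)
  obtain k where k: "k \<in> hom M W E" "k \<cdot> u = x" "k \<cdot> v = l"
    using pushout_induced[OF P t(1,2) h(2) l(1)] l(2) by metis
  have "p \<cdot> k = y"
    by (rule pushout_eqI[OF P t(1), of _ V]) (use h k t l in \<open>auto simp: cat\<close>)
  then show ?thesis using k by auto
qed

lemma cof_pushout:
  assumes P: "pushout M f g u v" and g: "g \<in> Cof M"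
  shows "u \<in> Cof M"
proof -
  obtain Z A B W where a: "f \<in> hom M Z A" "g \<in> hom M Z B" "u \<in> hom M A W" "v \<in> hom M B W" "u \<cdot> f = v \<cdot> g"
    using pushout_arr[OF P] .
  show ?thesis
  proof (rule cof_if_llp[OF a(3)])
    fix E V p x y
    assume h: "p \<in> Fib M" "p \<in> Weq M" "p \<in> hom M E V" "x \<in> hom M A E" "y \<in> hom M W V" "p \<cdot> x = y \<cdot> u"
    show "\<exists>l. l \<in> hom M W E \<and> l \<cdot> u = x \<and> p \<cdot> l = y"
      by (rule lift_pushout[OF P a(3,4,1,2) _ h(3-6)]) (use lift[OF g h(1) disjI2[OF h(2)] a(2) h(3)] in metis)
  qed
qed

lemma tcof_pushout:
  assumes P: "pushout M f g u v" and g: "g \<in> Cof M" "g \<in> Weq M"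
  shows "u \<in> Cof M" "u \<in> Weq M"
proof -
  obtain Z A B W where a: "f \<in> hom M Z A" "g \<in> hom M Z B" "u \<in> hom M A W" "v \<in> hom M B W" "u \<cdot> f = v \<cdot> g"
    using pushout_arr[OF P] .
  have *: "\<exists>l. l \<in> hom M W E \<and> l \<cdot> u = x \<and> p \<cdot> l = y"
    if h: "p \<in> Fib M" "p \<in> hom M E V" "x \<in> hom M A E" "y \<in> hom M W V" "p \<cdot> x = y \<cdot> u" for E V p x y
    by (rule lift_pushout[OF P a(3,4,1,2) _ h(2-5)]) (use lift[OF g(1) h(1) disjI1[OF g(2)] a(2) h(2)] in metis)
  show "u \<in> Cof M" "u \<in> Weq M" by (rule tcof_if_llp[OF a(3)]; use * in blast)+
qed

lemmas pushout_cofs = cof_pushout cof_pushout[OF pushout_sym] tcof_pushout tcof_pushout[OF pushout_sym]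

lemma cofibrant_obj: "cofibrant M A \<Longrightarrow> A \<in> Obj M"
  unfolding cofibrant_def using arr_obj(2) by blast

lemma initial_cof:
  assumes I: "initial_object M I" and f: "f \<in> hom M I A" and A: "cofibrant M A"
  shows "f \<in> Cof M"
proof (rule cof_if_llp[OF f])
  fix E W p x y
  assume h: "p \<in> Fib M" "p \<in> Weq M" "p \<in> hom M E W" "x \<in> hom M I E" "y \<in> hom M A W" "p \<cdot> x = y \<cdot> f"
  obtain J g where J: "initial_object M J" "g \<in> hom M J A" "g \<in> Cof M" using A unfolding cofibrant_def by auto
  have E: "E \<in> Obj M" "W \<in> Obj M" using arr_obj[OF h(3)] by auto
  obtain z where z: "z \<in> hom M J E" using J(1) E unfolding initial_object_def by blast
  have "p \<cdot> z \<in> hom M J W" "y \<cdot> g \<in> hom M J W" using z h J by (simp_all add: cat)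
  then have "p \<cdot> z = y \<cdot> g" using J(1) E unfolding initial_object_def by blast
  then obtain l where l: "l \<in> hom M A E" "p \<cdot> l = y"
    using lift[OF J(3) h(1) disjI2[OF h(2)] J(2) h(3) z h(5)] by metis
  have "l \<cdot> f \<in> hom M I E" using l f by (simp add: cat)
  then have "l \<cdot> f = x" using I h(4) E unfolding initial_object_def by blast
  with l show "\<exists>l. l \<in> hom M A E \<and> l \<cdot> f = x \<and> p \<cdot> l = y" by auto
qed

lemma cofibrant_lift:
  assumes A: "cofibrant M A" and p: "p \<in> Fib M" "p \<in> Weq M" "p \<in> hom M E W" and y: "y \<in> hom M A W"
  obtains l where "l \<in> hom M A E" "p \<cdot> l = y"
proof -
  obtain J g where J: "initial_object M J" "g \<in> hom M J A" "g \<in> Cof M" using A unfolding cofibrant_def by auto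
  have E: "E \<in> Obj M" "W \<in> Obj M" using arr_obj[OF p(3)] by auto
  obtain z where z: "z \<in> hom M J E" using J(1) E unfolding initial_object_def by blast
  have "p \<cdot> z \<in> hom M J W" "y \<cdot> g \<in> hom M J W" using z y p J by (simp_all add: cat)
  then have "p \<cdot> z = y \<cdot> g" using J(1) E unfolding initial_object_def by blast
  with lift[OF J(3) p(1) disjI2[OF p(2)] J(2) p(3) z y] that show thesis by metis
qed

lemma cofibrant_cof:
  assumes A: "cofibrant M A" and i: "i \<in> hom M A B" "i \<in> Cof M"
  shows "cofibrant M B"
proof -
  obtain J g where J: "initial_object M J" "g \<in> hom M J A" "g \<in> Cof M" using A unfolding cofibrant_def by auto
  have "i \<cdot> g \<in> hom M J B" "i \<cdot> g \<in> Cof M" using cof_comp[OF J(2,3) i] J i by (simp_all add: cat)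
  with J(1) show ?thesis unfolding cofibrant_def by blast
qed

lemma cofibrant_replacement:
  assumes "A \<in> Obj M"
  obtains Q p where "p \<in> hom M Q A" "p \<in> Fib M" "p \<in> Weq M" "cofibrant M Q"
proof -
  obtain I where I: "initial_object M I" using ex_initial by blast
  then obtain x where x: "x \<in> hom M I A" using assms unfolding initial_object_def by blast
  show thesis by (rule factor_cof[OF x]) (use that I in \<open>unfold cofibrant_def, blast\<close>)
qed

lemma weq_section:
  assumes "s \<in> hom M A B" "r \<in> hom M B A" "r \<cdot> s = Idt M A"
  shows "s \<in> Weq M \<longleftrightarrow> r \<in> Weq M"
  using Weq_cancel_left[OF assms(1,2)] Weq_cancel_right[OF assms(1,2)] assms(3)
    idt_tcof(2)[OF arr_obj(1)[OF assms(1)]] by auto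

lemma weq_left: "f \<in> hom M A B \<Longrightarrow> g \<in> hom M B C \<Longrightarrow> g \<in> Weq M \<Longrightarrow> g \<cdot> f \<in> Weq M \<longleftrightarrow> f \<in> Weq M"
  using Weq_cancel_left Weq_Comp by blast
lemma weq_right: "f \<in> hom M A B \<Longrightarrow> g \<in> hom M B C \<Longrightarrow> f \<in> Weq M \<Longrightarrow> g \<cdot> f \<in> Weq M \<longleftrightarrow> g \<in> Weq M"
  using Weq_cancel_right Weq_Comp by blast

text \<open>The dual statements, for pullbacks, fibrations and fibrant objects.\<close>
lemmas op_category = model_cat.axioms[OF op_model_cat, THEN closed_model_category.axioms(1)]
lemmas pullback_sym = category.pushout_sym[OF op_category, unfolded op_simps]
lemmas pullback_induced = category.pushout_induced[OF op_category, unfolded op_simps]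
lemmas pullback_eqI = category.pushout_eqI[OF op_category, unfolded op_simps]
lemmas pullback_ex = model_cat.pushout_ex[OF op_model_cat, unfolded op_simps]
lemmas fib_comp = model_cat.cof_comp[OF op_model_cat, unfolded op_simps]
lemmas pullback_fibs = model_cat.pushout_cofs[OF op_model_cat, unfolded op_simps]
lemmas fibrant_ext = model_cat.cofibrant_lift[OF op_model_cat, unfolded op_simps]
lemmas fibrant_fib = model_cat.cofibrant_cof[OF op_model_cat, unfolded op_simps]
lemmas fibrant_replacement = model_cat.cofibrant_replacement[OF op_model_cat, unfolded op_simps]

section \<open>Pushouts of weak equivalences\<close>

text \<open>Brown's factorisation trick: the map \<open>B \<union>\<^sub>Z B' \<rightarrow> B'\<close> given by \<open>e\<close> and the identity factors as a cofibration followed by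
  a trivial fibration \<open>r\<close>. This writes \<open>e\<close> as \<open>r \<cdot> j\<close> with a trivial cofibration \<open>j\<close> and a retraction \<open>r\<close> of a
  trivial cofibration \<open>j'\<close>, everything under \<open>Z\<close>, and pushing out along \<open>f\<close> preserves this situation.\<close>
lemma weq_pushout_under:
  assumes P: "pushout M f i u v" and P': "pushout M f i' u' v'"
    and t: "f \<in> hom M Z A" "i \<in> hom M Z B" "i' \<in> hom M Z B'" "e \<in> hom M B B'"
      "u \<in> hom M A W" "u' \<in> hom M A W'" "k \<in> hom M W W'"
    and e: "e \<cdot> i = i'" "k \<cdot> u = u'" "k \<cdot> v = v' \<cdot> e"
    and c: "i \<in> Cof M" "i' \<in> Cof M" "e \<in> Weq M"
  shows "k \<in> Weq M"
proof -
  have tv: "v \<in> hom M B W" "v' \<in> hom M B' W'" "u \<cdot> f = v \<cdot> i" "u' \<cdot> f = v' \<cdot> i'"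
    using P P' t by (auto simp: pushout_def in_hom)
  note o = arr_obj[OF t(3)] arr_obj[OF t(7)]
  obtain D p p' where D: "pushout M i i' p p'" "p \<in> hom M B D" "p' \<in> hom M B' D" "p \<cdot> i = p' \<cdot> i'"
    using pushout_ex[OF t(2,3)] .
  obtain d where d: "d \<in> hom M D B'" "d \<cdot> p = e" "d \<cdot> p' = Idt M B'"
    by (rule pushout_induced[OF D(1-3) t(4), of "Idt M B'"]) (use t e o in \<open>auto simp: cat\<close>)
  obtain N n r where n: "n \<in> hom M D N" "r \<in> hom M N B'" "n \<in> Cof M" "r \<in> Fib M" "r \<in> Weq M" "r \<cdot> n = d"
    using factor_cof[OF d(1)] .
  define j j' where "j = n \<cdot> p" and "j' = n \<cdot> p'"
  have j: "j \<in> hom M B N" "j' \<in> hom M B' N" "r \<cdot> j = e" "r \<cdot> j' = Idt M B'" "j \<cdot> i = j' \<cdot> i'"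
    using n D d t comp_ext[OF n(6)] unfolding j_def j'_def by (simp_all add: cat)
  have jc: "j \<in> Cof M" "j' \<in> Cof M"
    using cof_comp[OF D(2) _ n(1,3)] cof_comp[OF D(3) _ n(1,3)] pushout_cofs[OF D(1)] c
    unfolding j_def j'_def by blast+
  have jw: "j \<in> Weq M" "j' \<in> Weq M"
    using weq_left[OF j(1) n(2)] weq_left[OF j(2) n(2)] n(5) j c(3) idt_tcof[OF o(2)] by auto
  obtain WN a b where a: "pushout M v j a b" "a \<in> hom M W WN" "b \<in> hom M N WN" "a \<cdot> v = b \<cdot> j"
    using pushout_ex[OF tv(1) j(1)] .
  have P1: "pushout M f (j \<cdot> i) (a \<cdot> u) b"
    using pushout_sym[OF pushout_paste[OF pushout_sym[OF P] pushout_sym[OF a(1)]]] .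
  have au: "a \<cdot> u \<in> hom M A WN" and bj: "b \<cdot> j' \<in> hom M B' WN" using a t j by (auto simp: cat)
  have aub: "(a \<cdot> u) \<cdot> f = b \<cdot> (j \<cdot> i)"
    using P1 by (auto simp: pushout_def)
  obtain y where y: "y \<in> hom M W' WN" "y \<cdot> u' = a \<cdot> u" "y \<cdot> v' = b \<cdot> j'"
    by (rule pushout_induced[OF P' t(6) tv(2) au bj]) (use aub j a t in \<open>auto simp: cat\<close>)
  have "pushout M j' v' b y"
  proof (rule pushout_cancel[OF pushout_sym[OF P'] _ tv(2) a(3) j(2) y(1)])
    show "pushout M (j' \<cdot> i') f b (y \<cdot> u')" using pushout_sym[OF P1] y(2) j(5) by simp
    show "b \<cdot> j' = y \<cdot> v'" using y by simp
  qed
  then have yw: "y \<in> Weq M" using tcof_pushout[OF pushout_sym jc(2) jw(2)] by blast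
  have aw: "a \<in> Weq M" using tcof_pushout[OF a(1) jc(1) jw(1)] by blast
  have vr: "v' \<cdot> r \<in> hom M N W'" using tv n by (simp add: cat)
  have ji: "j \<cdot> i \<in> hom M Z N" using j t by (simp add: cat)
  obtain R where R: "R \<in> hom M WN W'" "R \<cdot> (a \<cdot> u) = u'" "R \<cdot> b = v' \<cdot> r"
  proof (rule pushout_induced[OF P1 au a(3) t(6) vr])
    have "(v' \<cdot> r) \<cdot> (j \<cdot> i) = v' \<cdot> (e \<cdot> i)"
      using j t n tv comp_ext[OF j(3), of i] by (simp add: cat del: j(5))
    then show "u' \<cdot> f = v' \<cdot> r \<cdot> (j \<cdot> i)" using tv e by simp
  qed blast
  have "R \<cdot> y = Idt M W'"
  proof (rule pushout_eqI[OF P' t(6), of _ W'])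
    show "(R \<cdot> y) \<cdot> u' = Idt M W' \<cdot> u'"
      using R y t a tv o by (simp add: cat)
    show "(R \<cdot> y) \<cdot> v' = Idt M W' \<cdot> v'"
      using R y t a tv o j n comp_ext[OF R(3), of j'] by (simp add: cat)
  qed (use R y o in \<open>auto simp: cat\<close>)
  then have Rw: "R \<in> Weq M" using weq_section[OF y(1) R(1)] yw by simp
  have "R \<cdot> a = k"
  proof (rule pushout_eqI[OF P t(5), of _ W'])
    show "(R \<cdot> a) \<cdot> u = k \<cdot> u" using R a t e by (simp add: cat)
    show "(R \<cdot> a) \<cdot> v = k \<cdot> v" using R a t e tv n j comp_ext[OF R(3), of j] by (simp add: cat)
  qed (use R a t in \<open>auto simp: cat\<close>)
  then show ?thesis using Weq_Comp[OF a(2) R(1) aw Rw] by simp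
qed

text \<open>Let \<open>K\<close> be the pushout of \<open>s\<close> and \<open>c \<cdot> s\<close>. The retraction \<open>K \<rightarrow> V\<close> is a weak equivalence between objects that are
  cofibrant under \<open>N\<close>, so its pushout along \<open>r\<close> is a weak equivalence by the previous lemma. Since
  \<open>r \<cdot> s\<close> is the identity, the pushout of \<open>K\<close> along \<open>r\<close> is \<open>V\<close> itself.\<close>
lemma weq_pushout_retraction:
  assumes P: "pushout M r c u v" and t: "r \<in> hom M N A" "s \<in> hom M A N" "c \<in> hom M N V" "r \<cdot> s = Idt M A"
    and c: "c \<in> Cof M" "s \<in> Cof M" "s \<in> Weq M"
  shows "v \<in> Weq M"
proof -
  note o = arr_obj[OF t(1)] arr_obj[OF t(3)]
  obtain W where tv: "u \<in> hom M A W" "v \<in> hom M V W" "u \<cdot> r = v \<cdot> c" using pushout_obj[OF P t(1,3)] .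
  have cs: "c \<cdot> s \<in> hom M A V" "c \<cdot> s \<in> Cof M" using cof_comp[OF t(2) c(2) t(3) c(1)] t by (auto simp: cat)
  obtain K sN kV where K: "pushout M s (c \<cdot> s) sN kV" "sN \<in> hom M N K" "kV \<in> hom M V K" "sN \<cdot> s = kV \<cdot> (c \<cdot> s)"
    using pushout_ex[OF t(2) cs(1)] .
  have kVw: "kV \<in> Weq M" using tcof_pushout[OF pushout_sym[OF K(1)] c(2,3)] by simp
  have sNc: "sN \<in> Cof M" using cof_pushout[OF K(1) cs(2)] .
  obtain e where e: "e \<in> hom M K V" "e \<cdot> sN = c" "e \<cdot> kV = Idt M V"
    by (rule pushout_induced[OF K(1-3) t(3), of "Idt M V"]) (use t o in \<open>auto simp: cat\<close>)
  have ew: "e \<in> Weq M" using weq_section[OF K(3) e(1,3)] kVw by simp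
  obtain W1 u1 v1 where W1: "pushout M r sN u1 v1" "u1 \<in> hom M A W1" "v1 \<in> hom M K W1" "u1 \<cdot> r = v1 \<cdot> sN"
    using pushout_ex[OF t(1) K(2)] .
  have ve: "v \<cdot> e \<in> hom M K W" using tv e by (simp add: cat)
  obtain k where k: "k \<in> hom M W1 W" "k \<cdot> u1 = u" "k \<cdot> v1 = v \<cdot> e"
    by (rule pushout_induced[OF W1(1-3) tv(1) ve]) (use tv e t K in \<open>auto simp: cat\<close>)
  have kw: "k \<in> Weq M"
    by (rule weq_pushout_under[OF W1(1) P t(1) K(2) t(3) e(1) W1(2) tv(1) k(1) e(2) k(2,3) sNc c(1) ew])
  have "pushout M (r \<cdot> s) (c \<cdot> s) u1 (v1 \<cdot> kV)" using pushout_paste[OF K(1) W1(1)] .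
  then have *: "v1 \<cdot> kV \<in> Weq M" using tcof_pushout(2)[OF pushout_sym] idt_tcof[OF o(2)] t(4) by metis
  have "v = k \<cdot> (v1 \<cdot> kV)" using k tv e W1 K comp_ext[OF k(3), of kV] by (simp add: cat)
  then show ?thesis using Weq_Comp[OF _ k(1) * kw, of V] W1 K by (auto simp: cat)
qed

lemma coproduct_pushout:
  assumes "cofibrant M A" "cofibrant M B"
  obtains I f g S a b where "initial_object M I" "f \<in> hom M I A" "g \<in> hom M I B" "pushout M f g a b" 
    "a \<in> hom M A S" "b \<in> hom M B S" "a \<in> Cof M" "b \<in> Cof M"
proof -
  obtain I where I: "initial_object M I" using ex_initial by blast
  obtain f g where fg: "f \<in> hom M I A" "g \<in> hom M I B"
    using I cofibrant_obj[OF assms(1)] cofibrant_obj[OF assms(2)] unfolding initial_object_def by blast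
  obtain S a b where S: "pushout M f g a b" "a \<in> hom M A S" "b \<in> hom M B S" using pushout_ex[OF fg] .
  have "f \<in> Cof M" "g \<in> Cof M" using initial_cof[OF I fg(1) assms(1)] initial_cof[OF I fg(2) assms(2)] .
  then show thesis using that[OF I fg S] pushout_cofs[OF S(1)] by blast
qed

lemma initial_unique: "initial_object M I \<Longrightarrow> x \<in> hom M I T \<Longrightarrow> y \<in> hom M I T \<Longrightarrow> x = y"
  unfolding initial_object_def using arr_obj(2) by blast

text \<open>Left properness, restricted to cofibrant objects. As in Brown's trick, \<open>q\<close> is a trivial cofibration followed by a
  retraction of a trivial cofibration.\<close>
lemma weq_pushout_cof:
  assumes P: "pushout M q b u v" and t: "q \<in> hom M A B" "b \<in> hom M A Y"
    and c: "q \<in> Weq M" "b \<in> Cof M" "cofibrant M A" "cofibrant M B"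
  shows "v \<in> Weq M"
proof -
  obtain W where tv: "u \<in> hom M B W" "v \<in> hom M Y W" "u \<cdot> q = v \<cdot> b" using pushout_obj[OF P t] .
  note o = arr_obj[OF t(1)]
  obtain I f g S x y where S: "initial_object M I" "f \<in> hom M I A" "g \<in> hom M I B" "pushout M f g x y" 
    "x \<in> hom M A S" "y \<in> hom M B S" "x \<in> Cof M" "y \<in> Cof M" using coproduct_pushout[OF c(3,4)] .
  obtain d where d: "d \<in> hom M S B" "d \<cdot> x = q" "d \<cdot> y = Idt M B"
    by (rule pushout_induced[OF S(4-6) t(1), of "Idt M B"])
      (use S t o initial_unique[OF S(1), of "q \<cdot> f" B g] in \<open>auto simp: cat\<close>)
  obtain N n r where n: "n \<in> hom M S N" "r \<in> hom M N B" "n \<in> Cof M" "r \<in> Fib M" "r \<in> Weq M" "r \<cdot> n = d"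
    using factor_cof[OF d(1)] .
  define j s where "j = n \<cdot> x" and "s = n \<cdot> y"
  have j: "j \<in> hom M A N" "s \<in> hom M B N" "r \<cdot> j = q" "r \<cdot> s = Idt M B"
    using n S d t comp_ext[OF n(6)] unfolding j_def s_def by (simp_all add: cat)
  have jc: "j \<in> Cof M" "s \<in> Cof M"
    using cof_comp[OF S(5,7) n(1,3)] cof_comp[OF S(6,8) n(1,3)] unfolding j_def s_def by auto
  have jw: "j \<in> Weq M" "s \<in> Weq M"
    using weq_left[OF j(1) n(2)] weq_left[OF j(2) n(2)] n(5) j c(1) idt_tcof[OF o(2)] by auto
  obtain V u1 v1 where V: "pushout M j b u1 v1" "u1 \<in> hom M N V" "v1 \<in> hom M Y V" "u1 \<cdot> j = v1 \<cdot> b"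
    using pushout_ex[OF j(1) t(2)] .
  have ur: "u \<cdot> r \<in> hom M N W" using tv n by (simp add: cat)
  obtain z where z: "z \<in> hom M V W" "z \<cdot> u1 = u \<cdot> r" "z \<cdot> v1 = v"
    by (rule pushout_induced[OF V(1-3) ur tv(2)]) (use tv n j in \<open>simp add: cat\<close>)
  have "pushout M r u1 u z"
    by (rule pushout_cancel[OF V(1) _ V(2) tv(1) n(2) z(1) z(2)[symmetric]]) (use P j z in simp)
  then have "z \<in> Weq M"
    by (rule weq_pushout_retraction[OF _ n(2) j(2) V(2) j(4) cof_pushout[OF V(1) c(2)] jc(2) jw(2)])
  moreover have "v1 \<in> Weq M" using tcof_pushout[OF pushout_sym[OF V(1)] jc(1) jw(1)] by simp
  ultimately show ?thesis using Weq_Comp[OF V(3) z(1)] z(3) by simp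
qed

end

section \<open>Homotopy cocartesian squares\<close>

text \<open>The square commutes strictly and is compared with the strict pushout. This expresses that it is a homotopy pushout
  when the objects are cofibrant and \<open>f\<close> or \<open>g\<close> is a cofibration.\<close>
definition hcocart :: "('o, 'a) model_structure \<Rightarrow> 'a \<Rightarrow> 'a \<Rightarrow> 'a \<Rightarrow> 'a \<Rightarrow> bool" where
  "hcocart M f g u v \<longleftrightarrow> (\<exists>a b W T w. pushout M f g a b \<and> a \<in> hom M (Cod M f) W \<and> w \<in> hom M W T \<and>
     w \<in> Weq M \<and> Comp M w a = u \<and> Comp M w b = v)"

definition hcart :: "('o, 'a) model_structure \<Rightarrow> 'a \<Rightarrow> 'a \<Rightarrow> 'a \<Rightarrow> 'a \<Rightarrow> bool" where
  "hcart M u v f g \<longleftrightarrow> hcocart (op_ms M) u v f g"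

lemma op_hcocart: "hcocart (op_ms M) u v f g = hcart M u v f g" "hcart (op_ms M) u v f g = hcocart M u v f g"
  by (simp_all add: hcart_def op_simps)

context model_cat begin

lemma hcocartI:
  assumes "pushout M f g a b" "a \<in> hom M A W" "w \<in> hom M W T" "w \<in> Weq M" "w \<cdot> a = u" "w \<cdot> b = v"
  shows "hcocart M f g u v"
proof -
  have "Cod M f = A" using assms(1,2) by (auto simp: pushout_def in_hom)
  then show ?thesis unfolding hcocart_def using assms by blast
qed

lemma hcocartE:
  assumes "hcocart M f g u v" "f \<in> hom M Z A" "g \<in> hom M Z B"
  obtains a b W T w where "pushout M f g a b" "a \<in> hom M A W" "b \<in> hom M B W" "a \<cdot> f = b \<cdot> g"
    "w \<in> hom M W T" "w \<in> Weq M" "w \<cdot> a = u" "w \<cdot> b = v" "u \<in> hom M A T" "v \<in> hom M B T" "u \<cdot> f = v \<cdot> g"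
proof -
  obtain a b W T w where w: "pushout M f g a b" "a \<in> hom M (Cod M f) W" "w \<in> hom M W T"
     "w \<in> Weq M" "w \<cdot> a = u" "w \<cdot> b = v" using assms(1) unfolding hcocart_def by blast
  have a: "a \<in> hom M A W" using w(2) assms(2) by (simp add: in_hom)
  obtain W' where b: "a \<in> hom M A W'" "b \<in> hom M B W'" "a \<cdot> f = b \<cdot> g" using pushout_obj[OF w(1) assms(2,3)] .
  have "W' = W" using a b by (simp add: in_hom)
  with b have b: "b \<in> hom M B W" "a \<cdot> f = b \<cdot> g" by auto
  show thesis
    by (rule that[OF w(1) a b w(3-6)]) (use w a b assms comp_ext[OF w(5), of f] in \<open>auto simp: cat\<close>)
qed

text \<open>Pushouts are unique up to isomorphism, so every strict pushout may be used to test the square.\<close>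
lemma hcocart_comparison:
  assumes H: "hcocart M f g u v" and P: "pushout M f g a b"
    and t: "f \<in> hom M Z A" "g \<in> hom M Z B" "a \<in> hom M A W" "w \<in> hom M W T" "w \<cdot> a = u" "w \<cdot> b = v"
  shows "w \<in> Weq M"
proof -
  obtain a' b' W' T' w' where w: "pushout M f g a' b'" "a' \<in> hom M A W'" "b' \<in> hom M B W'" "a' \<cdot> f = b' \<cdot> g"
    "w' \<in> hom M W' T'" "w' \<in> Weq M" "w' \<cdot> a' = u" "w' \<cdot> b' = v" "u \<in> hom M A T'" "v \<in> hom M B T'" "u \<cdot> f = v \<cdot> g"
    using hcocartE[OF H t(1,2)] .
  have tb: "b \<in> hom M B W" "a \<cdot> f = b \<cdot> g" using P t by (auto simp: pushout_def in_hom)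
  have "u \<in> hom M A T" using t(3,4) t(5)[symmetric] by (simp add: cat)
  then have T: "T' = T" using w(9) by (simp add: in_hom)
  note o = arr_obj[OF w(5)] arr_obj[OF t(4)]
  obtain k where k: "k \<in> hom M W' W" "k \<cdot> a' = a" "k \<cdot> b' = b" using pushout_induced[OF w(1-3) t(3) tb] .
  obtain l where l: "l \<in> hom M W W'" "l \<cdot> a = a'" "l \<cdot> b = b'" using pushout_induced[OF P t(3) tb(1) w(2-4)] .
  have "l \<cdot> k = Idt M W'"
    by (rule pushout_eqI[OF w(1,2), of _ W']) (use k l w o in \<open>auto simp: cat\<close>)
  moreover have "k \<cdot> l = Idt M W"
    by (rule pushout_eqI[OF P t(3), of _ W]) (use k l tb t o in \<open>auto simp: cat\<close>)
  ultimately have kw: "k \<in> Weq M" using iso_tcof[OF k(1) l(1)] by simp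
  have "w \<cdot> k = w'"
    by (rule pushout_eqI[OF w(1,2), of _ T]) (use k l w t T in \<open>auto simp: cat\<close>)
  then show ?thesis using weq_right[OF k(1) t(4) kw] w(6) by simp
qed

lemma hcocart_iff:
  assumes "pushout M f g a b" "f \<in> hom M Z A" "g \<in> hom M Z B" "a \<in> hom M A W" "w \<in> hom M W T" "w \<cdot> a = u" "w \<cdot> b = v"
  shows "hcocart M f g u v \<longleftrightarrow> w \<in> Weq M"
  using hcocart_comparison[OF _ assms] hcocartI[OF assms(1,4,5) _ assms(6,7)] by blast

lemma hcocart_sym: assumes "hcocart M f g u v" shows "hcocart M g f v u"
proof -
  obtain a b W T w where w: "pushout M f g a b" "a \<in> hom M (Cod M f) W" "w \<in> hom M W T"
     "w \<in> Weq M" "w \<cdot> a = u" "w \<cdot> b = v" using assms unfolding hcocart_def by blast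
  have "b \<in> hom M (Cod M g) W" using w(1,2) by (auto simp: pushout_def in_hom)
  then show ?thesis using hcocartI[OF pushout_sym[OF w(1)] _ w(3,4,6,5)] by blast
qed

text \<open>The object at the end of the cofibration may be replaced by a weakly equivalent one, since the pushouts are then
  weakly equivalent.\<close>
lemma hcocart_weq_under:
  assumes t: "f \<in> hom M Z A" "g \<in> hom M Z B" "e \<in> hom M B B'" "u \<in> hom M A T" "v \<in> hom M B' T" "u \<cdot> f = v \<cdot> (e \<cdot> g)"
    and c: "g \<in> Cof M" "e \<cdot> g \<in> Cof M" "e \<in> Weq M"
  shows "hcocart M f g u (v \<cdot> e) \<longleftrightarrow> hcocart M f (e \<cdot> g) u v"
proof -
  have eg: "e \<cdot> g \<in> hom M Z B'" "v \<cdot> e \<in> hom M B T" using t by (auto simp: cat)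
  obtain W a b where W: "pushout M f g a b" "a \<in> hom M A W" "b \<in> hom M B W" "a \<cdot> f = b \<cdot> g"
    using pushout_ex[OF t(1,2)] .
  obtain W' a' b' where W': "pushout M f (e \<cdot> g) a' b'" "a' \<in> hom M A W'" "b' \<in> hom M B' W'" "a' \<cdot> f = b' \<cdot> (e \<cdot> g)"
    using pushout_ex[OF t(1) eg(1)] .
  have be: "b' \<cdot> e \<in> hom M B W'" using W' t by (simp add: cat)
  obtain k where k: "k \<in> hom M W W'" "k \<cdot> a = a'" "k \<cdot> b = b' \<cdot> e"
    by (rule pushout_induced[OF W(1-3) W'(2) be]) (use W' t in \<open>simp add: cat\<close>)
  have kw: "k \<in> Weq M"
    by (rule weq_pushout_under[OF W(1) W'(1) t(1,2) eg(1) t(3) W(2) W'(2) k(1) refl k(2,3) c])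
  obtain w where w: "w \<in> hom M W' T" "w \<cdot> a' = u" "w \<cdot> b' = v"
    using pushout_induced[OF W'(1-3) t(4-6)] .
  have wk: "w \<cdot> k \<in> hom M W T" "(w \<cdot> k) \<cdot> a = u" "(w \<cdot> k) \<cdot> b = v \<cdot> e"
    using w k W W' t comp_ext[OF w(3), of e] by (simp_all add: cat)
  have "hcocart M f g u (v \<cdot> e) \<longleftrightarrow> w \<cdot> k \<in> Weq M"
    by (rule hcocart_iff[OF W(1) t(1,2) W(2) wk])
  moreover have "hcocart M f (e \<cdot> g) u v \<longleftrightarrow> w \<in> Weq M"
    by (rule hcocart_iff[OF W'(1) t(1) eg(1) W'(2) w])
  ultimately show ?thesis using weq_right[OF k(1) w(1) kw] by simp
qed

text \<open>Both conditions say that the comparison map \<open>w\<close> is a weak equivalence: the inclusion of \<open>B\<close> into the pushout is a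
  weak equivalence, and \<open>v\<close> is its composite with \<open>w\<close>.\<close>
lemma hcocart_along_weq:
  assumes t: "q \<in> hom M Z A" "b \<in> hom M Z B" "u \<in> hom M A T" "v \<in> hom M B T" "u \<cdot> q = v \<cdot> b"
    and c: "q \<in> Weq M" "b \<in> Cof M" "cofibrant M Z" "cofibrant M A"
  shows "hcocart M q b u v \<longleftrightarrow> v \<in> Weq M"
proof -
  obtain W x y where W: "pushout M q b x y" "x \<in> hom M A W" "y \<in> hom M B W" "x \<cdot> q = y \<cdot> b"
    using pushout_ex[OF t(1,2)] .
  obtain w where w: "w \<in> hom M W T" "w \<cdot> x = u" "w \<cdot> y = v" using pushout_induced[OF W(1-3) t(3-5)] .
  have y: "y \<in> Weq M" using weq_pushout_cof[OF W(1) t(1,2) c] .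
  have "hcocart M q b u v \<longleftrightarrow> w \<in> Weq M"
    by (rule hcocart_iff[OF W(1) t(1,2) W(2) w])
  then show ?thesis using weq_right[OF W(3) w(1) y] w(3) by simp
qed

lemma hcocart_cancel_pushout:
  assumes P: "pushout M f g u v" and H: "hcocart M (h \<cdot> f) g x (y \<cdot> v)"
    and t: "f \<in> hom M Z A" "g \<in> hom M Z B" "u \<in> hom M A W" "h \<in> hom M A A'" "x \<in> hom M A' T" "y \<in> hom M W T" "x \<cdot> h = y \<cdot> u"
  shows "hcocart M h u x y"
proof -
  have tv: "v \<in> hom M B W" "u \<cdot> f = v \<cdot> g" using P t by (auto simp: pushout_def in_hom)
  obtain V a b where V: "pushout M h u a b" "a \<in> hom M A' V" "b \<in> hom M W V" "a \<cdot> h = b \<cdot> u"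
    using pushout_ex[OF t(4,3)] .
  obtain w where w: "w \<in> hom M V T" "w \<cdot> a = x" "w \<cdot> b = y" using pushout_induced[OF V(1-3) t(5-7)] .
  have "w \<in> Weq M"
    by (rule hcocart_comparison[OF H pushout_paste[OF P V(1)] _ t(2) V(2) w(1,2)])
      (use t tv V w comp_ext[OF w(3), of v] in \<open>auto simp: cat\<close>)
  then show ?thesis using hcocartI[OF V(1,2) w(1) _ w(2,3)] by blast
qed

text \<open>The first square may be replaced by a strict pushout, to which the pasting law for pushouts applies.\<close>
lemma hcocart_paste:
  assumes H: "hcocart M f g u v" and H': "hcocart M h u x y"
    and t: "f \<in> hom M Z A" "g \<in> hom M Z B" "u \<in> hom M A W" "h \<in> hom M A A'"
    and c: "g \<in> Cof M" "u \<in> Cof M"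
  shows "hcocart M (h \<cdot> f) g x (y \<cdot> v)"
proof -
  obtain a b V T w where w: "pushout M f g a b" "a \<in> hom M A V" "b \<in> hom M B V" "a \<cdot> f = b \<cdot> g"
    "w \<in> hom M V T" "w \<in> Weq M" "w \<cdot> a = u" "w \<cdot> b = v" "u \<in> hom M A T" "v \<in> hom M B T" "u \<cdot> f = v \<cdot> g"
    using hcocartE[OF H t(1,2)] .
  have [simp]: "T = W" using w t by (simp add: in_hom)
  note w = w[simplified]
  obtain T' where x: "x \<in> hom M A' T'" "y \<in> hom M W T'" "x \<cdot> h = y \<cdot> u"
    using hcocartE[OF H' t(4,3)] by metis
  have "hcocart M h a x (y \<cdot> w)"
    by (rule iffD2[OF hcocart_weq_under[OF t(4) w(2) w(5) x(1,2)]])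
      (use w c x H' cof_pushout[OF w(1)] in auto)
  then obtain a' b' V' T'' w' where w': "pushout M h a a' b'" "a' \<in> hom M A' V'" "b' \<in> hom M V V'"
    "w' \<in> hom M V' T''" "w' \<in> Weq M" "w' \<cdot> a' = x" "w' \<cdot> b' = y \<cdot> w"
    using hcocartE[OF _ t(4) w(2)] by metis
  show ?thesis
    by (rule hcocartI[OF pushout_paste[OF w(1) w'(1)] w'(2,4,5,6)])
      (use w w' x comp_ext[OF w'(7), of b] in \<open>simp add: cat\<close>)
qed

lemma hcocart_cancel:
  assumes H: "hcocart M f g u v" and H': "hcocart M (h \<cdot> f) g x (y \<cdot> v)"
    and t: "f \<in> hom M Z A" "g \<in> hom M Z B" "u \<in> hom M A W" "h \<in> hom M A A'" "x \<in> hom M A' T" "y \<in> hom M W T" "x \<cdot> h = y \<cdot> u"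
    and c: "g \<in> Cof M" "u \<in> Cof M"
  shows "hcocart M h u x y"
proof -
  obtain a b V S w where w: "pushout M f g a b" "a \<in> hom M A V" "b \<in> hom M B V" "a \<cdot> f = b \<cdot> g"
    "w \<in> hom M V S" "w \<in> Weq M" "w \<cdot> a = u" "w \<cdot> b = v" "u \<in> hom M A S" "v \<in> hom M B S" "u \<cdot> f = v \<cdot> g"
    using hcocartE[OF H t(1,2)] .
  have [simp]: "S = W" using w t by (simp add: in_hom)
  note w = w[simplified]
  have yw: "y \<cdot> w \<in> hom M V T" using w t by (simp add: cat)
  have "hcocart M h a x (y \<cdot> w)"
    by (rule hcocart_cancel_pushout[OF w(1) _ t(1,2) w(2) t(4,5) yw])
      (use w t H' in \<open>simp_all add: cat\<close>)
  moreover have "hcocart M h a x (y \<cdot> w) \<longleftrightarrow> hcocart M h (w \<cdot> a) x y"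
    by (rule hcocart_weq_under[OF t(4) w(2) w(5) t(5,6)]) (use w t c cof_pushout[OF w(1)] in auto)
  ultimately show ?thesis using w(7) by simp
qed

text \<open>Pushing the cofibration \<open>A \<rightarrow> A \<union>\<^sub>Z B\<close> out along \<open>j\<close> compares the two pushouts.\<close>
lemma hcocart_weq_corner:
  assumes t: "f \<in> hom M Z A" "j \<in> hom M A A'" "g \<in> hom M Z B" "u \<in> hom M A' T" "v \<in> hom M B T" "u \<cdot> (j \<cdot> f) = v \<cdot> g"
    and c: "j \<in> Weq M" "g \<in> Cof M" "cofibrant M A" "cofibrant M A'"
  shows "hcocart M (j \<cdot> f) g u v \<longleftrightarrow> hcocart M f g (u \<cdot> j) v"
proof -
  obtain W a b where W: "pushout M f g a b" "a \<in> hom M A W" "b \<in> hom M B W" "a \<cdot> f = b \<cdot> g"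
    using pushout_ex[OF t(1,3)] .
  obtain V a' b' where V: "pushout M j a a' b'" "a' \<in> hom M A' V" "b' \<in> hom M W V" "a' \<cdot> j = b' \<cdot> a"
    using pushout_ex[OF t(2) W(2)] .
  have P: "pushout M (j \<cdot> f) g a' (b' \<cdot> b)" by (rule pushout_paste[OF W(1) V(1)])
  have bb: "b' \<cdot> b \<in> hom M B V" "j \<cdot> f \<in> hom M Z A'" using t V W by (auto simp: cat)
  obtain w where w: "w \<in> hom M V T" "w \<cdot> a' = u" "w \<cdot> (b' \<cdot> b) = v"
    using pushout_induced[OF P V(2) bb(1) t(4-6)] .
  have bw: "b' \<in> Weq M"
    using weq_pushout_cof[OF V(1) t(2) W(2) c(1) cof_pushout[OF W(1) c(2)] c(3,4)] .
  have wb: "w \<cdot> b' \<in> hom M W T" "(w \<cdot> b') \<cdot> a = u \<cdot> j" "(w \<cdot> b') \<cdot> b = v"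
    using w V W t comp_ext[OF w(2), of j] by (simp_all add: cat)
  have "hcocart M (j \<cdot> f) g u v \<longleftrightarrow> w \<in> Weq M"
    by (rule hcocart_iff[OF P bb(2) t(3) V(2) w])
  moreover have "hcocart M f g (u \<cdot> j) v \<longleftrightarrow> w \<cdot> b' \<in> Weq M"
    by (rule hcocart_iff[OF W(1) t(1,3) W(2) wb])
  ultimately show ?thesis using weq_right[OF V(3) w(1) bw] by simp
qed

lemmas hcartI = model_cat.hcocartI[OF op_model_cat, unfolded op_simps op_hcocart]
lemmas hcartE = model_cat.hcocartE[OF op_model_cat, unfolded op_simps op_hcocart]
lemmas hcart_sym = model_cat.hcocart_sym[OF op_model_cat, unfolded op_simps op_hcocart]
lemmas hcart_weq_over = model_cat.hcocart_weq_under[OF op_model_cat, unfolded op_simps op_hcocart]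
lemmas hcart_along_weq = model_cat.hcocart_along_weq[OF op_model_cat, unfolded op_simps op_hcocart]
lemmas hcart_paste = model_cat.hcocart_paste[OF op_model_cat, unfolded op_simps op_hcocart]
lemmas hcart_cancel = model_cat.hcocart_cancel[OF op_model_cat, unfolded op_simps op_hcocart]
lemmas hcart_weq_corner = model_cat.hcocart_weq_corner[OF op_model_cat, unfolded op_simps op_hcocart]

section \<open>Homotopies\<close>

lemma cylinderE:
  assumes "is_cylinder M A C"
  obtains I where "cylp C \<in> hom M I A" "cyl0 C \<in> hom M A I" "cyl1 C \<in> hom M A I"
    "cylp C \<cdot> cyl0 C = Idt M A" "cylp C \<cdot> cyl1 C = Idt M A" "cylp C \<in> Weq M" "cylp C \<in> Fib M"
    "cyl0 C \<in> Weq M" "cyl1 C \<in> Weq M"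
proof -
  have c: "cylp C \<in> hom M (Cyl M C) A" "cyl0 C \<in> hom M A (Cyl M C)" "cyl1 C \<in> hom M A (Cyl M C)"
    "cylp C \<cdot> cyl0 C = Idt M A" "cylp C \<cdot> cyl1 C = Idt M A" "cylp C \<in> Weq M" "cylp C \<in> Fib M"
    using assms unfolding is_cylinder_def by blast+
  show thesis by (rule that[OF c]) (use weq_section c in blast)+
qed

lemma cylinder_boundary:
  assumes C: "is_cylinder M A C" and p: "cylp C \<in> hom M I A"
  obtains S i j d where "i \<in> hom M A S" "j \<in> hom M A S" "d \<in> hom M S I" "d \<in> Cof M"
    "d \<cdot> i = cyl0 C" "d \<cdot> j = cyl1 C"
    "\<forall>T x y. x \<in> hom M A T \<longrightarrow> y \<in> hom M A T \<longrightarrow> (\<exists>t. t \<in> hom M S T \<and> t \<cdot> i = x \<and> t \<cdot> j = y)"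
    "\<forall>T s t. s \<in> hom M S T \<longrightarrow> t \<in> hom M S T \<longrightarrow> s \<cdot> i = t \<cdot> i \<longrightarrow> s \<cdot> j = t \<cdot> j \<longrightarrow> s = t"
proof -
  have [simp]: "Cyl M C = I" using p by (simp add: in_hom)
  obtain S i j d where S: "coproduct M A A S i j" "d \<in> hom M S I" "d \<in> Cof M" "d \<cdot> i = cyl0 C" "d \<cdot> j = cyl1 C"
    using C unfolding is_cylinder_def by auto
  have ij: "i \<in> hom M A S" "j \<in> hom M A S"
    and u: "\<And>T x y. x \<in> hom M A T \<Longrightarrow> y \<in> hom M A T \<Longrightarrow> \<exists>!t. t \<in> hom M S T \<and> t \<cdot> i = x \<and> t \<cdot> j = y"
    using S(1) unfolding coproduct_def by blast+
  show thesis
  proof (rule that[OF ij S(2-5)])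
    show "\<forall>T x y. x \<in> hom M A T \<longrightarrow> y \<in> hom M A T \<longrightarrow> (\<exists>t. t \<in> hom M S T \<and> t \<cdot> i = x \<and> t \<cdot> j = y)"
      using u by blast
    show "\<forall>T s t. s \<in> hom M S T \<longrightarrow> t \<in> hom M S T \<longrightarrow> s \<cdot> i = t \<cdot> i \<longrightarrow> s \<cdot> j = t \<cdot> j \<longrightarrow> s = t"
    proof (intro allI impI)
      fix T s t assume *: "s \<in> hom M S T" "t \<in> hom M S T" "s \<cdot> i = t \<cdot> i" "s \<cdot> j = t \<cdot> j"
      have "t \<cdot> i \<in> hom M A T" "t \<cdot> j \<in> hom M A T" using * ij by (auto simp: cat)
      then show "s = t" using u[of "t \<cdot> i" T "t \<cdot> j"] * by blast
    qed
  qed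
qed

text \<open>Maps on a cylinder lift along trivial fibrations with prescribed ends, because the inclusion \<open>d\<close> of the ends is a
  cofibration.\<close>
lemma cylinder_lift:
  assumes C: "is_cylinder M A C" and I: "cylp C \<in> hom M I A"
    and p: "p \<in> Fib M" "p \<in> Weq M" "p \<in> hom M E W"
    and t: "x \<in> hom M A E" "y \<in> hom M A E" "k \<in> hom M I W" "p \<cdot> x = k \<cdot> cyl0 C" "p \<cdot> y = k \<cdot> cyl1 C"
  obtains l where "l \<in> hom M I E" "l \<cdot> cyl0 C = x" "l \<cdot> cyl1 C = y" "p \<cdot> l = k"
proof -
  obtain S i j d where S: "i \<in> hom M A S" "j \<in> hom M A S" "d \<in> hom M S I" "d \<in> Cof M"
    "d \<cdot> i = cyl0 C" "d \<cdot> j = cyl1 C"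
    and ex0: "\<forall>T x y. x \<in> hom M A T \<longrightarrow> y \<in> hom M A T \<longrightarrow> (\<exists>t. t \<in> hom M S T \<and> t \<cdot> i = x \<and> t \<cdot> j = y)"
    and un0: "\<forall>T s t. s \<in> hom M S T \<longrightarrow> t \<in> hom M S T \<longrightarrow> s \<cdot> i = t \<cdot> i \<longrightarrow> s \<cdot> j = t \<cdot> j \<longrightarrow> s = t"
    using cylinder_boundary[OF C I] .
  note ex = ex0[rule_format] and un = un0[rule_format]
  obtain z where z: "z \<in> hom M S E" "z \<cdot> i = x" "z \<cdot> j = y" using ex[OF t(1,2)] by blast
  have "p \<cdot> z = k \<cdot> d"
    by (rule un[of _ W]) (use z t p S in \<open>auto simp: cat\<close>)
  from lift[OF S(4) p(1) disjI2[OF p(2)] S(3) p(3) z(1) t(3) this]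
  obtain l where l: "l \<in> hom M I E" "l \<cdot> d = z" "p \<cdot> l = k" .
  have "l \<cdot> cyl0 C = x" "l \<cdot> cyl1 C = y"
    unfolding S(5,6)[symmetric] using l z S comp_ext[OF l(2), of i] comp_ext[OF l(2), of j] by (auto simp: cat)
  then show thesis using that l by blast
qed

lemma cylinder_cof:
  assumes C: "is_cylinder M A C" and A: "cofibrant M A"
  shows "cyl0 C \<in> Cof M" "cyl1 C \<in> Cof M"
proof -
  obtain I where "cylp C \<in> hom M I A" using cylinderE[OF C] .
  from cylinder_boundary[OF C this] obtain S i j d where S: "i \<in> hom M A S" "j \<in> hom M A S" "d \<in> hom M S I" "d \<in> Cof M"
    "d \<cdot> i = cyl0 C" "d \<cdot> j = cyl1 C"
    and ex0: "\<forall>T x y. x \<in> hom M A T \<longrightarrow> y \<in> hom M A T \<longrightarrow> (\<exists>t. t \<in> hom M S T \<and> t \<cdot> i = x \<and> t \<cdot> j = y)"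
    and un0: "\<forall>T s t. s \<in> hom M S T \<longrightarrow> t \<in> hom M S T \<longrightarrow> s \<cdot> i = t \<cdot> i \<longrightarrow> s \<cdot> j = t \<cdot> j \<longrightarrow> s = t" .
  note ex = ex0[rule_format] and un = un0[rule_format]
  \<comment> \<open>An inclusion into the coproduct of two copies of \<open>A\<close> has the lifting property because a lift on the
    other copy exists by cofibrancy of \<open>A\<close>.\<close>
  have *: "i \<in> Cof M"
    if ij: "i \<in> hom M A S" "j \<in> hom M A S"
      and ex: "\<And>T x y. x \<in> hom M A T \<Longrightarrow> y \<in> hom M A T \<Longrightarrow> \<exists>t. t \<in> hom M S T \<and> t \<cdot> i = x \<and> t \<cdot> j = y"
      and un: "\<And>T s t. s \<in> hom M S T \<Longrightarrow> t \<in> hom M S T \<Longrightarrow> s \<cdot> i = t \<cdot> i \<Longrightarrow> s \<cdot> j = t \<cdot> j \<Longrightarrow> s = t" for i j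
  proof (rule cof_if_llp[OF ij(1)])
    fix E W p x y
    assume h: "p \<in> Fib M" "p \<in> Weq M" "p \<in> hom M E W" "x \<in> hom M A E" "y \<in> hom M S W" "p \<cdot> x = y \<cdot> i"
    have "y \<cdot> j \<in> hom M A W" using h ij by (simp add: cat)
    from cofibrant_lift[OF A h(1-3) this] obtain z where z: "z \<in> hom M A E" "p \<cdot> z = y \<cdot> j" .
    obtain l where l: "l \<in> hom M S E" "l \<cdot> i = x" "l \<cdot> j = z" using ex[OF h(4) z(1)] by blast
    have "p \<cdot> l = y"
      by (rule un[of _ W]) (use h z l ij in \<open>auto simp: cat\<close>)
    with l show "\<exists>l. l \<in> hom M S E \<and> l \<cdot> i = x \<and> p \<cdot> l = y" by blast
  qed
  have "i \<in> Cof M" by (rule *[OF S(1,2) ex un])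
  then show "cyl0 C \<in> Cof M" using cof_comp[OF S(1) _ S(3,4)] S(5) by simp
  have "j \<in> Cof M" by (rule *[OF S(2,1)]) (use ex un in metis)+
  then show "cyl1 C \<in> Cof M" using cof_comp[OF S(2) _ S(3,4)] S(6) by simp
qed

lemma cylinder_ex:
  assumes A: "A \<in> Obj M"
  obtains C where "is_cylinder M A C"
proof -
  obtain I where I: "initial_object M I" using ex_initial by blast
  obtain f where f: "f \<in> hom M I A" using I A unfolding initial_object_def by blast
  obtain S i j where S: "pushout M f f i j" "i \<in> hom M A S" "j \<in> hom M A S" using pushout_ex[OF f f] .
  have co: "coproduct M A A S i j"
    unfolding coproduct_def
  proof (intro conjI allI ballI S)
    fix T x y assume h: "x \<in> hom M A T" "y \<in> hom M A T"
    have "x \<cdot> f = y \<cdot> f" by (rule initial_unique[OF I]) (use h f in \<open>auto simp: cat\<close>)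
    from pushout_induced[OF S h this] obtain t where t: "t \<in> hom M S T" "t \<cdot> i = x" "t \<cdot> j = y" .
    show "\<exists>!t. t \<in> hom M S T \<and> t \<cdot> i = x \<and> t \<cdot> j = y"
      by (rule ex1I[of _ t]) (use t pushout_eqI[OF S(1,2)] in auto)
  qed
  obtain c where c: "c \<in> hom M S A" "c \<cdot> i = Idt M A" "c \<cdot> j = Idt M A"
    by (rule pushout_induced[OF S Idt_hom[OF A] Idt_hom[OF A]]) simp
  obtain E d p where e: "d \<in> hom M S E" "p \<in> hom M E A" "d \<in> Cof M" "p \<in> Fib M" "p \<in> Weq M" "p \<cdot> d = c"
    using factor_cof[OF c(1)] .
  have di: "d \<cdot> i \<in> hom M A E" "d \<cdot> j \<in> hom M A E" "p \<cdot> (d \<cdot> i) = Idt M A" "p \<cdot> (d \<cdot> j) = Idt M A"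
    using e S c comp_ext[OF e(6)] by (auto simp: cat)
  have E: "Dom M p = E" using e(2) by (simp add: in_hom)
  have "is_cylinder M A \<lparr>cyl0 = d \<cdot> i, cyl1 = d \<cdot> j, cylp = p\<rparr>"
    unfolding is_cylinder_def using e di co by (auto simp: E)
  then show thesis by (rule that)
qed

lemma homotopyI:
  assumes "is_cylinder M A C" "cylp C \<in> hom M I A" "h \<in> hom M I X" "h \<cdot> cyl0 C = f" "h \<cdot> cyl1 C = g"
  shows "homotopy M C h f g"
proof -
  obtain J where J: "cylp C \<in> hom M J A" "cyl0 C \<in> hom M A J" "cyl1 C \<in> hom M A J" using cylinderE[OF assms(1)] .
  have "J = I" using J assms by (simp add: in_hom)
  then have "f \<in> hom M A X" "g \<in> hom M A X" "Dom M (cylp C) = I"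
    using J assms by (auto simp: cat simp flip: assms(4,5))
  then show "homotopy M C h f g" using assms by (auto simp: homotopy_def in_hom)
qed

lemma homotopicI:
  assumes "is_cylinder M A C" "cylp C \<in> hom M I A" "h \<in> hom M I X" "h \<cdot> cyl0 C = f" "h \<cdot> cyl1 C = g"
  shows "homotopic M f g"
  using homotopyI[OF assms] unfolding homotopic_def by blast

lemma homotopicE:
  assumes "homotopic M f g" "f \<in> hom M A X"
  obtains C I h where "is_cylinder M A C" "cylp C \<in> hom M I A" "cyl0 C \<in> hom M A I" "cyl1 C \<in> hom M A I"
    "h \<in> hom M I X" "h \<cdot> cyl0 C = f" "h \<cdot> cyl1 C = g"
proof -
  have [simp]: "Dom M f = A" "Cod M f = X" using assms by (auto simp: in_hom)
  obtain C h where h: "is_cylinder M A C" "h \<in> hom M (Cyl M C) X" "h \<cdot> cyl0 C = f" "h \<cdot> cyl1 C = g"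
    using assms unfolding homotopic_def homotopy_def by auto
  obtain J where J: "cylp C \<in> hom M J A" "cyl0 C \<in> hom M A J" "cyl1 C \<in> hom M A J" using cylinderE[OF h(1)] .
  show thesis by (rule that[OF h(1) J]) (use h J in \<open>auto simp: in_hom\<close>)
qed

lemma homotopic_hom: "homotopic M f g \<Longrightarrow> f \<in> hom M A X \<Longrightarrow> g \<in> hom M A X"
  by (auto simp: homotopic_def homotopy_def in_hom)

lemma cylinder_map_ex:
  assumes C: "is_cylinder M A C" "cylp C \<in> hom M I A" and D: "is_cylinder M B D" "cylp D \<in> hom M J B"
    and a: "a \<in> hom M A B"
  obtains m where "m \<in> hom M I J" "m \<cdot> cyl0 C = cyl0 D \<cdot> a" "m \<cdot> cyl1 C = cyl1 D \<cdot> a" "cylp D \<cdot> m = a \<cdot> cylp C"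
proof -
  obtain I' where c: "cylp C \<in> hom M I' A" "cyl0 C \<in> hom M A I'" "cyl1 C \<in> hom M A I'"
    "cylp C \<cdot> cyl0 C = Idt M A" "cylp C \<cdot> cyl1 C = Idt M A" using cylinderE[OF C(1)] .
  have [simp]: "I' = I" using c C by (simp add: in_hom)
  obtain J' where d: "cylp D \<in> hom M J' B" "cyl0 D \<in> hom M B J'" "cyl1 D \<in> hom M B J'"
    "cylp D \<cdot> cyl0 D = Idt M B" "cylp D \<cdot> cyl1 D = Idt M B" "cylp D \<in> Weq M" "cylp D \<in> Fib M"
    using cylinderE[OF D(1)] .
  have [simp]: "J' = J" using d D by (simp add: in_hom)
  show thesis
    by (rule cylinder_lift[OF C d(7,6) D(2), of "cyl0 D \<cdot> a" "cyl1 D \<cdot> a" "a \<cdot> cylp C"])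
      (use that c d a comp_ext[OF d(4), of a] comp_ext[OF d(5), of a] in \<open>auto simp: cat\<close>)
qed

lemma homotopic_on:
  assumes h: "homotopic M f g" "f \<in> hom M A X" and C: "is_cylinder M A C" "cylp C \<in> hom M I A"
  obtains h where "h \<in> hom M I X" "h \<cdot> cyl0 C = f" "h \<cdot> cyl1 C = g"
proof -
  obtain D J k where D: "is_cylinder M A D" "cylp D \<in> hom M J A" "cyl0 D \<in> hom M A J" "cyl1 D \<in> hom M A J"
    "k \<in> hom M J X" "k \<cdot> cyl0 D = f" "k \<cdot> cyl1 D = g" using homotopicE[OF h] .
  have A: "A \<in> Obj M" using arr_obj h by blast
  obtain I' where c: "cylp C \<in> hom M I' A" "cyl0 C \<in> hom M A I'" "cyl1 C \<in> hom M A I'" using cylinderE[OF C(1)] .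
  have [simp]: "I' = I" using c C by (simp add: in_hom)
  obtain m where m: "m \<in> hom M I J" "m \<cdot> cyl0 C = cyl0 D \<cdot> Idt M A" "m \<cdot> cyl1 C = cyl1 D \<cdot> Idt M A"
    using cylinder_map_ex[OF C D(1,2) Idt_hom[OF A]] .
  show thesis by (rule that[of "k \<cdot> m"]) (use m D c A in \<open>auto simp: cat\<close>)
qed

lemma homotopic_refl: assumes "f \<in> hom M A X" shows "homotopic M f f"
proof -
  obtain C where C: "is_cylinder M A C" using cylinder_ex arr_obj(1)[OF assms] .
  obtain I where c: "cylp C \<in> hom M I A" "cyl0 C \<in> hom M A I" "cyl1 C \<in> hom M A I"
    "cylp C \<cdot> cyl0 C = Idt M A" "cylp C \<cdot> cyl1 C = Idt M A" using cylinderE[OF C] .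
  show ?thesis by (rule homotopicI[OF C c(1), of "f \<cdot> cylp C"]) (use c assms in \<open>auto simp: cat\<close>)
qed

lemma homotopic_post:
  assumes h: "homotopic M f g" "f \<in> hom M A X" and e: "e \<in> hom M X Y"
  shows "homotopic M (e \<cdot> f) (e \<cdot> g)"
proof -
  obtain D J k where D: "is_cylinder M A D" "cylp D \<in> hom M J A" "cyl0 D \<in> hom M A J" "cyl1 D \<in> hom M A J"
    "k \<in> hom M J X" "k \<cdot> cyl0 D = f" "k \<cdot> cyl1 D = g" using homotopicE[OF h] .
  show ?thesis by (rule homotopicI[OF D(1,2), of "e \<cdot> k"]) (use D e in \<open>auto simp: cat\<close>)
qed

lemma homotopic_pre:
  assumes h: "homotopic M f g" "f \<in> hom M A X" and e: "e \<in> hom M B A"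
  shows "homotopic M (f \<cdot> e) (g \<cdot> e)"
proof -
  obtain D J k where D: "is_cylinder M A D" "cylp D \<in> hom M J A" "cyl0 D \<in> hom M A J" "cyl1 D \<in> hom M A J"
    "k \<in> hom M J X" "k \<cdot> cyl0 D = f" "k \<cdot> cyl1 D = g" using homotopicE[OF h] .
  obtain C where C: "is_cylinder M B C" using cylinder_ex arr_obj(1)[OF e] .
  obtain I where c: "cylp C \<in> hom M I B" "cyl0 C \<in> hom M B I" "cyl1 C \<in> hom M B I" using cylinderE[OF C] .
  obtain m where m: "m \<in> hom M I J" "m \<cdot> cyl0 C = cyl0 D \<cdot> e" "m \<cdot> cyl1 C = cyl1 D \<cdot> e"
    using cylinder_map_ex[OF C c(1) D(1,2) e] .
  show ?thesis
    by (rule homotopicI[OF C c(1), of "k \<cdot> m"])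
      (use D e m c comp_ext[OF D(6), of e] comp_ext[OF D(7), of e] in \<open>auto simp: cat\<close>)
qed

lemma homotopic_sym: assumes h: "homotopic M f g" shows "homotopic M g f"
proof -
  obtain A X where f: "f \<in> hom M A X" using h by (auto simp: homotopic_def homotopy_def in_hom)
  obtain D J k where D: "is_cylinder M A D" "cylp D \<in> hom M J A" "cyl0 D \<in> hom M A J" "cyl1 D \<in> hom M A J"
    "k \<in> hom M J X" "k \<cdot> cyl0 D = f" "k \<cdot> cyl1 D = g" using homotopicE[OF h f] .
  obtain J' where d: "cylp D \<in> hom M J' A" "cylp D \<cdot> cyl0 D = Idt M A" "cylp D \<cdot> cyl1 D = Idt M A"
    "cylp D \<in> Weq M" "cylp D \<in> Fib M" using cylinderE[OF D(1)] .
  obtain m where m: "m \<in> hom M J J" "m \<cdot> cyl0 D = cyl1 D" "m \<cdot> cyl1 D = cyl0 D"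
    by (rule cylinder_lift[OF D(1,2) d(5,4) D(2,4,3,2)]) (use d in auto)
  show ?thesis by (rule homotopicI[OF D(1,2), of "k \<cdot> m"]) (use D m in \<open>auto simp: cat\<close>)
qed

lemma homotopic_weq:
  assumes h: "homotopic M f g" and f: "f \<in> Weq M" shows "g \<in> Weq M"
proof -
  obtain A X where fh: "f \<in> hom M A X" using h by (auto simp: homotopic_def homotopy_def in_hom)
  obtain D J k where D: "is_cylinder M A D" "cylp D \<in> hom M J A" "cyl0 D \<in> hom M A J" "cyl1 D \<in> hom M A J"
    "k \<in> hom M J X" "k \<cdot> cyl0 D = f" "k \<cdot> cyl1 D = g" using homotopicE[OF h fh] .
  have w: "cyl0 D \<in> Weq M" "cyl1 D \<in> Weq M" using cylinderE[OF D(1)] by metis+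
  show ?thesis using weq_right[OF D(3,5) w(1)] weq_right[OF D(4,5) w(2)] D f by simp
qed

text \<open>Left homotopies \<open>x \<sim> f\<close> and \<open>x \<sim> g\<close> form a map from the cylinder of \<open>A\<close> to \<open>X \<times> X\<close>. It lifts to the path
  object of \<open>X\<close>, starting with the constant path at \<open>x\<close>: the inclusion \<open>cyl0\<close> is a trivial cofibration and the evaluation of paths
  at their ends is a fibration. The lift ends with a right homotopy \<open>f \<sim> g\<close>. Both the passage from left to right
  homotopies and transitivity are special cases.\<close>
lemma right_homotopic_span:
  assumes f: "homotopic M x f" and g: "homotopic M x g" and x: "x \<in> hom M A X" and A: "cofibrant M A"
  shows "homotopic (op_ms M) f g"
proof -
  have fg: "f \<in> hom M A X" "g \<in> hom M A X" using homotopic_hom[OF f x] homotopic_hom[OF g x] .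
  obtain C I H where C: "is_cylinder M A C" "cylp C \<in> hom M I A" "cyl0 C \<in> hom M A I" "cyl1 C \<in> hom M A I"
    "H \<in> hom M I X" "H \<cdot> cyl0 C = x" "H \<cdot> cyl1 C = f" using homotopicE[OF f x] .
  obtain K where K: "K \<in> hom M I X" "K \<cdot> cyl0 C = x" "K \<cdot> cyl1 C = g" using homotopic_on[OF g x C(1,2)] .
  interpret op: model_cat "op_ms M" by (rule op_model_cat)
  have X: "X \<in> Obj M" using arr_obj[OF x] by simp
  obtain P where P: "is_cylinder (op_ms M) X P" using op.cylinder_ex[of X] X unfolding op_simps by blast
  obtain J where p: "cylp P \<in> hom M X J" "cyl0 P \<in> hom M J X" "cyl1 P \<in> hom M J X"
    "cyl0 P \<cdot> cylp P = Idt M X" "cyl1 P \<cdot> cylp P = Idt M X" using op.cylinderE[OF P] unfolding op_simps by metis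
  obtain S i j d where S: "i \<in> hom M S X" "j \<in> hom M S X" "d \<in> hom M J S" "d \<in> Fib M"
    "i \<cdot> d = cyl0 P" "j \<cdot> d = cyl1 P"
    and ex0: "\<forall>T x y. x \<in> hom M T X \<longrightarrow> y \<in> hom M T X \<longrightarrow> (\<exists>t. t \<in> hom M T S \<and> i \<cdot> t = x \<and> j \<cdot> t = y)"
    and un0: "\<forall>T s t. s \<in> hom M T S \<longrightarrow> t \<in> hom M T S \<longrightarrow> i \<cdot> s = i \<cdot> t \<longrightarrow> j \<cdot> s = j \<cdot> t \<longrightarrow> s = t"
    using op.cylinder_boundary[OF P, unfolded op_simps, OF p(1)] .
  note ex = ex0[rule_format] and un = un0[rule_format]
  obtain b where b: "b \<in> hom M I S" "i \<cdot> b = H" "j \<cdot> b = K" using ex[OF C(5) K(1)] by blast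
  have sx: "cylp P \<cdot> x \<in> hom M A J" using p x by (simp add: cat)
  have "d \<cdot> (cylp P \<cdot> x) = b \<cdot> cyl0 C"
    by (rule un[of _ A])
      (use S p x b C K X comp_ext[OF S(5)] comp_ext[OF S(6)] comp_ext[OF b(2)] comp_ext[OF b(3)]
        comp_ext[OF p(4)] comp_ext[OF p(5)] in \<open>auto simp: cat\<close>)
  then obtain k where k: "k \<in> hom M I J" "d \<cdot> k = b"
    using lift[OF cylinder_cof(1)[OF C(1) A] S(4) disjI1 C(3) S(3) sx b(1)] cylinderE[OF C(1)] by metis
  have k0: "cyl0 P \<cdot> (k \<cdot> cyl1 C) = f"
    using S k b C comp_ext[OF S(5), of "k \<cdot> cyl1 C"] comp_ext[OF k(2)] comp_ext[OF b(2)] by (auto simp: cat)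
  have k1: "cyl1 P \<cdot> (k \<cdot> cyl1 C) = g"
    using S k b C K comp_ext[OF S(6), of "k \<cdot> cyl1 C"] comp_ext[OF k(2)] comp_ext[OF b(3)] by (auto simp: cat)
  show ?thesis
    by (rule op.homotopicI[OF P, unfolded op_simps, OF p(1) _ k0 k1]) (use k C in \<open>auto simp: cat\<close>)
qed

lemma left_to_right:
  assumes "homotopic M f g" "f \<in> hom M A X" "cofibrant M A"
  shows "homotopic (op_ms M) f g"
  using right_homotopic_span[OF homotopic_refl assms(1)] assms by blast

lemma right_to_left:
  assumes "homotopic (op_ms M) f g" "f \<in> hom M A X" "fibrant M X"
  shows "homotopic M f g"
  using model_cat.left_to_right[OF op_model_cat, unfolded op_simps, OF assms] .

lemma homotopic_trans:
  assumes "homotopic M f g" "homotopic M g h" "f \<in> hom M A X" "cofibrant M A" "fibrant M X"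
  shows "homotopic M f h"
proof -
  have "homotopic (op_ms M) f h"
    by (rule right_homotopic_span[OF homotopic_sym[OF assms(1)] assms(2) homotopic_hom[OF assms(1,3)] assms(4)])
  then show ?thesis using right_to_left assms by blast
qed

lemma homotopy_lifting:
  assumes "homotopic M (p \<cdot> x) y" "p \<in> Fib M" "p \<in> hom M E W" "x \<in> hom M A E" "cofibrant M A"
  obtains x' where "x' \<in> hom M A E" "p \<cdot> x' = y" "homotopic M x x'"
proof -
  have px: "p \<cdot> x \<in> hom M A W" using assms by (simp add: cat)
  obtain C I H where C: "is_cylinder M A C" "cylp C \<in> hom M I A" "cyl0 C \<in> hom M A I" "cyl1 C \<in> hom M A I"
    "H \<in> hom M I W" "H \<cdot> cyl0 C = p \<cdot> x" "H \<cdot> cyl1 C = y" using homotopicE[OF assms(1) px] .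
  obtain l where l: "l \<in> hom M I E" "l \<cdot> cyl0 C = x" "p \<cdot> l = H"
    using lift[OF cylinder_cof(1)[OF C(1) assms(5)] assms(2) disjI1 C(3) assms(3,4) C(5)] C(6) cylinderE[OF C(1)] by metis
  show thesis
    by (rule that[of "l \<cdot> cyl1 C"])
      (use l C assms comp_ext[OF l(3)] homotopicI[OF C(1,2) l(1,2) refl] in \<open>auto simp: cat\<close>)
qed

text \<open>Extension of homotopies along a cofibration is dual to lifting along a fibration; it thus holds for right homotopies, and
  the assumptions allow to pass between the two notions.\<close>
lemma homotopy_extension:
  assumes h: "homotopic M (x \<cdot> i) y" "i \<in> Cof M" "i \<in> hom M A B" "x \<in> hom M B X"
    and c: "cofibrant M A" "fibrant M X"
  obtains x' where "x' \<in> hom M B X" "x' \<cdot> i = y" "homotopic M x x'"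
proof -
  have "homotopic (op_ms M) (x \<cdot> i) y" using left_to_right[OF h(1) _ c(1), of X] h by (simp add: cat)
  from model_cat.homotopy_lifting[OF op_model_cat, unfolded op_simps, OF this h(2-4) c(2)]
  obtain x' where "x' \<in> hom M B X" "x' \<cdot> i = y" "homotopic (op_ms M) x x'" .
  then show thesis using that right_to_left[OF _ h(4) c(2)] by blast
qed

text \<open>The map \<open>e\<close> factors as a trivial cofibration, which has a retraction since \<open>G\<close> is fibrant, and a trivial
  fibration, along which homotopies lift.\<close>
lemma homotopic_cancel_left:
  assumes h: "homotopic M (e \<cdot> x) (e \<cdot> y)" and t: "e \<in> hom M G E" "e \<in> Weq M" "x \<in> hom M A G" "y \<in> hom M A G"
    and G: "fibrant M G"
  shows "homotopic M x y"
proof -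
  obtain D k p where e: "k \<in> hom M G D" "p \<in> hom M D E" "k \<in> Cof M" "k \<in> Weq M" "p \<in> Fib M" "p \<cdot> k = e"
    using factor_fib[OF t(1)] .
  have pw: "p \<in> Weq M" using weq_right[OF e(1,2,4)] e t by simp
  have ex: "e \<cdot> x \<in> hom M A E" using t by (simp add: cat)
  obtain C I H where C: "is_cylinder M A C" "cylp C \<in> hom M I A" "cyl0 C \<in> hom M A I" "cyl1 C \<in> hom M A I"
    "H \<in> hom M I E" "H \<cdot> cyl0 C = e \<cdot> x" "H \<cdot> cyl1 C = e \<cdot> y" using homotopicE[OF h ex] .
  have kx: "k \<cdot> x \<in> hom M A D" "k \<cdot> y \<in> hom M A D" using e t by (auto simp: cat)
  obtain l where l: "l \<in> hom M I D" "l \<cdot> cyl0 C = k \<cdot> x" "l \<cdot> cyl1 C = k \<cdot> y"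
    by (rule cylinder_lift[OF C(1,2) e(5) pw e(2) kx C(5)]) (use e t C comp_ext[OF e(6)] in \<open>auto simp: cat\<close>)
  have "homotopic M (k \<cdot> x) (k \<cdot> y)" by (rule homotopicI[OF C(1,2) l])
  moreover obtain r where r: "r \<in> hom M D G" "r \<cdot> k = Idt M G"
    using fibrant_ext[OF G e(3,4,1) Idt_hom] arr_obj[OF t(1)] by metis
  ultimately have "homotopic M (r \<cdot> (k \<cdot> x)) (r \<cdot> (k \<cdot> y))" using homotopic_post kx by blast
  then show ?thesis using r t e comp_ext[OF r(2), of x] comp_ext[OF r(2), of y] arr_obj[OF t(1)] by (auto simp: cat)
qed

lemma homotopic_cancel_right:
  assumes h: "homotopic M (x \<cdot> e) (y \<cdot> e)" and t: "e \<in> hom M K X" "e \<in> Weq M" "x \<in> hom M X T" "y \<in> hom M X T"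
    and c: "cofibrant M K" "cofibrant M X" "fibrant M T"
  shows "homotopic M x y"
proof -
  have "homotopic (op_ms M) (x \<cdot> e) (y \<cdot> e)" using left_to_right[OF h _ c(1), of T] t by (simp add: cat)
  from model_cat.homotopic_cancel_left[OF op_model_cat, unfolded op_simps, OF this t(1-4) c(2)]
  show ?thesis using right_to_left[OF _ t(3) c(3)] by blast
qed

lemma weq_lift_up_to_homotopy:
  assumes t: "w \<in> hom M F D" "w \<in> Weq M" "d \<in> hom M A D" and c: "cofibrant M A" "fibrant M F" "fibrant M D"
  obtains s where "s \<in> hom M A F" "homotopic M (w \<cdot> s) d"
proof -
  obtain E k p where e: "k \<in> hom M F E" "p \<in> hom M E D" "k \<in> Cof M" "k \<in> Weq M" "p \<in> Fib M" "p \<cdot> k = w"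
    using factor_fib[OF t(1)] .
  have pw: "p \<in> Weq M" using weq_right[OF e(1,2,4)] e t by simp
  obtain d' where d': "d' \<in> hom M A E" "p \<cdot> d' = d" using cofibrant_lift[OF c(1) e(5) pw e(2) t(3)] .
  have oF: "F \<in> Obj M" using arr_obj[OF t(1)] by simp
  obtain r where r: "r \<in> hom M E F" "r \<cdot> k = Idt M F"
    using fibrant_ext[OF c(2) e(3,4,1) Idt_hom[OF oF]] .
  have rw: "r \<in> Weq M" using weq_section[OF e(1) r] e by simp
  have rd: "r \<cdot> d' \<in> hom M A F" "k \<cdot> (r \<cdot> d') \<in> hom M A E" using r d' e by (auto simp: cat)
  have "r \<cdot> (k \<cdot> (r \<cdot> d')) = r \<cdot> d'" using r e rd oF comp_ext[OF r(2)] by (auto simp: cat)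
  then have "homotopic M (r \<cdot> (k \<cdot> (r \<cdot> d'))) (r \<cdot> d')" using homotopic_refl[OF rd(1)] by simp
  from homotopic_cancel_left[OF this r(1) rw rd(2) d'(1) fibrant_fib[OF c(3) e(2,5)]]
  have "homotopic M (p \<cdot> (k \<cdot> (r \<cdot> d'))) (p \<cdot> d')" using homotopic_post rd e by blast
  then show thesis using that[OF rd(1)] d' e rd r comp_ext[OF e(6)] by (auto simp: cat)
qed

lemma weq_extend_up_to_homotopy:
  assumes t: "w \<in> hom M K X" "w \<in> Weq M" "l \<in> hom M K G" and c: "fibrant M G" "cofibrant M X" "cofibrant M K"
  obtains s where "s \<in> hom M X G" "homotopic M (s \<cdot> w) l"
proof -
  obtain s where s: "s \<in> hom M X G" "homotopic (op_ms M) (s \<cdot> w) l"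
    using model_cat.weq_lift_up_to_homotopy[OF op_model_cat, unfolded op_simps, OF t c] .
  show thesis by (rule that[OF s(1) right_to_left[OF s(2) _ c(1)]]) (use s t in \<open>simp add: cat\<close>)
qed

section \<open>Mapping cylinders and homotopy pushouts\<close>

lemma cofibrant_if_bifibrant: "bifibrant M A \<Longrightarrow> cofibrant M A"
  and fibrant_if_bifibrant: "bifibrant M A \<Longrightarrow> fibrant M A"
  and bifibrant_obj: "bifibrant M A \<Longrightarrow> A \<in> Obj M"
  using cofibrant_obj by (auto simp: bifibrant_def)

lemma bifibrant_factor:
  "i \<in> hom M A E \<Longrightarrow> i \<in> Cof M \<Longrightarrow> p \<in> hom M E B \<Longrightarrow> p \<in> Fib M \<Longrightarrow> cofibrant M A \<Longrightarrow> fibrant M B \<Longrightarrow> bifibrant M E"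
  using fibrant_fib cofibrant_cof by (simp add: bifibrant_def)

text \<open>\<open>N\<close> is the mapping cylinder of \<open>g\<close>, with the inclusion \<open>c \<cdot> cyl0 C\<close> of the free end. It turns the
  homotopy commutative square on \<open>f\<close> and \<open>g\<close> into a strictly commutative square on \<open>f\<close> and the cofibration
  \<open>c \<cdot> cyl0 C\<close>.\<close>
lemma mapping_cylinder:
  assumes C: "is_cylinder M Z C" "cylp C \<in> hom M I Z" and g: "g \<in> hom M Z B"
    and c: "cofibrant M Z" "cofibrant M B"
  obtains N c b r where "pushout M (cyl1 C) g c b" "c \<in> hom M I N" "b \<in> hom M B N" "c \<cdot> cyl1 C = b \<cdot> g"
    "c \<cdot> cyl0 C \<in> Cof M" "b \<in> Cof M" "b \<in> Weq M" "r \<in> hom M N B" "r \<in> Weq M" "r \<cdot> c = g \<cdot> cylp C" "r \<cdot> b = Idt M B"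
proof -
  obtain I' where i: "cylp C \<in> hom M I' Z" "cyl0 C \<in> hom M Z I'" "cyl1 C \<in> hom M Z I'"
    "cylp C \<cdot> cyl0 C = Idt M Z" "cylp C \<cdot> cyl1 C = Idt M Z" "cyl1 C \<in> Weq M" using cylinderE[OF C(1)] by metis
  have [simp]: "I' = I" using i C by (simp add: in_hom)
  note i = i[simplified]
  have o: "Z \<in> Obj M" "B \<in> Obj M" using arr_obj[OF g] .
  obtain N c b where N: "pushout M (cyl1 C) g c b" "c \<in> hom M I N" "b \<in> hom M B N" "c \<cdot> cyl1 C = b \<cdot> g"
    using pushout_ex[OF i(3) g] .
  have b: "b \<in> Cof M" "b \<in> Weq M" using pushout_cofs(4,5,6)[OF N(1)] cylinder_cof[OF C(1) c(1)] i(6) by blast+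
  obtain r where r: "r \<in> hom M N B" "r \<cdot> c = g \<cdot> cylp C" "r \<cdot> b = Idt M B"
    by (rule pushout_induced[OF N(1-3), of "g \<cdot> cylp C" B "Idt M B"]) (use g i o in \<open>auto simp: cat\<close>)
  have rw: "r \<in> Weq M" using weq_section[OF N(3) r(1,3)] b by simp
  have "c \<cdot> cyl0 C \<in> Cof M"
  proof (rule cof_if_llp[of _ Z N])
    fix E W p x y
    assume h: "p \<in> Fib M" "p \<in> Weq M" "p \<in> hom M E W" "x \<in> hom M Z E" "y \<in> hom M N W" "p \<cdot> x = y \<cdot> (c \<cdot> cyl0 C)"
    have yb: "y \<cdot> b \<in> hom M B W" using h N by (simp add: cat)
    obtain k where k: "k \<in> hom M B E" "p \<cdot> k = y \<cdot> b" using cofibrant_lift[OF c(2) h(1-3) yb] .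
    obtain l where l: "l \<in> hom M I E" "l \<cdot> cyl0 C = x" "l \<cdot> cyl1 C = k \<cdot> g" "p \<cdot> l = y \<cdot> c"
      by (rule cylinder_lift[OF C h(1-4), of "k \<cdot> g" "y \<cdot> c"])
        (use k g h i N comp_ext[OF k(2), of g] in \<open>auto simp: cat\<close>)
    obtain m where m: "m \<in> hom M N E" "m \<cdot> c = l" "m \<cdot> b = k"
      using pushout_induced[OF N(1-3) l(1) k(1) l(3)] .
    have "p \<cdot> m = y"
      by (rule pushout_eqI[OF N(1,2), of _ W]) (use m h k l N in \<open>auto simp: cat\<close>)
    moreover have "m \<cdot> (c \<cdot> cyl0 C) = x" using m l N i comp_ext[OF m(2), of "cyl0 C"] by (simp add: cat)
    ultimately show "\<exists>l. l \<in> hom M N E \<and> l \<cdot> (c \<cdot> cyl0 C) = x \<and> p \<cdot> l = y" using m by blast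
  qed (use N i in \<open>simp add: cat\<close>)
  then show thesis using that N b r rw by blast
qed

context
  fixes C :: "'a cylinder" and Z I A B N f g c b
  assumes C: "is_cylinder M Z C" "cylp C \<in> hom M I Z" and f: "f \<in> hom M Z A" and g: "g \<in> hom M Z B"
    and N: "pushout M (cyl1 C) g c b" "c \<in> hom M I N"
begin

lemma mapping_cylinder_arr:
  "cyl0 C \<in> hom M Z I" "cyl1 C \<in> hom M Z I" "b \<in> hom M B N" "c \<cdot> cyl1 C = b \<cdot> g" "c \<cdot> cyl0 C \<in> hom M Z N"
  "cylp C \<cdot> cyl0 C = Idt M Z" "cylp C \<cdot> cyl1 C = Idt M Z"
proof -
  obtain I' where i: "cylp C \<in> hom M I' Z" "cyl0 C \<in> hom M Z I'" "cyl1 C \<in> hom M Z I'"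
    "cylp C \<cdot> cyl0 C = Idt M Z" "cylp C \<cdot> cyl1 C = Idt M Z" using cylinderE[OF C(1)] .
  then show i: "cyl0 C \<in> hom M Z I" "cyl1 C \<in> hom M Z I" "cylp C \<cdot> cyl0 C = Idt M Z" "cylp C \<cdot> cyl1 C = Idt M Z"
    using C by (auto simp: in_hom)
  then show "b \<in> hom M B N" "c \<cdot> cyl1 C = b \<cdot> g" "c \<cdot> cyl0 C \<in> hom M Z N" using N g by (auto simp: pushout_def cat)
qed

text \<open>The double mapping cylinder arises by gluing first \<open>B\<close> to the end \<open>cyl1\<close> of the cylinder, which gives \<open>N\<close>, and then \<open>A\<close>
  to the free end of \<open>N\<close>. This and the following lemma are the two directions of this universal property.\<close>
lemma double_mapping_cylinder_of_pushout:
  assumes P: "pushout M f (c \<cdot> cyl0 C) a n" and a: "a \<in> hom M A W"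
  shows "double_mapping_cylinder M C f g a (n \<cdot> c) (n \<cdot> b)"
proof -
  note m = mapping_cylinder_arr
  have n: "n \<in> hom M N W" "a \<cdot> f = n \<cdot> (c \<cdot> cyl0 C)" using P a m(5) by (auto simp: pushout_def in_hom)
  have o: "Cod M f = A" "Cod M a = W" "Cyl M C = I" "Cod M g = B" using a f g C by (auto simp: in_hom)
  show ?thesis
    unfolding double_mapping_cylinder_def o
  proof (intro conjI allI ballI impI)
    fix T x k y
    assume h: "x \<in> hom M A T" "k \<in> hom M I T" "y \<in> hom M B T" "k \<cdot> cyl0 C = x \<cdot> f \<and> k \<cdot> cyl1 C = y \<cdot> g"
    obtain t where t: "t \<in> hom M N T" "t \<cdot> c = k" "t \<cdot> b = y"
      using pushout_induced[OF N m(3) h(2,3)] h(4) by blast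
    have "x \<cdot> f = t \<cdot> (c \<cdot> cyl0 C)" using h t m N comp_ext[OF t(2), of "cyl0 C"] by (simp add: cat)
    from pushout_induced[OF P a n(1) h(1) t(1) this]
    obtain s where s: "s \<in> hom M W T" "s \<cdot> a = x" "s \<cdot> n = t" .
    show "\<exists>!t. t \<in> hom M W T \<and> t \<cdot> a = x \<and> t \<cdot> (n \<cdot> c) = k \<and> t \<cdot> (n \<cdot> b) = y"
    proof (rule ex1I[of _ s])
      show "s \<in> hom M W T \<and> s \<cdot> a = x \<and> s \<cdot> (n \<cdot> c) = k \<and> s \<cdot> (n \<cdot> b) = y"
        using s t n N m comp_ext[OF s(3), of c] comp_ext[OF s(3), of b] by (simp add: cat)
      fix s' assume s': "s' \<in> hom M W T \<and> s' \<cdot> a = x \<and> s' \<cdot> (n \<cdot> c) = k \<and> s' \<cdot> (n \<cdot> b) = y"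
      have "s' \<cdot> n = t"
        by (rule pushout_eqI[OF N(1,2), of _ T]) (use s' t n m N in \<open>auto simp: cat\<close>)
      then show "s' = s" using pushout_eqI[OF P a, of s' T s] s s' by auto
    qed
  qed (use n a m N f g C in \<open>auto simp: cat\<close>)
qed

lemma pushout_of_double_mapping_cylinder:
  assumes D: "double_mapping_cylinder M C f g a c' b'" and a: "a \<in> hom M A W"
  obtains n where "pushout M f (c \<cdot> cyl0 C) a n" "n \<in> hom M N W" "n \<cdot> c = c'" "n \<cdot> b = b'"
proof -
  note m = mapping_cylinder_arr
  have o: "Cod M f = A" "Cod M a = W" "Cyl M C = I" "Cod M g = B" using a f g C by (auto simp: in_hom)
  have d: "c' \<in> hom M I W" "b' \<in> hom M B W" "c' \<cdot> cyl0 C = a \<cdot> f" "c' \<cdot> cyl1 C = b' \<cdot> g"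
    and u: "\<And>T x k y. x \<in> hom M A T \<Longrightarrow> k \<in> hom M I T \<Longrightarrow> y \<in> hom M B T \<Longrightarrow> k \<cdot> cyl0 C = x \<cdot> f \<and> k \<cdot> cyl1 C = y \<cdot> g \<Longrightarrow>
        \<exists>!t. t \<in> hom M W T \<and> t \<cdot> a = x \<and> t \<cdot> c' = k \<and> t \<cdot> b' = y"
    using D unfolding double_mapping_cylinder_def o by blast+
  obtain n where n: "n \<in> hom M N W" "n \<cdot> c = c'" "n \<cdot> b = b'" using pushout_induced[OF N m(3) d(1,2,4)] .
  have "pushout M f (c \<cdot> cyl0 C) a n"
  proof (rule pushoutI[OF f m(5) a n(1)])
    show e: "a \<cdot> f = n \<cdot> (c \<cdot> cyl0 C)" using d n m N comp_ext[OF n(2), of "cyl0 C"] by (simp add: cat)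
    fix T x y assume h: "x \<in> hom M A T" "y \<in> hom M N T" "x \<cdot> f = y \<cdot> (c \<cdot> cyl0 C)"
    have "y \<cdot> c \<in> hom M I T" "y \<cdot> b \<in> hom M B T" "(y \<cdot> c) \<cdot> cyl0 C = x \<cdot> f \<and> (y \<cdot> c) \<cdot> cyl1 C = (y \<cdot> b) \<cdot> g"
      using h m N g by (auto simp: cat)
    from u[OF h(1) this] obtain t where t: "t \<in> hom M W T" "t \<cdot> a = x" "t \<cdot> c' = y \<cdot> c" "t \<cdot> b' = y \<cdot> b" by blast
    have "t \<cdot> n = y"
      by (rule pushout_eqI[OF N(1,2), of _ T]) (use h t n m N in \<open>auto simp: cat\<close>)
    with t show "\<exists>t. t \<in> hom M W T \<and> t \<cdot> a = x \<and> t \<cdot> n = y" by blast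
  next
    fix T s t assume h: "s \<in> hom M W T" "t \<in> hom M W T" "s \<cdot> a = t \<cdot> a" "s \<cdot> n = t \<cdot> n"
    have e: "a \<cdot> f = n \<cdot> (c \<cdot> cyl0 C)" using d n m N comp_ext[OF n(2), of "cyl0 C"] by (simp add: cat)
    have sn: "s \<cdot> c' = t \<cdot> c'" "s \<cdot> b' = t \<cdot> b'"
      using h n m N comp_ext[OF h(4), of c] comp_ext[OF h(4), of b] by (auto simp: cat simp flip: n(2,3))
    have "t \<cdot> a \<in> hom M A T" "t \<cdot> c' \<in> hom M I T" "t \<cdot> b' \<in> hom M B T"
      "(t \<cdot> c') \<cdot> cyl0 C = (t \<cdot> a) \<cdot> f \<and> (t \<cdot> c') \<cdot> cyl1 C = (t \<cdot> b') \<cdot> g"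
      using h d a f g m by (auto simp: cat)
    from u[OF this] show "s = t" using h sn by blast
  qed
  then show thesis using that n by blast
qed

lemma homotopy_pushout_iff_hcocart:
  assumes H: "hsquare M C f g u v h" and y: "y \<in> hom M N T" "y \<cdot> c = h" "y \<cdot> b = v" and u: "u \<in> hom M A T"
  shows "homotopy_pushout M C f g u v h \<longleftrightarrow> hcocart M f (c \<cdot> cyl0 C) u y"
proof
  note m = mapping_cylinder_arr
  assume "homotopy_pushout M C f g u v h"
  then obtain a c' b' w where w: "double_mapping_cylinder M C f g a c' b'" "induced_by M a c' b' u h v w" "w \<in> Weq M"
    unfolding homotopy_pushout_def by blast
  obtain W where a: "a \<in> hom M A W" using w(1) f by (auto simp: double_mapping_cylinder_def in_hom)
  obtain n where n: "pushout M f (c \<cdot> cyl0 C) a n" "n \<in> hom M N W" "n \<cdot> c = c'" "n \<cdot> b = b'"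
    using pushout_of_double_mapping_cylinder[OF w(1) a] .
  have ww: "w \<in> hom M W T" "w \<cdot> a = u" "w \<cdot> c' = h" "w \<cdot> b' = v" using w(2) a u by (auto simp: induced_by_def in_hom)
  have "w \<cdot> n = y"
    by (rule pushout_eqI[OF N(1,2), of _ T]) (use ww n y m N in \<open>auto simp: cat\<close>)
  then show "hcocart M f (c \<cdot> cyl0 C) u y" using hcocartI[OF n(1) a ww(1) w(3) ww(2)] by blast
next
  note m = mapping_cylinder_arr
  assume "hcocart M f (c \<cdot> cyl0 C) u y"
  from hcocartE[OF this f m(5)]
  obtain a n W T' w where w: "pushout M f (c \<cdot> cyl0 C) a n" "a \<in> hom M A W" "n \<in> hom M N W"
    "w \<in> hom M W T'" "w \<in> Weq M" "w \<cdot> a = u" "w \<cdot> n = y" "u \<in> hom M A T'" by metis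
  have [simp]: "T' = T" "Cod M a = W" "Cod M u = T" using w u by (auto simp: in_hom)
  have "induced_by M a (n \<cdot> c) (n \<cdot> b) u h v w"
    using w y m N comp_ext[OF w(7), of c] comp_ext[OF w(7), of b] unfolding induced_by_def by (auto simp: cat)
  with double_mapping_cylinder_of_pushout[OF w(1,2)] H w(5)
  show "homotopy_pushout M C f g u v h" unfolding homotopy_pushout_def by blast
qed

end

text \<open>A homotopy pushout made strict: \<open>N\<close> replaces \<open>B\<close>, and the homotopy becomes a part of \<open>y\<close>.\<close>
lemma homotopy_pushoutE:
  assumes H: "homotopy_pushout M C f g u v h" and f: "f \<in> hom M Z A" and g: "g \<in> hom M Z B"
  obtains T N i b r y where "bifibrant M Z" "bifibrant M A" "bifibrant M B" "bifibrant M T"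
    "u \<in> hom M A T" "v \<in> hom M B T"
    "i \<in> hom M Z N" "i \<in> Cof M" "b \<in> hom M B N" "b \<in> Cof M" "b \<in> Weq M"
    "r \<in> hom M N B" "r \<in> Weq M" "r \<cdot> i = g" "r \<cdot> b = Idt M B"
    "y \<in> hom M N T" "y \<cdot> i = u \<cdot> f" "y \<cdot> b = v" "hcocart M f i u y"
proof -
  have hs: "hsquare M C f g u v h" using H unfolding homotopy_pushout_def by blast
  then obtain Z' A' B' T where t: "bifibrant M Z'" "bifibrant M A'" "bifibrant M B'" "bifibrant M T"
    "f \<in> hom M Z' A'" "g \<in> hom M Z' B'" "u \<in> hom M A' T" "v \<in> hom M B' T" and ho: "homotopy M C h (u \<cdot> f) (v \<cdot> g)"
    unfolding hsquare_def by blast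
  have [simp]: "Z' = Z" "A' = A" "B' = B" using t f g by (auto simp: in_hom)
  note t = t[simplified]
  have uf: "u \<cdot> f \<in> hom M Z T" "v \<cdot> g \<in> hom M Z T" using t by (auto simp: cat)
  have C: "is_cylinder M Z C" using ho uf by (auto simp: homotopy_def in_hom)
  obtain I where I: "cylp C \<in> hom M I Z" "cyl0 C \<in> hom M Z I" "cyl1 C \<in> hom M Z I"
    "cylp C \<cdot> cyl0 C = Idt M Z" "cylp C \<cdot> cyl1 C = Idt M Z" using cylinderE[OF C] .
  have h: "h \<in> hom M I T" "h \<cdot> cyl0 C = u \<cdot> f" "h \<cdot> cyl1 C = v \<cdot> g"
    using ho uf I by (auto simp: homotopy_def in_hom)
  obtain N c b r where N: "pushout M (cyl1 C) g c b" "c \<in> hom M I N" "b \<in> hom M B N" "c \<cdot> cyl1 C = b \<cdot> g"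
    "c \<cdot> cyl0 C \<in> Cof M" "b \<in> Cof M" "b \<in> Weq M" "r \<in> hom M N B" "r \<in> Weq M" "r \<cdot> c = g \<cdot> cylp C" "r \<cdot> b = Idt M B"
    using mapping_cylinder[OF C I(1) g cofibrant_if_bifibrant[OF t(1)] cofibrant_if_bifibrant[OF t(3)]] .
  obtain y where y: "y \<in> hom M N T" "y \<cdot> c = h" "y \<cdot> b = v" using pushout_induced[OF N(1-3) h(1) t(8) h(3)] .
  have hc: "hcocart M f (c \<cdot> cyl0 C) u y"
    using homotopy_pushout_iff_hcocart[OF C I(1) f g N(1,2) hs y t(7)] H by simp
  show thesis
    by (rule that[OF t(1-4,7,8) _ N(5,3,6-9) _ N(11) y(1) _ y(3) hc])
      (use N I y g h comp_ext[OF N(10), of "cyl0 C"] comp_ext[OF y(2), of "cyl0 C"] in \<open>auto simp: cat\<close>)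
qed

lemma hsquare_strict:
  assumes "bifibrant M Z" "bifibrant M A" "bifibrant M B" "bifibrant M T"
    and t: "f \<in> hom M Z A" "g \<in> hom M Z B" "u \<in> hom M A T" "v \<in> hom M B T" "u \<cdot> f = v \<cdot> g"
    and C: "is_cylinder M Z C"
  shows "hsquare M C f g u v (u \<cdot> f \<cdot> cylp C)"
proof -
  obtain I where I: "cylp C \<in> hom M I Z" "cyl0 C \<in> hom M Z I" "cyl1 C \<in> hom M Z I"
    "cylp C \<cdot> cyl0 C = Idt M Z" "cylp C \<cdot> cyl1 C = Idt M Z" using cylinderE[OF C] .
  have uf: "u \<cdot> f \<in> hom M Z T" "v \<cdot> g \<in> hom M Z T" using t by (auto simp: cat)
  have d: "Dom M (u \<cdot> f) = Z" "Cod M (u \<cdot> f) = T" "Cyl M C = I" using uf I by (auto simp: in_hom)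
  have "homotopy M C (u \<cdot> f \<cdot> cylp C) (u \<cdot> f) (v \<cdot> g)"
    unfolding homotopy_def d using C uf I t by (auto simp: cat)
  then show ?thesis unfolding hsquare_def using assms by blast
qed

lemma homotopy_pushout_strict:
  assumes b: "bifibrant M Z" "bifibrant M A" "bifibrant M B" "bifibrant M T"
    and t: "f \<in> hom M Z A" "g \<in> hom M Z B" "u \<in> hom M A T" "v \<in> hom M B T" "u \<cdot> f = v \<cdot> g"
    and g: "g \<in> Cof M" and C: "is_cylinder M Z C"
  shows "homotopy_pushout M C f g u v (u \<cdot> f \<cdot> cylp C) \<longleftrightarrow> hcocart M f g u v"
proof -
  obtain I where I: "cylp C \<in> hom M I Z" "cyl0 C \<in> hom M Z I" "cyl1 C \<in> hom M Z I"
    "cylp C \<cdot> cyl0 C = Idt M Z" "cylp C \<cdot> cyl1 C = Idt M Z" using cylinderE[OF C] .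
  obtain N c b r where N: "pushout M (cyl1 C) g c b" "c \<in> hom M I N" "b \<in> hom M B N" "c \<cdot> cyl1 C = b \<cdot> g"
    "c \<cdot> cyl0 C \<in> Cof M" "b \<in> Cof M" "b \<in> Weq M" "r \<in> hom M N B" "r \<in> Weq M" "r \<cdot> c = g \<cdot> cylp C" "r \<cdot> b = Idt M B"
    using mapping_cylinder[OF C I(1) t(2) cofibrant_if_bifibrant[OF b(1)] cofibrant_if_bifibrant[OF b(3)]] .
  have rc: "r \<cdot> (c \<cdot> cyl0 C) = g" using N I t comp_ext[OF N(10), of "cyl0 C"] by (simp add: cat)
  have c0: "c \<cdot> cyl0 C \<in> hom M Z N" using N I by (simp add: cat)
  have "homotopy_pushout M C f g u v (u \<cdot> f \<cdot> cylp C) \<longleftrightarrow> hcocart M f (c \<cdot> cyl0 C) u (v \<cdot> r)"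
    by (rule homotopy_pushout_iff_hcocart[OF C I(1) t(1,2) N(1,2) hsquare_strict[OF b t C] _ _ _ t(3)])
      (use t N I in \<open>auto simp: cat\<close>)
  also have "\<dots> \<longleftrightarrow> hcocart M f (r \<cdot> (c \<cdot> cyl0 C)) u v"
    by (rule hcocart_weq_under[OF t(1) c0 N(8) t(3,4)]) (use rc t g N in auto)
  finally show ?thesis using rc by simp
qed

text \<open>Factor \<open>v = p \<cdot> j\<close>. As \<open>u\<close> is a fibration, pulling back along \<open>u\<close> preserves the weak equivalence \<open>j\<close>, so that testing
  with \<open>v\<close> or with the fibration \<open>p\<close> makes no difference.\<close>
lemma homotopy_pullback_strict:
  assumes b: "bifibrant M Z" "bifibrant M A" "bifibrant M B" "bifibrant M T"
    and t: "f \<in> hom M Z A" "g \<in> hom M Z B" "u \<in> hom M A T" "v \<in> hom M B T" "u \<cdot> f = v \<cdot> g"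
    and u: "u \<in> Fib M" and C: "is_cylinder M Z C" and H: "hcart M u v f g"
  shows "homotopy_pullback M C f g u v (u \<cdot> f \<cdot> cylp C)"
proof -
  obtain I where I: "cylp C \<in> hom M I Z" "cyl0 C \<in> hom M Z I" "cyl1 C \<in> hom M Z I"
    "cylp C \<cdot> cyl0 C = Idt M Z" "cylp C \<cdot> cyl1 C = Idt M Z" using cylinderE[OF C] .
  obtain E j p where e: "j \<in> hom M B E" "p \<in> hom M E T" "j \<in> Cof M" "j \<in> Weq M" "p \<in> Fib M" "p \<cdot> j = v"
    using factor_fib[OF t(4)] .
  have E: "fibrant M E" using fibrant_fib[OF fibrant_if_bifibrant[OF b(4)] e(2,5)] .
  have "hcart M p u (j \<cdot> g) f"
    by (rule iffD1[OF hcart_weq_corner[OF e(2,1) t(3,2,1)]])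
      (use H e t u b E hcart_sym in \<open>auto simp: cat fibrant_if_bifibrant\<close>)
  then have H': "hcart M u p f (j \<cdot> g)" by (rule hcart_sym)
  obtain q r W S w where w: "pullback M u p q r" "q \<in> hom M W A" "r \<in> hom M W E"
    "w \<in> hom M S W" "w \<in> Weq M" "q \<cdot> w = f" "r \<cdot> w = j \<cdot> g" "f \<in> hom M S A" using hcartE[OF H' t(3) e(2)] by metis
  have o: "Dom M v = B" "Cod M v = T" "Cyl M C = I" "Dom M f = Z" "Dom M q = W" "S = Z"
    using t I w by (auto simp: in_hom)
  define l where "l = j \<cdot> (g \<cdot> cylp C)"
  have l: "l \<in> hom M I E" "p \<cdot> l = u \<cdot> f \<cdot> cylp C" "l \<cdot> cyl1 C = j \<cdot> g" "l \<cdot> cyl0 C = j \<cdot> g"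
    unfolding l_def using e t I comp_ext[OF e(6)] comp_ext[OF t(5)] by (auto simp: cat)
  show ?thesis
    unfolding homotopy_pullback_def o
    using hsquare_strict[OF b t C] e l w o by (metis (no_types, lifting))
qed

end

section \<open>Strict relative decompositions\<close>

definition pushcat_step :: "('o, 'a) model_structure \<Rightarrow> 'o \<Rightarrow> 'o \<Rightarrow> 'o \<Rightarrow> 'a \<Rightarrow> 'a \<Rightarrow> bool" where
  "pushcat_step M A X X' \<kappa> \<kappa>' \<longleftrightarrow>
     (\<exists>C Z. \<exists>\<rho>\<in>hom M Z A. \<exists>\<tau>\<in>hom M Z X. \<exists>\<chi>\<in>hom M X X'. \<exists>h.
        homotopy_pushout M C \<rho> \<tau> \<kappa>' \<chi> h \<and> homotopic M (Comp M \<chi> \<kappa>) \<kappa>')"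

definition relcat_step :: "('o, 'a) model_structure \<Rightarrow> 'o \<Rightarrow> 'o \<Rightarrow> 'o \<Rightarrow> 'a \<Rightarrow> 'a \<Rightarrow> bool" where
  "relcat_step M A X X' \<kappa> \<kappa>' \<longleftrightarrow>
     (\<exists>C Z. \<exists>\<rho>\<in>hom M Z A. \<exists>\<tau>\<in>hom M Z X. \<exists>\<chi>\<in>hom M X X'. \<exists>h.
        homotopy_pushout M C \<rho> \<tau> \<kappa>' \<chi> h \<and>
        (\<exists>\<sigma>\<in>hom M A Z. homotopic M (Comp M \<rho> \<sigma>) (Idt M A) \<and> homotopic M (Comp M \<tau> \<sigma>) \<kappa>))"

text \<open>The decompositions of \<open>Relcat\<close>, with strictly commuting squares, a strict section \<open>\<sigma>\<close> of \<open>\<rho>\<close>, and \<open>\<tau> \<cdot> \<sigma>\<close> itself as the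
  previous map \<open>A \<rightarrow> X\<close>.
  Requiring \<open>\<tau>\<close> to be a cofibration makes \<open>hcocart\<close> meaningful, and it allows to correct a map out of \<open>X\<close> so that
  it has prescribed values on \<open>Z\<close>; this is what makes the notion invariant under weak equivalences.\<close>
inductive rel_build :: "('o, 'a) model_structure \<Rightarrow> 'o \<Rightarrow> nat \<Rightarrow> 'a \<Rightarrow> bool"
  for M :: "('o, 'a) model_structure" and A :: 'o where
  rel_build_0: "\<kappa> \<in> hom M A X \<Longrightarrow> bifibrant M X \<Longrightarrow> \<kappa> \<in> Weq M \<Longrightarrow> rel_build M A 0 \<kappa>"
| rel_build_Suc: "rel_build M A n (Comp M \<tau> \<sigma>) \<Longrightarrow> bifibrant M Z \<Longrightarrow> bifibrant M X \<Longrightarrow> bifibrant M X' \<Longrightarrow>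
    \<sigma> \<in> hom M A Z \<Longrightarrow> \<rho> \<in> hom M Z A \<Longrightarrow> Comp M \<rho> \<sigma> = Idt M A \<Longrightarrow> \<tau> \<in> hom M Z X \<Longrightarrow> \<tau> \<in> Cof M \<Longrightarrow>
    \<kappa> \<in> hom M A X' \<Longrightarrow> \<chi> \<in> hom M X X' \<Longrightarrow> hcocart M \<rho> \<tau> \<kappa> \<chi> \<Longrightarrow> rel_build M A (Suc n) \<kappa>"

context model_cat begin

lemma hcocart_target:
  assumes t: "f \<in> hom M Z A" "g \<in> hom M Z B" "u \<in> hom M A T" "v \<in> hom M B T" "u \<cdot> f = v \<cdot> g"
    and e: "e \<in> hom M T S" "e \<in> Weq M"
  shows "hcocart M f g (e \<cdot> u) (e \<cdot> v) \<longleftrightarrow> hcocart M f g u v"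
proof -
  obtain W a b where W: "pushout M f g a b" "a \<in> hom M A W" "b \<in> hom M B W" "a \<cdot> f = b \<cdot> g"
    using pushout_ex[OF t(1,2)] .
  obtain w where w: "w \<in> hom M W T" "w \<cdot> a = u" "w \<cdot> b = v" using pushout_induced[OF W(1-3) t(3-5)] .
  have ew: "e \<cdot> w \<in> hom M W S" "(e \<cdot> w) \<cdot> a = e \<cdot> u" "(e \<cdot> w) \<cdot> b = e \<cdot> v" using w e W by (auto simp: cat)
  have "hcocart M f g (e \<cdot> u) (e \<cdot> v) \<longleftrightarrow> e \<cdot> w \<in> Weq M"
    by (rule hcocart_iff[OF W(1) t(1,2) W(2) ew])
  moreover have "hcocart M f g u v \<longleftrightarrow> w \<in> Weq M"
    by (rule hcocart_iff[OF W(1) t(1,2) W(2) w])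
  ultimately show ?thesis using weq_left[OF w(1) e] by simp
qed

lemma hcocart_commutes: "hcocart M f g u v \<Longrightarrow> f \<in> hom M Z A \<Longrightarrow> g \<in> hom M Z B \<Longrightarrow> u \<cdot> f = v \<cdot> g"
  by (rule hcocartE)

lemma rel_build_hom: "rel_build M A n \<kappa> \<Longrightarrow> \<kappa> \<in> hom M A X \<Longrightarrow> bifibrant M X"
  by (cases rule: rel_build.cases) (auto simp: in_hom)

lemma rel_build_weq_comp:
  assumes r: "rel_build M A n \<kappa>" and t: "\<kappa> \<in> hom M A X" "e \<in> hom M X Y" "e \<in> Weq M" "bifibrant M Y"
  shows "rel_build M A n (e \<cdot> \<kappa>)"
  using r
proof cases
  case (rel_build_0 X')
  then show ?thesis using t rel_build.rel_build_0[of "e \<cdot> \<kappa>" M A Y] Weq_Comp[OF t(1,2)] by (simp add: cat)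
next
  case (rel_build_Suc m \<tau> \<sigma> Z X0 X' \<rho> \<chi>)
  have [simp]: "X' = X" using rel_build_Suc t by (simp add: in_hom)
  have k: "e \<cdot> \<kappa> \<in> hom M A Y" "e \<cdot> \<chi> \<in> hom M X0 Y" using t rel_build_Suc by (auto simp: cat)
  have "hcocart M \<rho> \<tau> (e \<cdot> \<kappa>) (e \<cdot> \<chi>)"
    using hcocart_target[of \<rho> Z A \<tau> X0 \<kappa> X \<chi> e Y] rel_build_Suc t hcocart_commutes[of \<rho> \<tau> \<kappa> \<chi> Z A X0] by simp
  then show ?thesis
    unfolding rel_build_Suc(1) by (rule rel_build.rel_build_Suc[OF rel_build_Suc(2-4) t(4) rel_build_Suc(6-10) k])
qed

text \<open>Only the last square mentions the target. Its map \<open>\<chi>\<close> lifts along \<open>e\<close> relative to \<open>Z\<close>, as \<open>\<tau>\<close> is a cofibration.\<close>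
lemma rel_build_lift_tfib:
  assumes r: "rel_build M A n (e \<cdot> \<kappa>)" and t: "\<kappa> \<in> hom M A Y" "e \<in> hom M Y X" "e \<in> Weq M" "e \<in> Fib M" "bifibrant M Y"
  shows "rel_build M A n \<kappa>"
proof -
  have ek: "e \<cdot> \<kappa> \<in> hom M A X" using t by (simp add: cat)
  show ?thesis using r
  proof cases
    case (rel_build_0 X')
    then show ?thesis using t rel_build.rel_build_0[of \<kappa> M A Y] weq_left[OF t(1,2)] by simp
  next
    case (rel_build_Suc m \<tau> \<sigma> Z X0 X' \<rho> \<chi>)
    have [simp]: "X' = X" using rel_build_Suc ek by (simp add: in_hom)
    note s = rel_build_Suc[simplified]
    have kr: "\<kappa> \<cdot> \<rho> \<in> hom M Z Y" "e \<cdot> (\<kappa> \<cdot> \<rho>) = \<chi> \<cdot> \<tau>"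
      using s t hcocart_commutes[OF s(13,7,9)] by (auto simp: cat)
    obtain l where l: "l \<in> hom M X0 Y" "l \<cdot> \<tau> = \<kappa> \<cdot> \<rho>" "e \<cdot> l = \<chi>"
      using lift[OF s(10) t(4) disjI2[OF t(3)] s(9) t(2) kr(1) s(12) kr(2)] .
    have "hcocart M \<rho> \<tau> \<kappa> l"
      using hcocart_target[OF s(7,9) t(1) l(1) l(2)[symmetric] t(2,3)] s(13) l(3) by simp
    then show ?thesis
      unfolding s(1) by (rule rel_build.rel_build_Suc[OF s(2-4) t(5) s(6-10) t(1) l(1)])
  qed
qed

lemma rel_build_lift_weq:
  assumes r: "rel_build M A n (e \<cdot> \<kappa>)" and t: "\<kappa> \<in> hom M A Y" "e \<in> hom M Y X" "e \<in> Weq M" "bifibrant M Y"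
  shows "rel_build M A n \<kappa>"
proof -
  have X: "bifibrant M X" using rel_build_hom[OF r] t by (simp add: cat)
  have Y: "Y \<in> Obj M" "fibrant M Y" using t(4) bifibrant_obj fibrant_if_bifibrant by auto
  obtain N j p where e: "j \<in> hom M Y N" "p \<in> hom M N X" "j \<in> Cof M" "j \<in> Weq M" "p \<in> Fib M" "p \<cdot> j = e"
    using factor_fib[OF t(2)] .
  have pw: "p \<in> Weq M" using weq_right[OF e(1,2,4)] e t by simp
  have N: "bifibrant M N" using bifibrant_factor[OF e(1,3) e(2,5)] X t(4) by (simp add: bifibrant_def)
  obtain q where q: "q \<in> hom M N Y" "q \<cdot> j = Idt M Y" using fibrant_ext[OF Y(2) e(3,4,1) Idt_hom[OF Y(1)]] .
  have qw: "q \<in> Weq M" using weq_section[OF e(1) q] e by simp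
  have jk: "j \<cdot> \<kappa> \<in> hom M A N" "p \<cdot> (j \<cdot> \<kappa>) = e \<cdot> \<kappa>" using e t comp_ext[OF e(6)] by (auto simp: cat)
  have "rel_build M A n (j \<cdot> \<kappa>)" using rel_build_lift_tfib[OF _ jk(1) e(2) pw e(5) N] r jk by simp
  from rel_build_weq_comp[OF this jk(1) q(1) qw t(4)] show ?thesis
    using q t e comp_ext[OF q(2)] Y by (simp add: cat)
qed

text \<open>The attaching object need not be fibrant. Let \<open>\<chi> = \<chi>1 \<cdot> x\<close> with a trivial cofibration \<open>x: X \<rightarrow> X1\<close> and a fibration
  \<open>\<chi>1\<close>. The fibrant replacement \<open>Z1\<close> of \<open>Z\<close> maps to \<open>X1\<close> by lifting against \<open>\<chi>1\<close>, which keeps the square strictly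
  commutative; extending \<open>\<rho>\<close> and \<open>\<tau>\<close> independently would not.\<close>
lemma rel_build_SucI:
  assumes r: "rel_build M A n (\<tau> \<cdot> \<sigma>)" and b: "bifibrant M A" "cofibrant M Z" "bifibrant M X" "bifibrant M X'"
    and t: "\<sigma> \<in> hom M A Z" "\<rho> \<in> hom M Z A" "\<rho> \<cdot> \<sigma> = Idt M A" "\<tau> \<in> hom M Z X" "\<tau> \<in> Cof M"
      "\<kappa> \<in> hom M A X'" "\<chi> \<in> hom M X X'"
    and H: "hcocart M \<rho> \<tau> \<kappa> \<chi>"
  shows "rel_build M A (Suc n) \<kappa>"
proof -
  have sq: "\<kappa> \<cdot> \<rho> = \<chi> \<cdot> \<tau>" using hcocart_commutes[OF H t(2,4)] .
  obtain X1 x \<chi>1 where x: "x \<in> hom M X X1" "\<chi>1 \<in> hom M X1 X'" "x \<in> Cof M" "x \<in> Weq M" "\<chi>1 \<in> Fib M" "\<chi>1 \<cdot> x = \<chi>"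
    using factor_fib[OF t(7)] .
  have X1: "bifibrant M X1" using bifibrant_factor[OF x(1,3) x(2,5)] b by (simp add: bifibrant_def)
  obtain Z1 z where z: "z \<in> hom M Z Z1" "z \<in> Cof M" "z \<in> Weq M" "fibrant M Z1"
    using fibrant_replacement[OF cofibrant_obj[OF b(2)]] .
  have Z1: "bifibrant M Z1" using z cofibrant_cof[OF b(2) z(1,2)] by (simp add: bifibrant_def)
  obtain \<rho>1 where \<rho>1: "\<rho>1 \<in> hom M Z1 A" "\<rho>1 \<cdot> z = \<rho>"
    using fibrant_ext[OF fibrant_if_bifibrant[OF b(1)] z(2,3,1) t(2)] .
  have h: "x \<cdot> \<tau> \<in> hom M Z X1" "\<kappa> \<cdot> \<rho>1 \<in> hom M Z1 X'" "\<chi>1 \<cdot> (x \<cdot> \<tau>) = (\<kappa> \<cdot> \<rho>1) \<cdot> z"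
    using x z \<rho>1 t sq comp_ext[OF x(6), of \<tau>] by (auto simp: cat)
  obtain \<tau>1 where \<tau>1: "\<tau>1 \<in> hom M Z1 X1" "\<tau>1 \<cdot> z = x \<cdot> \<tau>" "\<chi>1 \<cdot> \<tau>1 = \<kappa> \<cdot> \<rho>1"
    using lift[OF z(2) x(5) disjI1[OF z(3)] z(1) x(2) h] .
  obtain X2 \<tau>2 p where p: "\<tau>2 \<in> hom M Z1 X2" "p \<in> hom M X2 X1" "\<tau>2 \<in> Cof M" "p \<in> Fib M" "p \<in> Weq M" "p \<cdot> \<tau>2 = \<tau>1"
    using factor_cof[OF \<tau>1(1)] .
  have X2: "bifibrant M X2" using bifibrant_factor[OF p(1,3) p(2,4)] X1 Z1 by (simp add: bifibrant_def)
  have h2: "\<tau>2 \<cdot> z \<in> hom M Z X2" "p \<cdot> (\<tau>2 \<cdot> z) = x \<cdot> \<tau>"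
    using p z \<tau>1 comp_ext[OF p(6), of z] by (auto simp: cat)
  obtain y where y: "y \<in> hom M X X2" "y \<cdot> \<tau> = \<tau>2 \<cdot> z" "p \<cdot> y = x"
    using lift[OF t(5) p(4) disjI2[OF p(5)] t(4) p(2) h2(1) x(1) h2(2)] .
  have yw: "y \<in> Weq M" using weq_left[OF y(1) p(2,5)] y x by simp
  define \<chi>2 where "\<chi>2 = \<chi>1 \<cdot> p"
  have \<chi>2: "\<chi>2 \<in> hom M X2 X'" "\<chi>2 \<cdot> y = \<chi>" "\<chi>2 \<cdot> \<tau>2 = \<kappa> \<cdot> \<rho>1"
    unfolding \<chi>2_def using x p y \<tau>1 by (auto simp: cat)
  obtain W a c where W: "pushout M z \<tau> a c" "a \<in> hom M Z1 W" "c \<in> hom M X W" "a \<cdot> z = c \<cdot> \<tau>"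
    using pushout_ex[OF z(1) t(4)] .
  obtain e where e: "e \<in> hom M W X2" "e \<cdot> a = \<tau>2" "e \<cdot> c = y" using pushout_induced[OF W(1-3) p(1) y(1) y(2)[symmetric]] .
  have ew: "e \<in> Weq M" using weq_right[OF W(3) e(1)] e yw pushout_cofs(6)[OF W(1) z(2,3)] by simp
  have ce: "\<chi>2 \<cdot> e \<in> hom M W X'" using \<chi>2 e by (simp add: cat)
  \<comment> \<open>Attaching along \<open>Z \<rightarrow> Z1 \<rightarrow> A\<close> is attaching \<open>Z1 \<union>\<^sub>Z X\<close> along \<open>Z1\<close>, and this object is weakly
    equivalent to \<open>X2\<close>.\<close>
  have "hcocart M \<rho>1 a \<kappa> (\<chi>2 \<cdot> e)"
    by (rule hcocart_cancel_pushout[OF W(1) _ z(1) t(4) W(2) \<rho>1(1) t(6) ce])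
      (use H \<rho>1 \<chi>2 e W in \<open>auto simp: cat\<close>)
  then have "hcocart M \<rho>1 (e \<cdot> a) \<kappa> \<chi>2"
    using hcocart_weq_under[OF \<rho>1(1) W(2) e(1) t(6) \<chi>2(1)] e ew \<chi>2 p cof_pushout[OF W(1) t(5)] by auto
  then have H2: "hcocart M \<rho>1 \<tau>2 \<kappa> \<chi>2" using e by simp
  have ts: "\<tau> \<cdot> \<sigma> \<in> hom M A X" "\<tau>2 \<cdot> (z \<cdot> \<sigma>) \<in> hom M A X2" "z \<cdot> \<sigma> \<in> hom M A Z1" using t p z by (auto simp: cat)
  have "p \<cdot> (\<tau>2 \<cdot> (z \<cdot> \<sigma>)) = x \<cdot> (\<tau> \<cdot> \<sigma>)"
    using p z t \<tau>1 x comp_ext[OF p(6), of "z \<cdot> \<sigma>"] comp_ext[OF \<tau>1(2), of \<sigma>] by (auto simp: cat)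
  then have "rel_build M A n (\<tau>2 \<cdot> (z \<cdot> \<sigma>))"
    using rel_build_lift_tfib[OF _ ts(2) p(2,5,4) X2] rel_build_weq_comp[OF r ts(1) x(1,4) X1] by simp
  moreover have "\<rho>1 \<cdot> (z \<cdot> \<sigma>) = Idt M A" using \<rho>1 z t comp_ext[OF \<rho>1(2), of \<sigma>] by (simp add: cat)
  ultimately show ?thesis
    using rel_build.rel_build_Suc[OF _ Z1 X2 b(4) ts(3) \<rho>1(1) _ p(1,3) t(6) \<chi>2(1) H2] by blast
qed

text \<open>The general form of an additional step. The attaching object is \<open>Z = A \<union>\<^sub>P R\<close>, which maps to \<open>A\<close> by the identity and
  \<open>m\<close>, has the section \<open>A \<rightarrow> Z\<close>, and has a cofibration to \<open>A \<union>\<^sub>P Q\<close>. Attaching along it gives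
  \<open>A \<union>\<^sub>Z (A \<union>\<^sub>P Q)\<close>, which is the pushout \<open>A \<union>\<^sub>R Q\<close> of \<open>m\<close> and \<open>d\<close>.\<close>
lemma rel_build_attach:
  assumes b: "bifibrant M A" "bifibrant M T'" "cofibrant M P"
    and t: "p \<in> hom M P A" "c \<in> hom M P R" "d \<in> hom M R Q" "m \<in> hom M R A" "m \<cdot> c = p"
      "t' \<in> hom M A T'" "l' \<in> hom M Q T'" "c \<in> Cof M" "d \<in> Cof M"
    and H: "hcocart M m d t' l'"
    and IH: "\<And>T t l. bifibrant M T \<Longrightarrow> t \<in> hom M A T \<Longrightarrow> l \<in> hom M Q T \<Longrightarrow> hcocart M p (d \<cdot> c) t l \<Longrightarrow> rel_build M A n t"
  shows "rel_build M A (Suc n) t'"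
proof -
  have A: "A \<in> Obj M" using bifibrant_obj[OF b(1)] .
  have sq: "t' \<cdot> m = l' \<cdot> d" using hcocart_commutes[OF H t(4,3)] .
  have dc: "d \<cdot> c \<in> hom M P Q" using t by (simp add: cat)
  obtain Z iA iR where Z: "pushout M p c iA iR" "iA \<in> hom M A Z" "iR \<in> hom M R Z" "iA \<cdot> p = iR \<cdot> c"
    using pushout_ex[OF t(1,2)] .
  obtain U zU qU where U: "pushout M iR d zU qU" "zU \<in> hom M Z U" "qU \<in> hom M Q U" "zU \<cdot> iR = qU \<cdot> d"
    using pushout_ex[OF Z(3) t(3)] .
  have U': "pushout M p (d \<cdot> c) (zU \<cdot> iA) qU"
    using pushout_sym[OF pushout_paste[OF pushout_sym[OF Z(1)] pushout_sym[OF U(1)]]] .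
  have zi: "zU \<cdot> iA \<in> hom M A U" using U Z by (simp add: cat)
  have cZ: "cofibrant M Z" using cofibrant_cof[OF cofibrant_if_bifibrant[OF b(1)] Z(2) cof_pushout[OF Z(1) t(8)]] .
  have zUc: "zU \<in> Cof M" using cof_pushout[OF U(1) t(9)] .
  have cU: "cofibrant M U" using cofibrant_cof[OF cZ U(2) zUc] .
  obtain T j where j: "j \<in> hom M U T" "j \<in> Cof M" "j \<in> Weq M" "fibrant M T"
    using fibrant_replacement[OF cofibrant_obj[OF cU]] .
  have T: "bifibrant M T" using j cofibrant_cof[OF cU j(1,2)] by (simp add: bifibrant_def)
  have jt: "j \<cdot> zU \<in> hom M Z T" "j \<cdot> zU \<cdot> iA \<in> hom M A T" "j \<cdot> qU \<in> hom M Q T" using j U Z by (auto simp: cat)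
  have jc: "j \<cdot> zU \<in> Cof M" using cof_comp[OF U(2) zUc j(1,2)] .
  have hc: "hcocart M p (d \<cdot> c) (j \<cdot> zU \<cdot> iA) (j \<cdot> qU)"
    by (rule hcocartI[OF U' zi j(1,3)]) (use j U Z in \<open>auto simp: cat\<close>)
  have r: "rel_build M A n (j \<cdot> zU \<cdot> iA)" by (rule IH[OF T jt(2,3) hc])
  obtain \<rho> where \<rho>: "\<rho> \<in> hom M Z A" "\<rho> \<cdot> iA = Idt M A" "\<rho> \<cdot> iR = m"
    by (rule pushout_induced[OF Z(1-3) Idt_hom[OF A] t(4)]) (use t A in \<open>auto simp: cat\<close>)
  obtain k where k: "k \<in> hom M U T'" "k \<cdot> (zU \<cdot> iA) = t'" "k \<cdot> qU = l'"
    by (rule pushout_induced[OF U' zi U(3) t(6,7)]) (use t sq comp_ext[OF sq, of c] in \<open>auto simp: cat\<close>)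
  obtain \<chi> where \<chi>: "\<chi> \<in> hom M T T'" "\<chi> \<cdot> j = k"
    using fibrant_ext[OF fibrant_if_bifibrant[OF b(2)] j(2,3,1) k(1)] .
  have tr: "t' \<cdot> \<rho> = k \<cdot> zU"
    by (rule pushout_eqI[OF Z(1,2), of _ T'])
      (use \<rho> k U Z t sq comp_ext[OF k(3), of d] A in \<open>auto simp: cat\<close>)
  have "hcocart M \<rho> zU t' k"
    by (rule hcocart_cancel_pushout[OF U(1) _ Z(3) t(3) U(2) \<rho>(1) t(6) k(1) tr]) (use H \<rho> k in simp)
  then have "hcocart M \<rho> (j \<cdot> zU) t' \<chi>"
    using hcocart_weq_under[OF \<rho>(1) U(2) j(1) t(6) \<chi>(1) _ zUc jc j(3)] tr \<chi> j U comp_ext[OF \<chi>(2), of zU]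
    by (auto simp: cat)
  then show ?thesis
    using rel_build_SucI[OF r b(1) cZ T b(2) Z(2) \<rho>(1,2) jt(1) jc t(6) \<chi>(1)] by blast
qed

section \<open>The Ganea construction as a decomposition\<close>

lemma product_ex:
  assumes "fibrant M A" "fibrant M B"
  obtains S p q where "p \<in> hom M S A" "q \<in> hom M S B" "fibrant M S"
    "\<forall>T x y. x \<in> hom M T A \<longrightarrow> y \<in> hom M T B \<longrightarrow> (\<exists>t. t \<in> hom M T S \<and> p \<cdot> t = x \<and> q \<cdot> t = y)"
    "\<forall>T s t. s \<in> hom M T S \<longrightarrow> t \<in> hom M T S \<longrightarrow> p \<cdot> s = p \<cdot> t \<longrightarrow> q \<cdot> s = q \<cdot> t \<longrightarrow> s = t"
proof -
  obtain I f g S a b where I: "terminal_object M I" "f \<in> hom M A I" "g \<in> hom M B I" "pullback M f g a b" 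
    "a \<in> hom M S A" "b \<in> hom M S B" "a \<in> Fib M" "b \<in> Fib M"
    using model_cat.coproduct_pushout[OF op_model_cat, unfolded op_simps, OF assms] .
  have "\<exists>t. t \<in> hom M T S \<and> a \<cdot> t = x \<and> b \<cdot> t = y" if h: "x \<in> hom M T A" "y \<in> hom M T B" for T x y
  proof -
    have "f \<cdot> x \<in> hom M T I" "g \<cdot> y \<in> hom M T I" using h I by (auto simp: cat)
    then have "f \<cdot> x = g \<cdot> y" using I(1) arr_obj[OF h(1)] unfolding terminal_object_def by blast
    with pullback_induced[OF I(4-6) h] show ?thesis by metis
  qed
  then show thesis using that[OF I(5,6) fibrant_fib[OF assms(1) I(5,7)]] pullback_eqI[OF I(4,5)] by blast
qed

lemma homotopic_trans3:
  assumes "homotopic M f g" "homotopic M g h" "homotopic M h k" "f \<in> hom M A X" "cofibrant M A" "fibrant M X"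
  shows "homotopic M f k"
  using homotopic_trans[OF homotopic_trans[OF assms(1,2,4-6)] assms(3-6)] .

text \<open>The homotopy \<open>g \<cdot> \<alpha> \<sim> \<iota>\<close> makes the identity of \<open>A\<close> and \<open>\<alpha>\<close> into a map from \<open>A\<close> to the strict pullback \<open>D\<close>, which
  then factors through the weak equivalence \<open>F \<rightarrow> D\<close> up to homotopy.\<close>
lemma homotopy_pullback_section:
  assumes H: "homotopy_pullback M C \<eta> \<beta> \<iota> g h"
    and t: "\<iota> \<in> hom M A X" "g \<in> hom M G X" "\<alpha> \<in> hom M A G" "bifibrant M A"
    and a: "homotopic M (g \<cdot> \<alpha>) \<iota>"
  obtains F s where "bifibrant M F" "bifibrant M G" "\<eta> \<in> hom M F A" "\<beta> \<in> hom M F G" "s \<in> hom M A F" "homotopic M (\<eta> \<cdot> s) (Idt M A)"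
    "homotopic M (\<beta> \<cdot> s) \<alpha>"
proof -
  have hs: "hsquare M C \<eta> \<beta> \<iota> g h" using H unfolding homotopy_pullback_def by blast
  then obtain F A' G' X' where f: "bifibrant M F" "bifibrant M A'" "bifibrant M G'" "bifibrant M X'"
    "\<eta> \<in> hom M F A'" "\<beta> \<in> hom M F G'" "\<iota> \<in> hom M A' X'" "g \<in> hom M G' X'" and ho: "homotopy M C h (\<iota> \<cdot> \<eta>) (g \<cdot> \<beta>)"
    unfolding hsquare_def by blast
  have [simp]: "A' = A" "G' = G" "X' = X" using f t by (auto simp: in_hom)
  note f = f[simplified]
  have cA: "cofibrant M A" "A \<in> Obj M" using t(4) cofibrant_if_bifibrant bifibrant_obj by auto
  have d: "Dom M g = G" "Cod M g = X" "Dom M \<eta> = F" using t f by (auto simp: in_hom)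
  obtain E j p l q r w where e: "j \<in> hom M G E" "p \<in> hom M E X" "l \<in> hom M (Cyl M C) E"
    "j \<in> Weq M" "p \<in> Fib M" "p \<cdot> j = g" "l \<cdot> cyl1 C = j \<cdot> \<beta>"
    "pullback M \<iota> p q r" "w \<in> hom M F (Dom M q)" "q \<cdot> w = \<eta>" "r \<cdot> w = l \<cdot> cyl0 C" "w \<in> Weq M"
    using H unfolding homotopy_pullback_def d by blast
  obtain D where D: "q \<in> hom M D A" "r \<in> hom M D E" "w \<in> hom M F D"
    using e t unfolding pullback_def by (auto simp: in_hom)
  have E: "fibrant M E" using fibrant_fib[OF fibrant_if_bifibrant[OF f(4)] e(2,5)] .
  have fD: "fibrant M D" using fibrant_fib[OF fibrant_if_bifibrant[OF f(2)] D(1) pullback_fibs(1)[OF e(8,5)]] .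
  have ja: "j \<cdot> \<alpha> \<in> hom M A E" "p \<cdot> (j \<cdot> \<alpha>) = g \<cdot> \<alpha>" using e t comp_ext[OF e(6)] by (auto simp: cat)
  obtain m where m: "m \<in> hom M A E" "p \<cdot> m = \<iota>" "homotopic M (j \<cdot> \<alpha>) m"
    using homotopy_lifting[OF _ e(5,2) ja(1) cA(1)] a ja(2) by metis
  obtain \<delta> where \<delta>: "\<delta> \<in> hom M A D" "q \<cdot> \<delta> = Idt M A" "r \<cdot> \<delta> = m"
    by (rule pullback_induced[OF e(8) D(1,2) Idt_hom[OF cA(2)] m(1)]) (use m t cA in \<open>auto simp: cat\<close>)
  obtain s where s: "s \<in> hom M A F" "homotopic M (w \<cdot> s) \<delta>"
    using weq_lift_up_to_homotopy[OF D(3) e(12) \<delta>(1) cA(1) fibrant_if_bifibrant[OF f(1)] fD] .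
  have ws: "w \<cdot> s \<in> hom M A D" using D s by (simp add: cat)
  have 1: "homotopic M (\<eta> \<cdot> s) (Idt M A)"
    using homotopic_post[OF s(2) ws D(1)] \<delta> D s e comp_ext[OF e(10), of s] by (simp add: cat)
  have "is_cylinder M F C" using ho f by (auto simp: homotopy_def in_hom comp_arr)
  from cylinderE[OF this] obtain I where I: "cylp C \<in> hom M I F" "cyl0 C \<in> hom M F I" "cyl1 C \<in> hom M F I" .
  have lI: "l \<in> hom M I E" using e I by (simp add: in_hom)
  have l0: "homotopic M (l \<cdot> cyl0 C) (l \<cdot> cyl1 C)" "l \<cdot> cyl0 C \<in> hom M F E"
    using homotopicI[OF \<open>is_cylinder M F C\<close> I(1) lI] lI I by (auto simp: cat)
  have 2: "homotopic M (l \<cdot> cyl0 C \<cdot> s) (j \<cdot> \<beta> \<cdot> s)"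
    using homotopic_pre[OF l0 s(1)] e(7) by simp
  have 3: "homotopic M (l \<cdot> cyl0 C \<cdot> s) m"
    using homotopic_post[OF s(2) ws D(2)] \<delta>(3) comp_ext[OF e(11), of s] D s by (simp add: cat)
  have bs: "\<beta> \<cdot> s \<in> hom M A G" "j \<cdot> \<beta> \<cdot> s \<in> hom M A E" "j \<cdot> \<beta> \<cdot> s = j \<cdot> (\<beta> \<cdot> s)" using f s e by (auto simp: cat)
  have "homotopic M (j \<cdot> (\<beta> \<cdot> s)) (j \<cdot> \<alpha>)"
    using homotopic_trans3[OF homotopic_sym[OF 2] 3 homotopic_sym[OF m(3)] bs(2) cA(1) E] bs(3) by simp
  from homotopic_cancel_left[OF this e(1,4) bs(1) t(3) fibrant_if_bifibrant[OF f(3)]]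
  show thesis using that[OF f(1,3,5,6) s(1) 1] by blast
qed

text \<open>Once \<open>(\<eta>, \<beta>): F \<rightarrow> A \<times> G\<close> is replaced by a fibration \<open>F' \<rightarrow> A \<times> G\<close>, the homotopies \<open>\<eta> \<cdot> s \<sim> id\<close> and \<open>\<beta> \<cdot> s \<sim> \<alpha>\<close>
  lift and deform \<open>s\<close> into a strict section. The homotopy pushout is made strict by the mapping cylinder \<open>N\<close>
  of \<open>\<beta>\<close>, and pushing out along \<open>F \<rightarrow> F'\<close> transfers it to \<open>F'\<close>.\<close>
lemma rel_build_ganea_step:
  assumes r: "rel_build M A n \<alpha>" and A: "bifibrant M A" and P: "homotopy_pushout M C \<eta> \<beta> \<alpha>' \<gamma> k"
    and f: "bifibrant M F" "\<eta> \<in> hom M F A" "\<beta> \<in> hom M F G" and a: "\<alpha> \<in> hom M A G"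
    and s: "s \<in> hom M A F" "homotopic M (\<eta> \<cdot> s) (Idt M A)" "homotopic M (\<beta> \<cdot> s) \<alpha>"
  shows "rel_build M A (Suc n) \<alpha>'"
proof -
  have G: "bifibrant M G" using rel_build_hom[OF r a] .
  have cA: "cofibrant M A" "A \<in> Obj M" using A cofibrant_if_bifibrant bifibrant_obj by auto
  obtain S pA pG where S: "pA \<in> hom M S A" "pG \<in> hom M S G" "fibrant M S"
    and S0: "\<forall>T x y. x \<in> hom M T A \<longrightarrow> y \<in> hom M T G \<longrightarrow> (\<exists>t. t \<in> hom M T S \<and> pA \<cdot> t = x \<and> pG \<cdot> t = y)"
    and S1: "\<forall>T s t. s \<in> hom M T S \<longrightarrow> t \<in> hom M T S \<longrightarrow> pA \<cdot> s = pA \<cdot> t \<longrightarrow> pG \<cdot> s = pG \<cdot> t \<longrightarrow> s = t"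
    using product_ex[OF fibrant_if_bifibrant[OF A] fibrant_if_bifibrant[OF G]] .
  note S' = S0[rule_format]
  obtain u where u: "u \<in> hom M F S" "pA \<cdot> u = \<eta>" "pG \<cdot> u = \<beta>" using S'[OF f(2,3)] by blast
  obtain F' j u' where j: "j \<in> hom M F F'" "u' \<in> hom M F' S" "j \<in> Cof M" "j \<in> Weq M" "u' \<in> Fib M" "u' \<cdot> j = u"
    using factor_fib[OF u(1)] .
  have F': "cofibrant M F'" using cofibrant_cof[OF cofibrant_if_bifibrant[OF f(1)] j(1,3)] .
  have hs: "\<eta> \<cdot> s \<in> hom M A A" "\<beta> \<cdot> s \<in> hom M A G" "u \<cdot> s \<in> hom M A S" "j \<cdot> s \<in> hom M A F'" "u' \<cdot> (j \<cdot> s) = u \<cdot> s"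
    using f s j u comp_ext[OF j(6), of s] by (auto simp: cat)
  obtain C1 I H1 where C1: "is_cylinder M A C1" "cylp C1 \<in> hom M I A" "cyl0 C1 \<in> hom M A I" "cyl1 C1 \<in> hom M A I"
    "H1 \<in> hom M I A" "H1 \<cdot> cyl0 C1 = \<eta> \<cdot> s" "H1 \<cdot> cyl1 C1 = Idt M A" using homotopicE[OF s(2) hs(1)] .
  obtain H2 where H2: "H2 \<in> hom M I G" "H2 \<cdot> cyl0 C1 = \<beta> \<cdot> s" "H2 \<cdot> cyl1 C1 = \<alpha>"
    using homotopic_on[OF s(3) hs(2) C1(1,2)] .
  obtain H where H: "H \<in> hom M I S" "pA \<cdot> H = H1" "pG \<cdot> H = H2" using S'[OF C1(5) H2(1)] by blast
  have H0: "H \<cdot> cyl0 C1 = u \<cdot> s"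
    by (rule S1[rule_format, of _ A])
      (use H C1 hs S u s H2 comp_ext[OF H(2)] comp_ext[OF H(3)] comp_ext[OF u(2)] comp_ext[OF u(3)] in \<open>auto simp: cat\<close>)
  have "homotopic M (u' \<cdot> (j \<cdot> s)) (H \<cdot> cyl1 C1)" using homotopicI[OF C1(1,2) H(1) H0 refl] hs(5) by simp
  then obtain \<sigma> where \<sigma>: "\<sigma> \<in> hom M A F'" "u' \<cdot> \<sigma> = H \<cdot> cyl1 C1"
    using homotopy_lifting[OF _ j(5,2) hs(4) cA(1)] by metis
  define \<eta>' \<beta>' where "\<eta>' = pA \<cdot> u'" and "\<beta>' = pG \<cdot> u'"
  have e: "\<eta>' \<in> hom M F' A" "\<beta>' \<in> hom M F' G" "\<eta>' \<cdot> j = \<eta>" "\<beta>' \<cdot> j = \<beta>" "\<eta>' \<cdot> \<sigma> = Idt M A" "\<beta>' \<cdot> \<sigma> = \<alpha>"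
    unfolding \<eta>'_def \<beta>'_def
    using S j u \<sigma> H C1 H2 comp_ext[OF H(2), of "cyl1 C1"] comp_ext[OF H(3), of "cyl1 C1"] by (auto simp: cat)
  obtain T N i b r \<psi> where p: "bifibrant M F" "bifibrant M A" "bifibrant M G" "bifibrant M T"
    "\<alpha>' \<in> hom M A T" "\<gamma> \<in> hom M G T"
    "i \<in> hom M F N" "i \<in> Cof M" "b \<in> hom M G N" "b \<in> Cof M" "b \<in> Weq M"
    "r \<in> hom M N G" "r \<in> Weq M" "r \<cdot> i = \<beta>" "r \<cdot> b = Idt M G"
    "\<psi> \<in> hom M N T" "\<psi> \<cdot> i = \<alpha>' \<cdot> \<eta>" "\<psi> \<cdot> b = \<gamma>" "hcocart M \<eta> i \<alpha>' \<psi>"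
    using homotopy_pushoutE[OF P f(2,3)] .
  obtain N' \<tau> m where N: "pushout M j i \<tau> m" "\<tau> \<in> hom M F' N'" "m \<in> hom M N N'" "\<tau> \<cdot> j = m \<cdot> i"
    using pushout_ex[OF j(1) p(7)] .
  have c: "\<tau> \<in> Cof M" "m \<in> Weq M" using pushout_cofs[OF N(1)] p j by auto
  have ae: "\<alpha>' \<cdot> \<eta>' \<in> hom M F' T" "(\<alpha>' \<cdot> \<eta>') \<cdot> j = \<psi> \<cdot> i" using p e j by (auto simp: cat)
  obtain \<psi>1 where \<psi>1: "\<psi>1 \<in> hom M N' T" "\<psi>1 \<cdot> \<tau> = \<alpha>' \<cdot> \<eta>'" "\<psi>1 \<cdot> m = \<psi>"
    using pushout_induced[OF N(1-3) ae(1) p(16) ae(2)] .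
  have h1: "hcocart M \<eta>' \<tau> \<alpha>' \<psi>1"
    by (rule hcocart_cancel_pushout[OF N(1) _ j(1) p(7) N(2) e(1) p(5) \<psi>1(1)]) (use p e \<psi>1 in simp_all)
  obtain q where q: "q \<in> hom M N' G" "q \<cdot> \<tau> = \<beta>'" "q \<cdot> m = r"
    by (rule pushout_induced[OF N(1-3) e(2) p(12)]) (use e p in simp)
  have qw: "q \<in> Weq M" using weq_right[OF N(3) q(1)] q c p by simp
  have cN: "cofibrant M N'" using cofibrant_cof[OF F' N(2) c(1)] .
  obtain L l where l: "l \<in> hom M N' L" "l \<in> Cof M" "l \<in> Weq M" "fibrant M L"
    using fibrant_replacement[OF cofibrant_obj[OF cN]] .
  have L: "bifibrant M L" using l cofibrant_cof[OF cN l(1,2)] by (simp add: bifibrant_def)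
  obtain \<psi>2 where \<psi>2: "\<psi>2 \<in> hom M L T" "\<psi>2 \<cdot> l = \<psi>1"
    using fibrant_ext[OF fibrant_if_bifibrant[OF p(4)] l(2,3,1) \<psi>1(1)] .
  obtain q2 where q2: "q2 \<in> hom M L G" "q2 \<cdot> l = q"
    using fibrant_ext[OF fibrant_if_bifibrant[OF G] l(2,3,1) q(1)] .
  have q2w: "q2 \<in> Weq M" using weq_right[OF l(1) q2(1) l(3)] qw q2 by simp
  have lt: "l \<cdot> \<tau> \<in> hom M F' L" "l \<cdot> \<tau> \<in> Cof M" using l N cof_comp[OF N(2) c(1) l(1,2)] by (auto simp: cat)
  have h2: "hcocart M \<eta>' (l \<cdot> \<tau>) \<alpha>' \<psi>2"
    using hcocart_weq_under[OF e(1) N(2) l(1) p(5) \<psi>2(1) _ c(1) lt(2) l(3)] h1 \<psi>1 \<psi>2 N l comp_ext[OF \<psi>2(2), of \<tau>]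
    by (auto simp: cat)
  have ls: "l \<cdot> \<tau> \<cdot> \<sigma> \<in> hom M A L" "q2 \<cdot> (l \<cdot> \<tau> \<cdot> \<sigma>) = \<alpha>"
    using lt \<sigma> q2 q e l N comp_ext[OF q2(2), of "\<tau> \<cdot> \<sigma>"] comp_ext[OF q(2), of \<sigma>] by (auto simp: cat)
  have "rel_build M A n (l \<cdot> \<tau> \<cdot> \<sigma>)"
    using rel_build_lift_weq[OF _ ls(1) q2(1) q2w L] \<open>rel_build M A n \<alpha>\<close> ls(2) by simp
  then show ?thesis
    by (rule rel_build_SucI[OF _ A F' L p(4) \<sigma>(1) e(1,5) lt p(5) \<psi>2(1) h2])
qed

lemma ganea_rel_build:
  assumes g: "ganea M \<iota> n g \<alpha>" and t: "\<iota> \<in> hom M A X" "bifibrant M A" "bifibrant M X"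
  shows "\<exists>G. g \<in> hom M G X \<and> \<alpha> \<in> hom M A G \<and> bifibrant M G \<and> rel_build M A n \<alpha> \<and> homotopic M (g \<cdot> \<alpha>) \<iota>"
  using g
proof induction
  case ganea_0
  have [simp]: "Dom M \<iota> = A" and A: "A \<in> Obj M" using t bifibrant_obj by (auto simp: in_hom)
  have "rel_build M A 0 (Idt M A)" using rel_build_0[of "Idt M A" M A A] idt_tcof[OF A] t A by (simp add: cat)
  then show ?case using t A homotopic_refl[OF t(1)] by (intro exI[of _ A]) (auto simp: cat)
next
  case (ganea_Suc n g \<alpha> C \<eta> \<beta> h \<alpha>' \<gamma> k g')
  then obtain G where G: "g \<in> hom M G X" "\<alpha> \<in> hom M A G" "bifibrant M G" "rel_build M A n \<alpha>" "homotopic M (g \<cdot> \<alpha>) \<iota>"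
    by blast
  obtain F s where F: "bifibrant M F" "bifibrant M G" "\<eta> \<in> hom M F A" "\<beta> \<in> hom M F G" "s \<in> hom M A F"
    "homotopic M (\<eta> \<cdot> s) (Idt M A)" "homotopic M (\<beta> \<cdot> s) \<alpha>"
    using homotopy_pullback_section[OF ganea_Suc(2) t(1) G(1,2) t(2) G(5)] .
  have r: "rel_build M A (Suc n) \<alpha>'"
    using rel_build_ganea_step[OF G(4) t(2) ganea_Suc(3) F(1,3,4) G(2) F(5-7)] .
  obtain G' where G': "\<alpha>' \<in> hom M A G'" "bifibrant M G'" using homotopy_pushoutE[OF ganea_Suc(3) F(3,4)] by metis
  obtain a c b w x where w: "g' \<in> hom M G' X" "double_mapping_cylinder M C \<eta> \<beta> a c b"
    "induced_by M a c b \<alpha>' k \<gamma> w" "induced_by M a c b \<iota> h g x" "homotopic M (g' \<cdot> w) x"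
    using ganea_Suc(4) G' t unfolding whisker_map_def in_hom by auto
  obtain W where a: "a \<in> hom M A W" using w(2) F by (auto simp: double_mapping_cylinder_def in_hom)
  have ww: "w \<in> hom M W G'" "w \<cdot> a = \<alpha>'" "x \<cdot> a = \<iota>" using w(3,4) a G' t by (auto simp: induced_by_def in_hom)
  have "homotopic M (g' \<cdot> w \<cdot> a) (x \<cdot> a)" using homotopic_pre[OF w(5) _ a] w ww by (simp add: cat)
  then have "homotopic M (g' \<cdot> \<alpha>') \<iota>" using w ww a by (simp add: cat)
  then show ?case using r G' w by blast
qed

section \<open>Pulling back a decomposition\<close>

lemmas hcart_commutes = model_cat.hcocart_commutes[OF op_model_cat, unfolded op_simps op_hcocart]

text \<open>If all six homotopies are constant, then the hexagon collapses and is filled by \<open>Z\<close> itself.\<close>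
lemma compatible_chains_const:
  assumes C: "is_cylinder M Z C" and p: "\<phi> \<in> hom M Z W"
    and "h1 = \<phi> \<cdot> cylp C" "h2 = \<phi> \<cdot> cylp C" "h3 = \<phi> \<cdot> cylp C" "k1 = \<phi> \<cdot> cylp C" "k2 = \<phi> \<cdot> cylp C" "k3 = \<phi> \<cdot> cylp C"
  shows "compatible_chains M C h1 h2 h3 k1 k2 k3"
proof -
  obtain I where I: "cylp C \<in> hom M I Z" "cyl0 C \<in> hom M Z I" "cyl1 C \<in> hom M Z I"
    "cylp C \<cdot> cyl0 C = Idt M Z" "cylp C \<cdot> cyl1 C = Idt M Z" using cylinderE[OF C] .
  have Z: "Z \<in> Obj M" using arr_obj[OF p] by simp
  have d: "Cod M (cylp C) = Z" "Cod M h1 = W" "Cyl M C = I" using I p assms(3) by (auto simp: in_hom comp_arr)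
  show ?thesis
    unfolding compatible_chains_def d
    by (rule exI[of _ Z], rule bexI[of _ "Idt M Z"], rule bexI[of _ \<phi>], (rule bexI[of _ "cylp C"])+)
      (use I Z p idt_tcof assms(3-) in \<open>simp_all add: cat\<close>)
qed

end

locale cube_model_cat = cube_model_category M for M :: "('o, 'a) model_structure" (structure)
sublocale cube_model_cat \<subseteq> model_cat M by unfold_locales

context cube_model_cat begin

text \<open>With constant homotopies, a strictly commuting cube is homotopy commutative. The cofibrations \<open>g\<close>, \<open>g'\<close> and the fibrations
  \<open>a\<close>, \<open>b\<close>, \<open>w\<close> are what makes \<open>hcocart\<close> and \<open>hcart\<close> imply the homotopy pushouts and pullbacks of the Cube axiom.\<close>
lemma strict_cube:
  assumes b: "bifibrant M Z" "bifibrant M A" "bifibrant M B" "bifibrant M W"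
      "bifibrant M Z'" "bifibrant M A'" "bifibrant M B'" "bifibrant M W'"
    and t: "f \<in> hom M Z A" "g \<in> hom M Z B" "u \<in> hom M A W" "v \<in> hom M B W"
      "f' \<in> hom M Z' A'" "g' \<in> hom M Z' B'" "u' \<in> hom M A' W'" "v' \<in> hom M B' W'"
      "z \<in> hom M Z' Z" "a \<in> hom M A' A" "b \<in> hom M B' B" "w \<in> hom M W' W"
    and e: "u' \<cdot> f' = v' \<cdot> g'"
    and c: "g \<in> Cof M" "g' \<in> Cof M" "a \<in> Fib M" "b \<in> Fib M" "w \<in> Fib M"
    and H: "hcocart M f g u v" "hcart M a f f' z" "hcart M b g g' z" "hcart M w u u' a" "hcart M w v v' b"
  shows "hcocart M f' g' u' v'"
proof -
  have sq: "u \<cdot> f = v \<cdot> g" "a \<cdot> f' = f \<cdot> z" "b \<cdot> g' = g \<cdot> z" "w \<cdot> u' = u \<cdot> a" "w \<cdot> v' = v \<cdot> b"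
    using hcocart_commutes[OF H(1) t(1,2)] hcart_commutes[OF H(2) t(10,1)] hcart_commutes[OF H(3) t(11,2)]
      hcart_commutes[OF H(4) t(12,3)] hcart_commutes[OF H(5) t(12,4)] .
  obtain CZ CZ' CA CB where C: "is_cylinder M Z CZ" "is_cylinder M Z' CZ'" "is_cylinder M A' CA" "is_cylinder M B' CB"
    using cylinder_ex[OF bifibrant_obj] b by metis
  obtain I J K L where i: "cylp CZ \<in> hom M I Z" "cylp CZ' \<in> hom M J Z'" "cylp CA \<in> hom M K A'" "cylp CB \<in> hom M L B'"
    using cylinderE[OF C(1)] cylinderE[OF C(2)] cylinderE[OF C(3)] cylinderE[OF C(4)] by metis
  obtain mz where mz: "mz \<in> hom M J I" "mz \<cdot> cyl0 CZ' = cyl0 CZ \<cdot> z" "mz \<cdot> cyl1 CZ' = cyl1 CZ \<cdot> z" "cylp CZ \<cdot> mz = z \<cdot> cylp CZ'"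
    using cylinder_map_ex[OF C(2) i(2) C(1) i(1) t(9)] .
  obtain mf where mf: "mf \<in> hom M J K" "mf \<cdot> cyl0 CZ' = cyl0 CA \<cdot> f'" "mf \<cdot> cyl1 CZ' = cyl1 CA \<cdot> f'" "cylp CA \<cdot> mf = f' \<cdot> cylp CZ'"
    using cylinder_map_ex[OF C(2) i(2) C(3) i(3) t(5)] .
  obtain mg where mg: "mg \<in> hom M J L" "mg \<cdot> cyl0 CZ' = cyl0 CB \<cdot> g'" "mg \<cdot> cyl1 CZ' = cyl1 CB \<cdot> g'" "cylp CB \<cdot> mg = g' \<cdot> cylp CZ'"
    using cylinder_map_ex[OF C(2) i(2) C(4) i(4) t(6)] .
  have cm: "cylinder_map M CZ' CZ z mz" "cylinder_map M CZ' CA f' mf" "cylinder_map M CZ' CB g' mg"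
    using mz mf mg i unfolding cylinder_map_def by (auto simp: in_hom)
  define Q where "Q = \<lparr>bot_f = f, bot_g = g, bot_u = u, bot_v = v, top_f = f', top_g = g', top_u = u', top_v = v',
    vert_z = z, vert_a = a, vert_b = b, vert_w = w, cyl_Z = CZ, cyl_Z' = CZ', cyl_A' = CA, cyl_B' = CB,
    h_bot = u \<cdot> f \<cdot> cylp CZ, h_top = u' \<cdot> f' \<cdot> cylp CZ', h_ZA = a \<cdot> f' \<cdot> cylp CZ', h_ZB = b \<cdot> g' \<cdot> cylp CZ',
    h_AW = w \<cdot> u' \<cdot> cylp CA, h_BW = w \<cdot> v' \<cdot> cylp CB\<rparr>"
  have phi: "w \<cdot> (u' \<cdot> f') \<in> hom M Z' W" using t by (simp add: cat)
  have 1: "w \<cdot> (v' \<cdot> (g' \<cdot> cylp CZ')) = w \<cdot> (u' \<cdot> (f' \<cdot> cylp CZ'))"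
    using t i comp_ext[OF e, of "cylp CZ'"] by (simp add: cat)
  have 2: "v \<cdot> (b \<cdot> (g' \<cdot> cylp CZ')) = w \<cdot> (v' \<cdot> (g' \<cdot> cylp CZ'))"
    using t i comp_ext[OF sq(5), of "g' \<cdot> cylp CZ'"] by (simp add: cat)
  have 3: "u \<cdot> (a \<cdot> (f' \<cdot> cylp CZ')) = w \<cdot> (u' \<cdot> (f' \<cdot> cylp CZ'))"
    using t i comp_ext[OF sq(4), of "f' \<cdot> cylp CZ'"] by (simp add: cat)
  have 4: "f \<cdot> (z \<cdot> cylp CZ') = a \<cdot> (f' \<cdot> cylp CZ')"
    using t i comp_ext[OF sq(2), of "cylp CZ'"] by (simp add: cat)
  have cc: "compatible_chains M CZ' (w \<cdot> (u' \<cdot> f' \<cdot> cylp CZ')) (w \<cdot> v' \<cdot> cylp CB \<cdot> mg) (v \<cdot> (b \<cdot> g' \<cdot> cylp CZ'))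
     (w \<cdot> u' \<cdot> cylp CA \<cdot> mf) (u \<cdot> (a \<cdot> f' \<cdot> cylp CZ')) (u \<cdot> f \<cdot> cylp CZ \<cdot> mz)"
    by (rule compatible_chains_const[OF C(2) phi]) (use t i mz mf mg 1 2 3 4 in \<open>simp_all add: cat\<close>)
  have Q: "homotopy_commutative_cube M Q"
    unfolding homotopy_commutative_cube_def Q_def
    using hsquare_strict[OF b(1-4) t(1-4) sq(1) C(1)] hsquare_strict[OF b(5-8) t(5-8) e C(2)]
      hsquare_strict[OF b(5,6,1,2) t(5,9,10,1) sq(2) C(2)] hsquare_strict[OF b(5,7,1,3) t(6,9,11,2) sq(3) C(2)]
      hsquare_strict[OF b(6,8,2,4) t(7,10,12,3) sq(4) C(3)] hsquare_strict[OF b(7,8,3,4) t(8,11,12,4) sq(5) C(4)] cm cc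
    by auto
  have "homotopy_pushout M CZ' f' g' u' v' (u' \<cdot> f' \<cdot> cylp CZ')"
    using cube_axiom[OF Q] H
      homotopy_pushout_strict[OF b(1-4) t(1-4) sq(1) c(1) C(1)]
      homotopy_pullback_strict[OF b(5,6,1,2) t(5,9,10,1) sq(2) c(3) C(2)]
      homotopy_pullback_strict[OF b(5,7,1,3) t(6,9,11,2) sq(3) c(4) C(2)]
      homotopy_pullback_strict[OF b(6,8,2,4) t(7,10,12,3) sq(4) c(5) C(3)]
      homotopy_pullback_strict[OF b(7,8,3,4) t(8,11,12,4) sq(5) c(5) C(4)]
    unfolding Q_def by simp
  then show ?thesis using homotopy_pushout_strict[OF b(5-8) t(5-8) e c(2) C(2)] by simp
qed

text \<open>Pull the decomposition of \<open>\<kappa>: A \<rightarrow> X\<close> back along \<open>s: Y \<rightarrow> X\<close>, where \<open>P\<close> is the pullback of \<open>A\<close>, and glue \<open>A\<close> back in along \<open>p: P \<rightarrow> A\<close>.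
  If \<open>X\<close> is obtained from \<open>A \<leftarrow> Z \<rightarrow> X0\<close>, then by the Cube axiom \<open>Y\<close> is obtained from the pullbacks
  \<open>P \<leftarrow> R \<rightarrow> Q\<close>. The decomposition of \<open>A \<union>\<^sub>P Q\<close> is known by induction, and
  \<open>A \<union>\<^sub>P Y = A \<union>\<^sub>P (P \<union>\<^sub>R Q) = A \<union>\<^sub>R Q\<close> arises from it by attaching.\<close>
lemma rel_build_pullback:
  assumes "rel_build M A n \<kappa>" and A: "bifibrant M A"
    and "\<kappa> \<in> hom M A X" "bifibrant M Y" "bifibrant M P" "bifibrant M T"
      "s \<in> hom M Y X" "s \<in> Fib M" "p \<in> hom M P A" "p \<in> Fib M" "y \<in> hom M P Y" "y \<in> Cof M" "hcart M s \<kappa> y p"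
      "t \<in> hom M A T" "l \<in> hom M Y T" "hcocart M p y t l"
  shows "rel_build M A n t"
  using assms(1,3-)
proof (induction arbitrary: X Y P T s p y t l)
  case (rel_build_0 \<kappa> X')
  have [simp]: "X' = X" using rel_build_0 by (simp add: in_hom)
  note a = rel_build_0.prems
  have sy: "s \<cdot> y = \<kappa> \<cdot> p" using hcart_commutes[OF a(11,5,1)] .
  have X: "fibrant M X" "fibrant M A" using rel_build_0.hyps(2) A fibrant_if_bifibrant by auto
  have "y \<in> Weq M"
    using hcart_along_weq[OF a(1,5,7,9) sy[symmetric] rel_build_0.hyps(3) a(6) X] hcart_sym[OF a(11)]
    by simp
  moreover obtain a' b' W S w where w: "pushout M p y a' b'" "a' \<in> hom M A W" "b' \<in> hom M Y W" "a' \<cdot> p = b' \<cdot> y"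
     "w \<in> hom M W S" "w \<in> Weq M" "w \<cdot> a' = t" "w \<cdot> b' = l" "t \<in> hom M A S" "l \<in> hom M Y S" "t \<cdot> p = l \<cdot> y"
    using hcocartE[OF a(14,7,9)] .
  ultimately have "t \<in> Weq M" using tcof_pushout[OF w(1) a(10)] Weq_Comp[OF w(2,5) _ w(6)] by simp
  then show ?case by (rule rel_build.rel_build_0[OF a(12,4)])
next
  case (rel_build_Suc n \<tau> \<sigma> Z X0 X' \<rho> \<kappa> \<chi>)
  have [simp]: "X' = X" using rel_build_Suc by (simp add: in_hom)
  note a = rel_build_Suc.prems and h = rel_build_Suc.hyps[simplified]
  have bZ: "bifibrant M Z" "bifibrant M X0" "bifibrant M X" using h by auto
  have hs: "\<sigma> \<in> hom M A Z" "\<rho> \<in> hom M Z A" "\<rho> \<cdot> \<sigma> = Idt M A" "\<tau> \<in> hom M Z X0" "\<tau> \<in> Cof M" "\<chi> \<in> hom M X0 X"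
    "hcocart M \<rho> \<tau> \<kappa> \<chi>" using h by auto
  have P: "P \<in> Obj M" "cofibrant M P" using a(3) bifibrant_obj cofibrant_if_bifibrant by auto
  have sy: "s \<cdot> y = \<kappa> \<cdot> p" using hcart_commutes[OF a(11,5,1)] .
  have kr: "\<kappa> \<cdot> \<rho> = \<chi> \<cdot> \<tau>" using hcocart_commutes[OF hs(7,2,4)] .
  \<comment> \<open>The section \<open>\<sigma>\<close> of \<open>\<rho>\<close> pulls back to a section of \<open>R0 \<rightarrow> P\<close>. Factoring it through \<open>R\<close> gives
    a cofibration \<open>P \<rightarrow> R\<close> that is strictly a section of \<open>R \<rightarrow> P\<close>.\<close>
  obtain R0 x z where R0: "pullback M p \<rho> x z" "x \<in> hom M R0 P" "z \<in> hom M R0 Z" "p \<cdot> x = \<rho> \<cdot> z"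
    using pullback_ex[OF a(7) hs(2)] .
  have zf: "z \<in> Fib M" using pullback_fibs(2)[OF R0(1) a(8)] .
  have sp: "\<sigma> \<cdot> p \<in> hom M P Z" using hs a by (simp add: cat)
  obtain c0 where c0: "c0 \<in> hom M P R0" "x \<cdot> c0 = Idt M P" "z \<cdot> c0 = \<sigma> \<cdot> p"
    by (rule pullback_induced[OF R0(1-3) Idt_hom[OF P(1)] sp])
      (use hs a P comp_ext[OF hs(3), of p] A bifibrant_obj in \<open>auto simp: cat\<close>)
  obtain R c e where c: "c \<in> hom M P R" "e \<in> hom M R R0" "c \<in> Cof M" "e \<in> Fib M" "e \<in> Weq M" "e \<cdot> c = c0"
    using factor_cof[OF c0(1)] .
  define rP rZ where "rP = x \<cdot> e" and "rZ = z \<cdot> e"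
  have r: "rP \<in> hom M R P" "rZ \<in> hom M R Z" "rP \<cdot> c = Idt M P" "rZ \<cdot> c = \<sigma> \<cdot> p" "p \<cdot> rP = \<rho> \<cdot> rZ"
    unfolding rP_def rZ_def using R0 c0 c a hs comp_ext[OF R0(4), of e] by (auto simp: cat)
  have rZf: "rZ \<in> Fib M" unfolding rZ_def by (rule fib_comp[OF R0(3) zf c(2,4)])
  have R: "bifibrant M R" using fibrant_fib[OF _ r(2) rZf] cofibrant_cof[OF P(2) c(1,3)] bZ by (simp add: bifibrant_def)
  have HR: "hcart M p \<rho> rP rZ"
    by (rule hcartI[OF R0(1,2) c(2,5)]) (simp_all add: rP_def rZ_def)
  \<comment> \<open>\<open>Q\<close> replaces the pullback of \<open>X0\<close> such that \<open>R \<rightarrow> Q\<close> is a cofibration.\<close>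
  obtain Q0 x0 y0 where Q0: "pullback M \<chi> s x0 y0" "x0 \<in> hom M Q0 X0" "y0 \<in> hom M Q0 Y" "\<chi> \<cdot> x0 = s \<cdot> y0"
    using pullback_ex[OF hs(6) a(5)] .
  have x0f: "x0 \<in> Fib M" using pullback_fibs(1)[OF Q0(1) a(6)] .
  have q: "\<tau> \<cdot> rZ \<in> hom M R X0" "y \<cdot> rP \<in> hom M R Y" using hs r a by (auto simp: cat)
  obtain d0 where d0: "d0 \<in> hom M R Q0" "x0 \<cdot> d0 = \<tau> \<cdot> rZ" "y0 \<cdot> d0 = y \<cdot> rP"
    by (rule pullback_induced[OF Q0(1-3) q])
      (use hs r a comp_ext[OF kr[symmetric], of rZ] comp_ext[OF sy, of rP] in \<open>auto simp: cat\<close>)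
  obtain Q d e' where d: "d \<in> hom M R Q" "e' \<in> hom M Q Q0" "d \<in> Cof M" "e' \<in> Fib M" "e' \<in> Weq M" "e' \<cdot> d = d0"
    using factor_cof[OF d0(1)] .
  define qX qY where "qX = x0 \<cdot> e'" and "qY = y0 \<cdot> e'"
  have q': "qX \<in> hom M Q X0" "qY \<in> hom M Q Y" "qX \<cdot> d = \<tau> \<cdot> rZ" "qY \<cdot> d = y \<cdot> rP" "\<chi> \<cdot> qX = s \<cdot> qY"
    unfolding qX_def qY_def using Q0 d0 d a hs comp_ext[OF Q0(4), of e'] by (auto simp: cat)
  have qXf: "qX \<in> Fib M" unfolding qX_def by (rule fib_comp[OF Q0(2) x0f d(2,4)])
  have Q: "bifibrant M Q"
    using fibrant_fib[OF _ q'(1) qXf] cofibrant_cof[OF _ d(1,3)] bZ R by (simp add: bifibrant_def)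
  have HQ: "hcart M \<chi> s qX qY"
    by (rule hcartI[OF Q0(1,2) d(2,5)]) (simp_all add: qX_def qY_def)
  \<comment> \<open>The face over \<open>\<tau>\<close> is homotopy cartesian by cancellation, since the faces over \<open>\<chi>\<close> and over
    \<open>\<chi> \<cdot> \<tau> = \<kappa> \<cdot> \<rho>\<close> are.\<close>
  have "hcart M (\<kappa> \<cdot> \<rho>) s rZ (y \<cdot> rP)"
    by (rule hcart_paste[OF hcart_sym[OF a(11)] hcart_sym[OF HR] a(1,5,7) hs(2) a(6,8)])
  then have "hcart M \<tau> qX rZ d"
    using hcart_cancel[OF HQ _ hs(6) a(5) q'(1) hs(4) r(2) d(1) q'(3)[symmetric] a(6) qXf] kr q' by simp
  then have Hd: "hcart M qX \<tau> d rZ" by (rule hcart_sym)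
  have Htop: "hcocart M rP d y qY"
    by (rule strict_cube[OF bZ(1) A bZ(2,3) R a(3) Q a(2) hs(2,4) a(1) hs(6) r(1) d(1) a(9) q'(2) r(2) a(7) q'(1) a(5)
          q'(4)[symmetric] hs(5) d(3) a(8) qXf a(6) hs(7) HR Hd a(11) hcart_sym[OF HQ]])
  \<comment> \<open>As \<open>\<chi> \<cdot> \<tau> \<cdot> \<sigma> = \<kappa>\<close>, the pullback of \<open>Q \<rightarrow> X0\<close> along \<open>\<tau> \<cdot> \<sigma>\<close> is again \<open>P\<close>. This is what lets the induction
    hypothesis apply to \<open>Q\<close> with the same \<open>p: P \<rightarrow> A\<close>.\<close>
  have ts: "\<tau> \<cdot> \<sigma> \<in> hom M A X0" "d \<cdot> c \<in> hom M P Q" "d \<cdot> c \<in> Cof M"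
    using hs d c cof_comp[OF c(1,3) d(1,3)] by (auto simp: cat)
  have 1: "\<chi> \<cdot> (\<tau> \<cdot> \<sigma>) = \<kappa>"
    using hs a A bifibrant_obj comp_ext[OF kr[symmetric], of \<sigma>] by (auto simp: cat)
  have 2: "qY \<cdot> (d \<cdot> c) = y" using q' d c r a P comp_ext[OF q'(4), of c] by (auto simp: cat)
  have 3: "\<tau> \<cdot> \<sigma> \<cdot> p = qX \<cdot> (d \<cdot> c)" using q' d c r a hs comp_ext[OF q'(3), of c] by (auto simp: cat)
  have "hcart M (\<tau> \<cdot> \<sigma>) qX p (d \<cdot> c)"
    by (rule hcart_cancel[OF HQ _ hs(6) a(5) q'(1) ts(1) a(7) ts(2) 3 a(6) qXf]) (use 1 2 hcart_sym[OF a(11)] in simp)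
  then have H1: "hcart M qX (\<tau> \<cdot> \<sigma>) (d \<cdot> c) p" by (rule hcart_sym)
  have Hout: "hcocart M (p \<cdot> rP) d t (l \<cdot> qY)"
    by (rule hcocart_paste[OF Htop a(14) r(1) d(1) a(9,7) d(3) a(10)])
  have pr: "p \<cdot> rP \<in> hom M R A" "(p \<cdot> rP) \<cdot> c = p" "l \<cdot> qY \<in> hom M Q T"
    using a(7,13) r(1,3) c(1) q'(2) by (simp_all add: cat)
  show ?case
  proof (rule rel_build_attach[OF A a(4) P(2) a(7) c(1) d(1) pr(1,2) a(12) pr(3) c(3) d(3) Hout])
    fix T' t' l' assume "bifibrant M T'" "t' \<in> hom M A T'" "l' \<in> hom M Q T'" "hcocart M p (d \<cdot> c) t' l'"
    then show "rel_build M A n t'"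
      using rel_build_Suc.IH[OF ts(1) Q a(3) _ q'(1) qXf a(7,8) ts(2,3) H1] by blast
  qed
qed

text \<open>Let \<open>Y \<rightarrow> G\<close> be a fibration that replaces \<open>s\<close>, so that \<open>e: Y \<rightarrow> X\<close> is a weak equivalence, and let \<open>P\<close> be its
  pullback along \<open>\<alpha>\<close>. By the previous lemma \<open>A \<union>\<^sub>P Y\<close> has a decomposition of length \<open>n\<close>. Attaching one more
  copy \<open>A'\<close> of \<open>A\<close>, which maps to \<open>Y\<close> over \<open>X\<close> and contains \<open>P\<close>, leaves the pushout of \<open>A \<leftarrow> A' \<rightarrow> Y\<close>. As \<open>A' \<rightarrow> A\<close> is a
  weak equivalence, this is \<open>Y\<close> up to weak equivalence, that is \<open>X\<close>.\<close>
lemma rel_build_of_homotopy_section: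
  assumes r: "rel_build M A n \<alpha>" and b: "bifibrant M A" "bifibrant M X"
    and t: "\<alpha> \<in> hom M A G" "g \<in> hom M G X" "s \<in> hom M X G" and h: "homotopic M (g \<cdot> s) (Idt M X)"
  shows "rel_build M A (Suc n) (g \<cdot> \<alpha>)"
proof -
  have G: "bifibrant M G" using rel_build_hom[OF r t(1)] .
  have X: "X \<in> Obj M" using bifibrant_obj[OF b(2)] .
  have gsw: "g \<cdot> s \<in> Weq M" using homotopic_weq[OF homotopic_sym[OF h] idt_tcof(2)[OF X]] .
  \<comment> \<open>With a fibration \<open>g1\<close> in place of \<open>g\<close>, also \<open>e\<close> is a fibration. This is needed to lift \<open>A' \<rightarrow> X\<close> to \<open>Y\<close> below.\<close>
  obtain G1 j g1 where j: "j \<in> hom M G G1" "g1 \<in> hom M G1 X" "j \<in> Cof M" "j \<in> Weq M" "g1 \<in> Fib M" "g1 \<cdot> j = g"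
    using factor_fib[OF t(2)] .
  have G1: "bifibrant M G1" using bifibrant_factor[OF j(1,3) j(2,5)] b G by (simp add: bifibrant_def)
  define \<alpha>1 where "\<alpha>1 = j \<cdot> \<alpha>"
  have a1: "\<alpha>1 \<in> hom M A G1" "g1 \<cdot> \<alpha>1 = g \<cdot> \<alpha>" unfolding \<alpha>1_def using j t comp_ext[OF j(6)] by (auto simp: cat)
  have r1: "rel_build M A n \<alpha>1" unfolding \<alpha>1_def by (rule rel_build_weq_comp[OF r t(1) j(1,4) G1])
  have js: "j \<cdot> s \<in> hom M X G1" using j t by (simp add: cat)
  obtain Y x s2 where y: "x \<in> hom M X Y" "s2 \<in> hom M Y G1" "x \<in> Cof M" "x \<in> Weq M" "s2 \<in> Fib M" "s2 \<cdot> x = j \<cdot> s"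
    using factor_fib[OF js] .
  have Y: "bifibrant M Y" using bifibrant_factor[OF y(1,3) y(2,5)] b G1 by (simp add: bifibrant_def)
  define e where "e = g1 \<cdot> s2"
  have e: "e \<in> hom M Y X" "e \<cdot> x = g \<cdot> s" unfolding e_def using j y t comp_ext[OF j(6), of s] by (auto simp: cat)
  have ef: "e \<in> Fib M" unfolding e_def by (rule fib_comp[OF j(2,5) y(2,5)])
  have ew: "e \<in> Weq M" using weq_right[OF y(1) e(1) y(4)] e gsw by simp
  obtain P0 x0 z0 where P0: "pullback M s2 \<alpha>1 x0 z0" "x0 \<in> hom M P0 Y" "z0 \<in> hom M P0 A" "s2 \<cdot> x0 = \<alpha>1 \<cdot> z0"
    using pullback_ex[OF y(2) a1(1)] .
  have z0f: "z0 \<in> Fib M" using pullback_fibs(2)[OF P0(1) y(5)] .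
  obtain P \<pi> where P: "\<pi> \<in> hom M P P0" "\<pi> \<in> Fib M" "\<pi> \<in> Weq M" "cofibrant M P"
    using cofibrant_replacement[OF arr_obj(1)[OF P0(2)]] .
  define p y0 where "p = z0 \<cdot> \<pi>" and "y0 = x0 \<cdot> \<pi>"
  have p: "p \<in> hom M P A" "y0 \<in> hom M P Y" "s2 \<cdot> y0 = \<alpha>1 \<cdot> p" unfolding p_def y0_def
    using P P0 y a1 comp_ext[OF P0(4), of \<pi>] by (auto simp: cat)
  have pf: "p \<in> Fib M" unfolding p_def by (rule fib_comp[OF P0(3) z0f P(1,2)])
  have bP: "bifibrant M P" using fibrant_fib[OF _ p(1) pf] P b by (simp add: bifibrant_def)
  have H0: "hcart M s2 \<alpha>1 y0 p" by (rule hcartI[OF P0(1,2) P(1,3)]) (simp_all add: p_def y0_def)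
  obtain A' i q where i: "i \<in> hom M P A'" "q \<in> hom M A' A" "i \<in> Cof M" "q \<in> Fib M" "q \<in> Weq M" "q \<cdot> i = p"
    using factor_cof[OF p(1)] .
  have A': "cofibrant M A'" using cofibrant_cof[OF P(4) i(1,3)] .
  have gq: "g \<cdot> \<alpha> \<cdot> q \<in> hom M A' X" using t i by (simp add: cat)
  have "e \<cdot> y0 = g \<cdot> \<alpha> \<cdot> q \<cdot> i"
    unfolding e_def using j y p t i a1 comp_ext[OF a1(2), of p] by (simp add: cat)
  then obtain b' where b': "b' \<in> hom M A' Y" "b' \<cdot> i = y0" "e \<cdot> b' = g \<cdot> \<alpha> \<cdot> q"
    using lift[OF i(3) ef disjI2[OF ew] i(1) e(1) p(2) gq] by metis
  obtain Y3 c f where c: "c \<in> hom M A' Y3" "f \<in> hom M Y3 Y" "c \<in> Cof M" "f \<in> Fib M" "f \<in> Weq M" "f \<cdot> c = b'"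
    using factor_cof[OF b'(1)] .
  have Y3: "bifibrant M Y3" using fibrant_fib[OF _ c(2,4)] cofibrant_cof[OF A' c(1,3)] Y by (simp add: bifibrant_def)
  have ci: "c \<cdot> i \<in> hom M P Y3" "c \<cdot> i \<in> Cof M" "f \<cdot> (c \<cdot> i) = y0"
    using c i b' cof_comp[OF i(1,3) c(1,3)] comp_ext[OF c(6), of i] by (auto simp: cat)
  have sf: "s2 \<cdot> f \<in> hom M Y3 G1" "s2 \<cdot> f \<in> Fib M" using c y fib_comp[OF y(2,5) c(2,4)] by (auto simp: cat)
  have "hcart M \<alpha>1 (s2 \<cdot> f) p (c \<cdot> i)"
    using hcart_weq_over[OF a1(1) y(2) c(2) p(1) ci(1) _ y(5) sf(2) c(5)] hcart_sym[OF H0] ci p y c i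
    by (auto simp: cat)
  then have H3: "hcart M (s2 \<cdot> f) \<alpha>1 (c \<cdot> i) p" by (rule hcart_sym)
  have ga: "g \<cdot> \<alpha> \<in> hom M A X" "e \<cdot> f \<in> hom M Y3 X" "e \<cdot> f \<in> Weq M"
    using t e c Weq_Comp[OF c(2) e(1) c(5) ew] by (auto simp: cat)
  have "hcocart M q c (g \<cdot> \<alpha>) (e \<cdot> f)"
    using hcocart_along_weq[OF i(2) c(1) ga(1,2) _ i(5) c(3) A' cofibrant_if_bifibrant[OF b(1)]] ga(3) b' c e t i
    by (simp add: cat)
  then show ?thesis
  proof (rule rel_build_attach[OF b P(4) p(1) i(1) c(1) i(2,6) ga(1,2) i(3) c(3)])
    fix T t' l' assume "bifibrant M T" "t' \<in> hom M A T" "l' \<in> hom M Y3 T" "hcocart M p (c \<cdot> i) t' l'"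
    then show "rel_build M A n t'"
      using rel_build_pullback[OF r1 b(1) a1(1) Y3 bP _ sf p(1) pf ci(1,2) H3] by blast
  qed
qed

section \<open>From strict decompositions to sequences\<close>

lemma weq_homotopy_inverse:
  assumes "f \<in> hom M A B" "f \<in> Weq M" "bifibrant M A" "bifibrant M B"
  obtains r where "homotopy_inverse M f r"
proof -
  have o: "A \<in> Obj M" "B \<in> Obj M" "cofibrant M B" "fibrant M A" "fibrant M B"
    using assms bifibrant_obj by (auto simp: bifibrant_def)
  obtain r where r: "r \<in> hom M B A" "homotopic M (f \<cdot> r) (Idt M B)"
    using weq_lift_up_to_homotopy[OF assms(1,2) Idt_hom[OF o(2)] o(3-5)] .
  have rf: "r \<cdot> f \<in> hom M A A" "f \<cdot> r \<in> hom M B B" using r assms by (auto simp: cat)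
  have "homotopic M (f \<cdot> (r \<cdot> f)) (f \<cdot> Idt M A)"
    using homotopic_pre[OF r(2) rf(2) assms(1)] r assms o by (simp add: cat)
  then have "homotopic M (r \<cdot> f) (Idt M A)"
    by (rule homotopic_cancel_left[OF _ assms(1,2) rf(1) Idt_hom[OF o(1)] o(4)])
  moreover have "Dom M f = A" "Cod M f = B" using assms(1) by (auto simp: in_hom)
  ultimately show thesis using r assms(1) by (intro that[of r]) (simp add: homotopy_inverse_def in_hom)
qed

lemma rel_build_sequence:
  assumes "rel_build M A n \<kappa>" "\<kappa> \<in> hom M A Y" "bifibrant M A"
  shows "\<exists>X K. (\<forall>i\<le>n. bifibrant M (X i) \<and> K i \<in> hom M A (X i)) \<and> (\<exists>r. homotopy_inverse M (K 0) r) \<and>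
     (\<forall>i<n. relcat_step M A (X i) (X (Suc i)) (K i) (K (Suc i))) \<and>
     X n = Y \<and> K n = \<kappa>"
  using assms(1,2)
proof (induction arbitrary: Y)
  case (rel_build_0 \<kappa> X)
  have "X = Y" using rel_build_0 by (simp add: in_hom)
  with rel_build_0 show ?case
    using weq_homotopy_inverse[of \<kappa> A Y] assms(3) by (intro exI[of _ "\<lambda>_. Y"] exI[of _ "\<lambda>_. \<kappa>"]) auto
next
  case (rel_build_Suc n \<tau> \<sigma> Z X0 X' \<rho> \<kappa> \<chi>)
  have [simp]: "X' = Y" using rel_build_Suc by (simp add: in_hom)
  note h = rel_build_Suc.hyps[simplified]
  have ts: "\<tau> \<cdot> \<sigma> \<in> hom M A X0" using h by (simp add: cat)
  obtain X K where K: "\<forall>i\<le>n. bifibrant M (X i) \<and> K i \<in> hom M A (X i)" "\<exists>r. homotopy_inverse M (K 0) r"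
     "\<forall>i<n. relcat_step M A (X i) (X (Suc i)) (K i) (K (Suc i))"
     "X n = X0" "K n = \<tau> \<cdot> \<sigma>" using rel_build_Suc.IH[OF ts] by blast
  obtain C where C: "is_cylinder M Z C" using cylinder_ex[OF bifibrant_obj] h by metis
  have ty: "bifibrant M Z" "bifibrant M X0" "bifibrant M Y" "\<rho> \<in> hom M Z A" "\<tau> \<in> hom M Z X0" "\<kappa> \<in> hom M A Y"
    "\<chi> \<in> hom M X0 Y" "\<tau> \<in> Cof M" "hcocart M \<rho> \<tau> \<kappa> \<chi>" "\<sigma> \<in> hom M A Z" "\<rho> \<cdot> \<sigma> = Idt M A" using h by auto
  have po: "homotopy_pushout M C \<rho> \<tau> \<kappa> \<chi> (\<kappa> \<cdot> \<rho> \<cdot> cylp C)"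
    using homotopy_pushout_strict[OF ty(1) assms(3) ty(2-7) hcocart_commutes[OF ty(9,4,5)] ty(8) C] ty(9) by simp
  have new: "relcat_step M A (X n) Y (K n) \<kappa>"
    unfolding K(4,5) relcat_step_def using po ty homotopic_refl[OF ts] homotopic_refl[OF Idt_hom[OF bifibrant_obj[OF assms(3)]]] by metis
  show ?case
  proof (intro exI[of _ "X(Suc n := Y)"] exI[of _ "K(Suc n := \<kappa>)"] conjI allI impI)
    fix i assume "i < Suc n"
    then consider "i < n" | "i = n" by linarith
    then show "relcat_step M A ((X(Suc n := Y)) i) ((X(Suc n := Y)) (Suc i)) ((K(Suc n := \<kappa>)) i) ((K(Suc n := \<kappa>)) (Suc i))"
    proof cases
      case 1 then show ?thesis using K(3) by simp
    next
      case 2 then show ?thesis using new by simp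
    qed
  qed (use K ty le_Suc_eq in auto)
qed

section \<open>Comparison of a decomposition with the Ganea construction\<close>

text \<open>One step of the Ganea construction in a form that maps can be constructed into. Here \<open>F\<close> is a cofibrant replacement of the
  strict pullback of \<open>\<iota>\<close> and the fibration \<open>p: E \<rightarrow> X\<close>, whence the weak universal property, and \<open>G'\<close> receives \<open>A\<close> and an
  object \<open>E'\<close> that is trivially fibred over \<open>E\<close>. The square \<open>\<alpha>' \<cdot> \<eta> = v \<cdot> e\<close> and the maps to \<open>X\<close> are strict; the homotopies
  demanded by the definition of the construction are hidden in \<open>E'\<close>, which contains the mapping cylinder of \<open>\<beta>\<close>.\<close>
lemma ganea_step:
  assumes g: "g \<in> hom M G X" and i: "\<iota> \<in> hom M A X" and b: "bifibrant M G" "bifibrant M A" "bifibrant M X"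
  obtains E j p F \<eta> \<epsilon> E' e q v G' \<alpha>' g' C \<beta> h \<gamma> k where
    "j \<in> hom M G E" "p \<in> hom M E X" "p \<in> Fib M" "p \<cdot> j = g"
    "\<eta> \<in> hom M F A" "\<epsilon> \<in> hom M F E"
    "\<forall>T x y. cofibrant M T \<longrightarrow> x \<in> hom M T A \<longrightarrow> y \<in> hom M T E \<longrightarrow> \<iota> \<cdot> x = p \<cdot> y \<longrightarrow>
       (\<exists>\<theta>. \<theta> \<in> hom M T F \<and> \<eta> \<cdot> \<theta> = x \<and> \<epsilon> \<cdot> \<theta> = y)"
    "e \<in> hom M F E'" "q \<in> hom M E' E" "q \<in> Fib M" "q \<in> Weq M" "q \<cdot> e = \<epsilon>"
    "v \<in> hom M E' G'" "\<alpha>' \<in> hom M A G'" "\<alpha>' \<cdot> \<eta> = v \<cdot> e" "bifibrant M G'"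
    "g' \<in> hom M G' X" "g' \<cdot> \<alpha>' = \<iota>" "g' \<cdot> v = p \<cdot> q"
    "homotopy_pullback M C \<eta> \<beta> \<iota> g h" "homotopy_pushout M C \<eta> \<beta> \<alpha>' \<gamma> k"
    "whisker_map M C \<eta> \<beta> \<alpha>' \<gamma> k \<iota> g h g'"
proof -
  have o: "G \<in> Obj M" "A \<in> Obj M" "X \<in> Obj M" using b bifibrant_obj by auto
  obtain E j p where j: "j \<in> hom M G E" "p \<in> hom M E X" "j \<in> Cof M" "j \<in> Weq M" "p \<in> Fib M" "p \<cdot> j = g"
    using factor_fib[OF g] .
  have E: "fibrant M E" "E \<in> Obj M" using fibrant_fib[OF _ j(2,5)] b arr_obj[OF j(2)] by (auto simp: bifibrant_def)
  obtain D x y where D: "pullback M \<iota> p x y" "x \<in> hom M D A" "y \<in> hom M D E" "\<iota> \<cdot> x = p \<cdot> y"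
    using pullback_ex[OF i j(2)] .
  have xf: "x \<in> Fib M" using pullback_fibs(1)[OF D(1) j(5)] .
  obtain F \<pi> where F: "\<pi> \<in> hom M F D" "\<pi> \<in> Fib M" "\<pi> \<in> Weq M" "cofibrant M F"
    using cofibrant_replacement[OF arr_obj(1)[OF D(2)]] .
  define \<eta> \<epsilon> where "\<eta> = x \<cdot> \<pi>" and "\<epsilon> = y \<cdot> \<pi>"
  have e: "\<eta> \<in> hom M F A" "\<epsilon> \<in> hom M F E" "\<iota> \<cdot> \<eta> = p \<cdot> \<epsilon>" unfolding \<eta>_def \<epsilon>_def
    using F D i j comp_ext[OF D(4), of \<pi>] by (auto simp: cat)
  have bF: "bifibrant M F" using fibrant_fib[OF _ e(1)] fib_comp[OF D(2) xf F(1,2)] F b by (simp add: bifibrant_def \<eta>_def)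
  have uni: "\<exists>\<theta>. \<theta> \<in> hom M T F \<and> \<eta> \<cdot> \<theta> = s \<and> \<epsilon> \<cdot> \<theta> = t"
    if T: "cofibrant M T" "s \<in> hom M T A" "t \<in> hom M T E" "\<iota> \<cdot> s = p \<cdot> t" for T s t
  proof -
    obtain d where d: "d \<in> hom M T D" "x \<cdot> d = s" "y \<cdot> d = t" using pullback_induced[OF D(1-3) T(2-4)] .
    obtain \<theta> where \<theta>: "\<theta> \<in> hom M T F" "\<pi> \<cdot> \<theta> = d" using cofibrant_lift[OF T(1) F(2,3,1) d(1)] .
    then show ?thesis using d F D unfolding \<eta>_def \<epsilon>_def by (intro exI[of _ \<theta>]) (simp add: cat)
  qed
  obtain r where r: "r \<in> hom M E G" "r \<cdot> j = Idt M G"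
    using fibrant_ext[OF fibrant_if_bifibrant[OF b(1)] j(3,4,1) Idt_hom[OF o(1)]] .
  have rw: "r \<in> Weq M" using weq_section[OF j(1) r] j by simp
  have jr: "j \<cdot> r \<in> hom M E E" using j r by (simp add: cat)
  have "r \<cdot> (j \<cdot> r) = r \<cdot> Idt M E" using r j E o comp_ext[OF r(2), of r] by (simp add: cat)
  then have "homotopic M (r \<cdot> (j \<cdot> r)) (r \<cdot> Idt M E)"
    using homotopic_refl[of "r \<cdot> Idt M E" E G] r E by (simp add: cat)
  then have "homotopic M (j \<cdot> r) (Idt M E)"
    by (rule homotopic_cancel_left[OF _ r(1) rw jr Idt_hom[OF E(2)] E(1)])
  then have "homotopic M (j \<cdot> r \<cdot> \<epsilon>) (Idt M E \<cdot> \<epsilon>)" by (rule homotopic_pre[OF _ jr e(2)])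
  \<comment> \<open>The map \<open>\<epsilon>\<close> goes to \<open>E\<close>, not to \<open>G\<close>; the retraction \<open>r\<close> brings it to \<open>G\<close> at the price of the
    homotopy \<open>l\<close> from \<open>\<epsilon>\<close> to \<open>j \<cdot> \<beta>\<close>.\<close>
  define \<beta> where "\<beta> = r \<cdot> \<epsilon>"
  have \<beta>: "\<beta> \<in> hom M F G" "j \<cdot> \<beta> \<in> hom M F E" unfolding \<beta>_def using r e j by (auto simp: cat)
  have "homotopic M \<epsilon> (j \<cdot> \<beta>)"
    using homotopic_sym[OF \<open>homotopic M (j \<cdot> r \<cdot> \<epsilon>) (Idt M E \<cdot> \<epsilon>)\<close>] r e j unfolding \<beta>_def by (simp add: cat)
  then obtain C I l where C: "is_cylinder M F C" "cylp C \<in> hom M I F" "cyl0 C \<in> hom M F I" "cyl1 C \<in> hom M F I"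
    "l \<in> hom M I E" "l \<cdot> cyl0 C = \<epsilon>" "l \<cdot> cyl1 C = j \<cdot> \<beta>" using homotopicE[OF _ e(2)] by metis
  define h where "h = p \<cdot> l"
  have h: "h \<in> hom M I X" "h \<cdot> cyl0 C = \<iota> \<cdot> \<eta>" "h \<cdot> cyl1 C = g \<cdot> \<beta>"
    unfolding h_def using j C e \<beta> comp_ext[OF j(6), of \<beta>] by (auto simp: cat)
  have hs: "hsquare M C \<eta> \<beta> \<iota> g h"
    unfolding hsquare_def using homotopyI[OF C(1,2) h] bF b e \<beta> i g by blast
  have dm: "Dom M g = G" "Cod M g = X" "Cyl M C = I" "Dom M \<eta> = F" "Dom M x = D" "Cod M \<iota> = X" "Dom M \<iota> = A" "Cod M \<eta> = A" "Cod M \<beta> = G"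
    using g C e D i \<beta> by (auto simp: in_hom)
  have pb: "homotopy_pullback M C \<eta> \<beta> \<iota> g h"
    unfolding homotopy_pullback_def dm
    using hs j C h_def D F \<eta>_def \<epsilon>_def dm by (metis (no_types, lifting))
  have cof: "cofibrant M F" "cofibrant M G" "cofibrant M A" using bF b by (auto simp: bifibrant_def)
  obtain N c b' rr where N: "pushout M (cyl1 C) \<beta> c b'" "c \<in> hom M I N" "b' \<in> hom M G N" "c \<cdot> cyl1 C = b' \<cdot> \<beta>"
    "c \<cdot> cyl0 C \<in> Cof M" "b' \<in> Cof M" "b' \<in> Weq M"
    using mapping_cylinder[OF C(1,2) \<beta>(1) cof(1,2)] by metis
  have c0: "c \<cdot> cyl0 C \<in> hom M F N" using N C by (simp add: cat)
  obtain n where n: "n \<in> hom M N E" "n \<cdot> c = l" "n \<cdot> b' = j" using pushout_induced[OF N(1-3) C(5) j(1) C(7)] .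
  have nw: "n \<in> Weq M" using weq_right[OF N(3) n(1)] N n j by simp
  obtain E' m q where m: "m \<in> hom M N E'" "q \<in> hom M E' E" "m \<in> Cof M" "q \<in> Fib M" "q \<in> Weq M" "q \<cdot> m = n"
    using factor_cof[OF n(1)] .
  have mw: "m \<in> Weq M" using weq_left[OF m(1,2,5)] m nw by simp
  define e' where "e' = m \<cdot> (c \<cdot> cyl0 C)"
  have e': "e' \<in> hom M F E'" "q \<cdot> e' = \<epsilon>" "e' \<in> Cof M"
    unfolding e'_def using m c0 N C n cof_comp[OF c0 N(5) m(1,3)] comp_ext[OF m(6), of "c \<cdot> cyl0 C"] comp_ext[OF n(2), of "cyl0 C"]
    by (auto simp: cat)
  obtain U aA nE where U: "pushout M \<eta> e' aA nE" "aA \<in> hom M A U" "nE \<in> hom M E' U" "aA \<cdot> \<eta> = nE \<cdot> e'"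
    using pushout_ex[OF e(1) e'(1)] .
  have pq: "p \<cdot> q \<in> hom M E' X" using j m by (simp add: cat)
  obtain t where t: "t \<in> hom M U X" "t \<cdot> aA = \<iota>" "t \<cdot> nE = p \<cdot> q"
    by (rule pushout_induced[OF U(1-3) i pq]) (use e e' j m in \<open>auto simp: cat\<close>)
  obtain G' u g' where u: "u \<in> hom M U G'" "g' \<in> hom M G' X" "u \<in> Cof M" "u \<in> Weq M" "g' \<in> Fib M" "g' \<cdot> u = t"
    using factor_fib[OF t(1)] .
  have cU: "cofibrant M U" using cofibrant_cof[OF cof(3) U(2) cof_pushout[OF U(1) e'(3)]] .
  have G': "bifibrant M G'" using fibrant_fib[OF _ u(2,5)] cofibrant_cof[OF cU u(1,3)] b by (simp add: bifibrant_def)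
  define \<alpha>' v where "\<alpha>' = u \<cdot> aA" and "v = u \<cdot> nE"
  have a': "\<alpha>' \<in> hom M A G'" "v \<in> hom M E' G'" "\<alpha>' \<cdot> \<eta> = v \<cdot> e'" "g' \<cdot> \<alpha>' = \<iota>" "g' \<cdot> v = p \<cdot> q"
    unfolding \<alpha>'_def v_def using u U t e e' comp_ext[OF u(6), of aA] comp_ext[OF u(6), of nE] by (auto simp: cat)
  define \<gamma> k where "\<gamma> = v \<cdot> m \<cdot> b'" and "k = v \<cdot> m \<cdot> c"
  have vm: "v \<cdot> m \<in> hom M N G'" using a' m by (simp add: cat)
  have gk: "\<gamma> \<in> hom M G G'" "k \<in> hom M I G'" unfolding \<gamma>_def k_def using vm N by (auto simp: cat)
  have k: "k \<cdot> cyl0 C = \<alpha>' \<cdot> \<eta>" "k \<cdot> cyl1 C = \<gamma> \<cdot> \<beta>"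
    unfolding a'(3) unfolding k_def \<gamma>_def e'_def using a' m N C \<beta> by (simp_all add: cat)
  have hs': "hsquare M C \<eta> \<beta> \<alpha>' \<gamma> k"
    unfolding hsquare_def using homotopyI[OF C(1,2) gk(2) k] bF b G' e \<beta> a' gk by blast
  have hc: "hcocart M \<eta> e' \<alpha>' v" by (rule hcocartI[OF U(1,2) u(1,4)]) (simp_all add: \<alpha>'_def v_def)
  have hc': "hcocart M \<eta> (c \<cdot> cyl0 C) \<alpha>' (v \<cdot> m)"
    using hcocart_weq_under[OF e(1) c0 m(1) a'(1,2)] hc a'(3) N e' mw unfolding e'_def by simp
  have po: "homotopy_pushout M C \<eta> \<beta> \<alpha>' \<gamma> k"
    using homotopy_pushout_iff_hcocart[OF C(1,2) e(1) \<beta>(1) N(1,2) hs' vm _ _ a'(1)] hc' \<gamma>_def k_def by simp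
  \<comment> \<open>On the double mapping cylinder \<open>D1\<close>, the map \<open>g' \<cdot> w\<close> is exactly the one determined by \<open>\<iota>\<close>, \<open>h\<close> and \<open>g\<close>.\<close>
  obtain D1 a1 n1 where D1: "pushout M \<eta> (c \<cdot> cyl0 C) a1 n1" "a1 \<in> hom M A D1" "n1 \<in> hom M N D1" "a1 \<cdot> \<eta> = n1 \<cdot> (c \<cdot> cyl0 C)"
    using pushout_ex[OF e(1) c0] .
  have dmc: "double_mapping_cylinder M C \<eta> \<beta> a1 (n1 \<cdot> c) (n1 \<cdot> b')"
    by (rule double_mapping_cylinder_of_pushout[OF C(1,2) e(1) \<beta>(1) N(1,2) D1(1,2)])
  obtain w where w: "w \<in> hom M D1 G'" "w \<cdot> a1 = \<alpha>'" "w \<cdot> n1 = v \<cdot> m"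
    by (rule pushout_induced[OF D1(1-3) a'(1) vm]) (use a' e'_def m c0 N C in \<open>auto simp: cat\<close>)
  have dm2: "Cod M a1 = D1" "Cod M \<alpha>' = G'" using D1 a' by (auto simp: in_hom)
  have iw: "induced_by M a1 (n1 \<cdot> c) (n1 \<cdot> b') \<alpha>' k \<gamma> w"
    unfolding induced_by_def dm2 \<gamma>_def k_def
    using w D1 N m a' comp_ext[OF w(3), of c] comp_ext[OF w(3), of b'] by (auto simp: cat)
  have gw: "g' \<cdot> w \<in> hom M D1 X" using u w by (simp add: cat)
  have gvm: "g' \<cdot> (v \<cdot> m) = p \<cdot> n" using u a' m j comp_ext[OF a'(5), of m] by (simp add: cat)
  have gc: "g' \<cdot> (w \<cdot> (n1 \<cdot> c)) = h" "g' \<cdot> (w \<cdot> (n1 \<cdot> b')) = g"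
    using comp_ext[OF gvm, of c] comp_ext[OF gvm, of b'] comp_ext[OF w(3), of c] comp_ext[OF w(3), of b'] u vm n N j D1 w h_def C
    by (auto simp: cat)
  have ig: "induced_by M a1 (n1 \<cdot> c) (n1 \<cdot> b') \<iota> h g (g' \<cdot> w)"
    unfolding induced_by_def dm dm2 using gw gc w D1 N a' u by (auto simp: cat)
  have "whisker_map M C \<eta> \<beta> \<alpha>' \<gamma> k \<iota> g h g'"
    unfolding whisker_map_def dm dm2 using po hs u(2) dmc iw ig homotopic_refl[OF gw] by blast
  then show thesis
    using that[OF j(1,2,5,6) e(1,2) _ e'(1) m(2,4,5) e'(2) a'(2,1,3) G' u(2) a'(4,5) pb po] uni by blast
qed

text \<open>Let \<open>W = A \<union>\<^sub>Z N \<simeq> Y'\<close> be the strict form of the given homotopy pushout. After deforming \<open>\<zeta>\<close> on \<open>W\<close> such that it restricts to \<open>\<iota>\<close> on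
  \<open>A\<close>, and \<open>j \<cdot> l\<close> such that it lies over the deformed map, one gets \<open>N \<rightarrow> E\<close> and, with \<open>\<rho>\<close>, a map \<open>\<theta>: Z \<rightarrow> F\<close>. These fit together to a
  map \<open>W = A \<union>\<^sub>Z N \<rightarrow> G'\<close> strictly over \<open>X\<close> and under \<open>A\<close>, which is transferred to \<open>Y'\<close> along the weak equivalence
  \<open>W \<rightarrow> Y'\<close>.\<close>
lemma ganea_comparison_step:
  assumes ga: "ganea M \<iota> n g \<alpha>" and b: "bifibrant M A" "bifibrant M X" "bifibrant M G"
    and t: "\<iota> \<in> hom M A X" "g \<in> hom M G X" "l \<in> hom M Y G" "\<rho> \<in> hom M Z A" "\<tau> \<in> hom M Z Y" "\<zeta> \<in> hom M Y' X"
    and P: "homotopy_pushout M C0 \<rho> \<tau> \<kappa>' \<chi> k0"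
    and Y': "\<kappa>' \<in> hom M A Y'"
    and h: "homotopic M (g \<cdot> l) (\<zeta> \<cdot> \<chi>)" "homotopic M (\<zeta> \<cdot> \<kappa>') \<iota>"
  obtains G' g' \<alpha>' l' where "ganea M \<iota> (Suc n) g' \<alpha>'" "g' \<in> hom M G' X" "bifibrant M G'"
    "\<alpha>' \<in> hom M A G'" "l' \<in> hom M Y' G'" "homotopic M (g' \<cdot> l') \<zeta>" "homotopic M (l' \<cdot> \<kappa>') \<alpha>'"
proof -
  obtain Y'' N i c r y where p: "bifibrant M Z" "bifibrant M A" "bifibrant M Y" "bifibrant M Y''"
    "\<kappa>' \<in> hom M A Y''" "\<chi> \<in> hom M Y Y''"
    "i \<in> hom M Z N" "i \<in> Cof M" "c \<in> hom M Y N" "c \<in> Cof M" "c \<in> Weq M"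
    "r \<in> hom M N Y" "r \<in> Weq M" "r \<cdot> i = \<tau>" "r \<cdot> c = Idt M Y"
    "y \<in> hom M N Y''" "y \<cdot> i = \<kappa>' \<cdot> \<rho>" "y \<cdot> c = \<chi>" "hcocart M \<rho> i \<kappa>' y"
    using homotopy_pushoutE[OF P t(4,5)] .
  have [simp]: "Y'' = Y'" using p(5) Y' by (simp add: in_hom)
  note p = p[simplified]
  have co: "cofibrant M Z" "cofibrant M A" "cofibrant M Y" "cofibrant M Y'" "fibrant M X" "fibrant M G"
    using p b by (auto simp: bifibrant_def)
  obtain a n W T w where w: "pushout M \<rho> i a n" "a \<in> hom M A W" "n \<in> hom M N W" "a \<cdot> \<rho> = n \<cdot> i"
    "w \<in> hom M W T" "w \<in> Weq M" "w \<cdot> a = \<kappa>'" "w \<cdot> n = y" "\<kappa>' \<in> hom M A T" "y \<in> hom M N T" "\<kappa>' \<cdot> \<rho> = y \<cdot> i"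
    using hcocartE[OF p(19) t(4) p(7)] .
  have [simp]: "T = Y'" using w(9) Y' by (simp add: in_hom)
  note w = w[simplified]
  have ac: "a \<in> Cof M" using cof_pushout[OF w(1) p(8)] .
  have cW: "cofibrant M W" using cofibrant_cof[OF co(2) w(2) ac] .
  have zw: "\<zeta> \<cdot> w \<in> hom M W X" "\<zeta> \<cdot> w \<cdot> a = \<zeta> \<cdot> \<kappa>'" using t w by (auto simp: cat)
  obtain z where z: "z \<in> hom M W X" "z \<cdot> a = \<iota>" "homotopic M (\<zeta> \<cdot> w) z"
    using homotopy_extension[OF _ ac w(2) zw(1) co(2,5)] zw(2) h(2) by metis
  obtain E j p' F \<eta> \<epsilon> E' e q v G' \<alpha>' g' C \<beta> hh \<gamma> k where s:
    "j \<in> hom M G E" "p' \<in> hom M E X" "p' \<in> Fib M" "p' \<cdot> j = g"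
    "\<eta> \<in> hom M F A" "\<epsilon> \<in> hom M F E"
    "\<forall>T x y. cofibrant M T \<longrightarrow> x \<in> hom M T A \<longrightarrow> y \<in> hom M T E \<longrightarrow> \<iota> \<cdot> x = p' \<cdot> y \<longrightarrow>
       (\<exists>\<theta>. \<theta> \<in> hom M T F \<and> \<eta> \<cdot> \<theta> = x \<and> \<epsilon> \<cdot> \<theta> = y)"
    "e \<in> hom M F E'" "q \<in> hom M E' E" "q \<in> Fib M" "q \<in> Weq M" "q \<cdot> e = \<epsilon>"
    "v \<in> hom M E' G'" "\<alpha>' \<in> hom M A G'" "\<alpha>' \<cdot> \<eta> = v \<cdot> e" "bifibrant M G'"
    "g' \<in> hom M G' X" "g' \<cdot> \<alpha>' = \<iota>" "g' \<cdot> v = p' \<cdot> q"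
    "homotopy_pullback M C \<eta> \<beta> \<iota> g hh" "homotopy_pushout M C \<eta> \<beta> \<alpha>' \<gamma> k"
    "whisker_map M C \<eta> \<beta> \<alpha>' \<gamma> k \<iota> g hh g'" using ganea_step[OF t(2,1) b(3,1,2)] .
  have nc: "n \<cdot> c \<in> hom M Y W" "\<zeta> \<cdot> w \<cdot> (n \<cdot> c) = \<zeta> \<cdot> \<chi>"
    using w p t comp_ext[OF w(8), of c] by (auto simp: cat)
  have "homotopic M (\<zeta> \<cdot> \<chi>) (z \<cdot> (n \<cdot> c))"
    using homotopic_pre[OF z(3) zw(1) nc(1)] nc(2) by simp
  moreover have gl: "g \<cdot> l \<in> hom M Y X" "p' \<cdot> (j \<cdot> l) = g \<cdot> l" "j \<cdot> l \<in> hom M Y E"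
    using t s comp_ext[OF s(4), of l] by (auto simp: cat)
  ultimately have "homotopic M (p' \<cdot> (j \<cdot> l)) (z \<cdot> (n \<cdot> c))"
    using homotopic_trans[OF h(1) _ gl(1) co(3,5)] by simp
  then obtain l1 where l1: "l1 \<in> hom M Y E" "p' \<cdot> l1 = z \<cdot> (n \<cdot> c)"
    using homotopy_lifting[OF _ s(3,2) gl(3) co(3)] by metis
  have zn: "z \<cdot> n \<in> hom M N X" "p' \<cdot> l1 = z \<cdot> n \<cdot> c" using z w l1 p by (auto simp: cat)
  obtain lN where lN: "lN \<in> hom M N E" "lN \<cdot> c = l1" "p' \<cdot> lN = z \<cdot> n"
    using lift[OF p(10) s(3) disjI1[OF p(11)] p(9) s(2) l1(1) zn] .
  have li: "lN \<cdot> i \<in> hom M Z E" "\<iota> \<cdot> \<rho> = p' \<cdot> (lN \<cdot> i)"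
    using lN p s w z t comp_ext[OF lN(3), of i] comp_ext[OF z(2), of \<rho>] by (auto simp: cat)
  obtain \<theta> where \<theta>: "\<theta> \<in> hom M Z F" "\<eta> \<cdot> \<theta> = \<rho>" "\<epsilon> \<cdot> \<theta> = lN \<cdot> i"
    using s(7)[rule_format, OF co(1) t(4) li] by blast
  have et: "e \<cdot> \<theta> \<in> hom M Z E'" "q \<cdot> (e \<cdot> \<theta>) = lN \<cdot> i" using s \<theta> comp_ext[OF s(12), of \<theta>] by (auto simp: cat)
  obtain m where m: "m \<in> hom M N E'" "m \<cdot> i = e \<cdot> \<theta>" "q \<cdot> m = lN"
    using lift[OF p(8) s(10) disjI2[OF s(11)] p(7) s(9) et(1) lN(1) et(2)] .
  have vm: "v \<cdot> m \<in> hom M N G'" using s m by (simp add: cat)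
  have vmi: "\<alpha>' \<cdot> \<rho> = v \<cdot> m \<cdot> i"
    using s m p \<theta> comp_ext[OF s(15), of \<theta>] by (simp add: cat)
  obtain L where L: "L \<in> hom M W G'" "L \<cdot> a = \<alpha>'" "L \<cdot> n = v \<cdot> m"
    using pushout_induced[OF w(1-3) s(14) vm vmi] .
  have gL: "g' \<cdot> L = z"
    by (rule pushout_eqI[OF w(1,2), of _ X])
      (use L s z w m lN comp_ext[OF s(19), of m] in \<open>auto simp: cat\<close>)
  obtain l' where l': "l' \<in> hom M Y' G'" "homotopic M (l' \<cdot> w) L"
    using weq_extend_up_to_homotopy[OF w(5,6) L(1) fibrant_if_bifibrant[OF s(16)] co(4) cW] .
  have lw: "l' \<cdot> w \<in> hom M W G'" "g' \<cdot> l' \<in> hom M Y' X" "g' \<cdot> l' \<cdot> w \<in> hom M W X" "g' \<cdot> l' \<cdot> w = g' \<cdot> (l' \<cdot> w)"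
    using l' s w by (auto simp: cat)
  have "homotopic M (g' \<cdot> l' \<cdot> w) z" using homotopic_post[OF l'(2) lw(1) s(17)] gL lw by simp
  then have "homotopic M (g' \<cdot> l' \<cdot> w) (\<zeta> \<cdot> w)"
    by (rule homotopic_trans[OF _ homotopic_sym[OF z(3)] lw(3) cW co(5)])
  then have 1: "homotopic M (g' \<cdot> l') \<zeta>"
    by (rule homotopic_cancel_right[OF _ w(5,6) lw(2) t(6) cW co(4,5)])
  have "homotopic M (l' \<cdot> w \<cdot> a) (L \<cdot> a)" using homotopic_pre[OF l'(2) lw(1) w(2)] .
  then have 2: "homotopic M (l' \<cdot> \<kappa>') \<alpha>'" using L w l' by (simp add: cat)
  show thesis
    by (rule that[OF ganea.ganea_Suc[OF ga s(20-22)] s(17,16,14) l'(1) 1 2])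
qed

text \<open>The map \<open>\<zeta>\<close> stands for the composite \<open>X m \<rightarrow> X (Suc m) \<rightarrow> \<dots> \<rightarrow> X n\<close>. Leaving it arbitrary in the induction avoids
  choosing all maps \<open>\<chi>\<close> beforehand.\<close>
lemma pushcat_ganea:
  assumes b: "bifibrant M A" "bifibrant M B" and i: "\<iota> \<in> hom M A B"
    and K: "\<forall>i\<le>n. bifibrant M (X i) \<and> K i \<in> hom M A (X i)" and r: "homotopy_inverse M (K 0) r"
    and S: "\<forall>i<n. pushcat_step M A (X i) (X (Suc i)) (K i) (K (Suc i))"
  shows "m \<le> n \<Longrightarrow> \<zeta> \<in> hom M (X m) B \<Longrightarrow> homotopic M (\<zeta> \<cdot> K m) \<iota> \<Longrightarrow>
    \<exists>g \<alpha> G l. ganea M \<iota> m g \<alpha> \<and> g \<in> hom M G B \<and> bifibrant M G \<and> \<alpha> \<in> hom M A G \<and> l \<in> hom M (X m) G \<and>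
      homotopic M (g \<cdot> l) \<zeta> \<and> homotopic M (l \<cdot> K m) \<alpha>"
proof (induction m arbitrary: \<zeta>)
  case 0
  have k: "K 0 \<in> hom M A (X 0)" "bifibrant M (X 0)" using K by auto
  have A: "A \<in> Obj M" "cofibrant M (X 0)" "fibrant M B" using b k bifibrant_obj by (auto simp: bifibrant_def)
  have d: "Dom M (K 0) = A" "Cod M (K 0) = X 0" "Dom M \<iota> = A" using k i by (auto simp: in_hom)
  have r': "r \<in> hom M (X 0) A" "homotopic M (r \<cdot> K 0) (Idt M A)" "homotopic M (K 0 \<cdot> r) (Idt M (X 0))"
    using r d unfolding homotopy_inverse_def by auto
  have ty: "\<zeta> \<cdot> K 0 \<in> hom M A B" "K 0 \<cdot> r \<in> hom M (X 0) (X 0)" "\<iota> \<cdot> r \<in> hom M (X 0) B"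
    using 0 k r' i by (auto simp: cat)
  have 1: "homotopic M (\<zeta> \<cdot> K 0 \<cdot> r) (\<iota> \<cdot> r)" by (rule homotopic_pre[OF 0(3) ty(1) r'(1)])
  have "homotopic M (\<zeta> \<cdot> (K 0 \<cdot> r)) (\<zeta> \<cdot> Idt M (X 0))" by (rule homotopic_post[OF r'(3) ty(2) 0(2)])
  then have 2: "homotopic M (\<zeta> \<cdot> K 0 \<cdot> r) \<zeta>" using 0 k r' by (simp add: cat)
  have "homotopic M (\<iota> \<cdot> r) \<zeta>" by (rule homotopic_trans[OF homotopic_sym[OF 1] 2 ty(3) A(2,3)])
  then show ?case
    using ganea_0[of M \<iota>] i b r' Idt_hom[OF A(1)] unfolding d by blast
next
  case (Suc m)
  obtain C Z \<rho> \<tau> \<chi> h where s: "\<rho> \<in> hom M Z A" "\<tau> \<in> hom M Z (X m)" "\<chi> \<in> hom M (X m) (X (Suc m))"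
    "homotopy_pushout M C \<rho> \<tau> (K (Suc m)) \<chi> h" "homotopic M (\<chi> \<cdot> K m) (K (Suc m))"
    using S Suc.prems(1) unfolding pushcat_step_def by (meson Suc_le_eq)
  have k: "K m \<in> hom M A (X m)" "K (Suc m) \<in> hom M A (X (Suc m))" "m \<le> n" using K Suc.prems(1) by auto
  have A: "cofibrant M A" "fibrant M B" using b by (auto simp: bifibrant_def)
  have z: "\<zeta> \<cdot> \<chi> \<in> hom M (X m) B" "\<zeta> \<cdot> \<chi> \<cdot> K m \<in> hom M A B" "\<chi> \<cdot> K m \<in> hom M A (X (Suc m))"
    "\<zeta> \<cdot> \<chi> \<cdot> K m = \<zeta> \<cdot> (\<chi> \<cdot> K m)"
    using Suc.prems(2) s k by (auto simp: cat)
  have "homotopic M (\<zeta> \<cdot> \<chi> \<cdot> K m) \<iota>"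
    by (rule homotopic_trans[OF _ Suc.prems(3) z(2) A]) (use homotopic_post[OF s(5) z(3) Suc.prems(2)] z(4) in simp)
  then obtain g \<alpha> G l where g: "ganea M \<iota> m g \<alpha>" "g \<in> hom M G B" "bifibrant M G" "l \<in> hom M (X m) G"
      "homotopic M (g \<cdot> l) (\<zeta> \<cdot> \<chi>)"
    using Suc.IH[OF k(3) z(1)] by blast
  obtain G' g' \<alpha>' l' where "ganea M \<iota> (Suc m) g' \<alpha>'" "g' \<in> hom M G' B" "bifibrant M G'"
    "\<alpha>' \<in> hom M A G'" "l' \<in> hom M (X (Suc m)) G'" "homotopic M (g' \<cdot> l') \<zeta>" "homotopic M (l' \<cdot> K (Suc m)) \<alpha>'"
    using ganea_comparison_step[OF g(1) b g(3) i g(2,4) s(1,2) Suc.prems(2) s(4) k(2) g(5) Suc.prems(3)] .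
  then show ?case by blast
qed

section \<open>The four inequalities\<close>

lemma relcat_step_pushcat_step:
  assumes b: "bifibrant M A" and S: "relcat_step M A X X' \<kappa> \<kappa>'"
  shows "pushcat_step M A X X' \<kappa> \<kappa>'"
proof -
  obtain C Z \<rho> \<tau> \<chi> k \<sigma> where t: "\<rho> \<in> hom M Z A" "\<tau> \<in> hom M Z X" "\<sigma> \<in> hom M A Z" "\<chi> \<in> hom M X X'"
    and P: "homotopy_pushout M C \<rho> \<tau> \<kappa>' \<chi> k"
    and h: "homotopic M (\<rho> \<cdot> \<sigma>) (Idt M A)" "homotopic M (\<tau> \<cdot> \<sigma>) \<kappa>"
    using S unfolding relcat_step_def by blast
  have hs: "hsquare M C \<rho> \<tau> \<kappa>' \<chi> k" using P unfolding homotopy_pushout_def by blast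
  then obtain Z' A' B T where f: "bifibrant M T" "\<rho> \<in> hom M Z' A'" "\<tau> \<in> hom M Z' B" "\<kappa>' \<in> hom M A' T" "\<chi> \<in> hom M B T"
    and ho: "homotopic M (\<kappa>' \<cdot> \<rho>) (\<chi> \<cdot> \<tau>)" unfolding hsquare_def homotopic_def by metis
  have [simp]: "Z' = Z" "A' = A" "B = X" using f t by (auto simp: in_hom)
  note f = f[simplified]
  have c: "cofibrant M A" "fibrant M T" "A \<in> Obj M" using b f bifibrant_obj by (auto simp: bifibrant_def)
  have ty: "\<rho> \<cdot> \<sigma> \<in> hom M A A" "\<tau> \<cdot> \<sigma> \<in> hom M A X" "\<kappa>' \<cdot> \<rho> \<in> hom M Z T" "\<kappa>' \<cdot> \<rho> \<cdot> \<sigma> \<in> hom M A T"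
    "\<chi> \<cdot> \<kappa> \<in> hom M A T"
    using t f homotopic_hom[OF h(2), of A X] by (auto simp: cat)
  have 1: "homotopic M (\<chi> \<cdot> \<kappa>) (\<chi> \<cdot> \<tau> \<cdot> \<sigma>)"
    using homotopic_sym[OF homotopic_post[OF h(2) ty(2) f(5)]] f t by (simp add: cat)
  have 2: "homotopic M (\<chi> \<cdot> \<tau> \<cdot> \<sigma>) (\<kappa>' \<cdot> \<rho> \<cdot> \<sigma>)"
    by (rule homotopic_sym[OF homotopic_pre[OF ho ty(3) t(3)]])
  have 3: "homotopic M (\<kappa>' \<cdot> \<rho> \<cdot> \<sigma>) \<kappa>'"
    using homotopic_post[OF h(1) ty(1) f(4)] t f c by (simp add: cat)
  show ?thesis using homotopic_trans3[OF 1 2 3 ty(5) c(1,2)] P t unfolding pushcat_step_def by blast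
qed

lemma secat_le_relcat: "secat M \<iota> \<le> relcat M \<iota>"
    unfolding secat_def relcat_def by (rule Inf_superset_mono) blast

lemma relcat_le_Pushcat:
  assumes b: "bifibrant M A" "bifibrant M X" and i: "\<iota> \<in> hom M A X"
  shows "relcat M \<iota> \<le> Pushcat M \<iota>"
proof -
  have d: "Dom M \<iota> = A" "Cod M \<iota> = X" using i by (auto simp: in_hom)
  have A: "X \<in> Obj M" "cofibrant M A" using b bifibrant_obj by (auto simp: bifibrant_def)
  show ?thesis
    unfolding relcat_def Pushcat_def d pushcat_step_def[symmetric]
  proof (rule Inf_superset_mono, rule image_mono, rule subsetI, unfold mem_Collect_eq)
    fix n assume "\<exists>Y \<kappa>. (\<forall>i\<le>n. bifibrant M (Y i) \<and> \<kappa> i \<in> hom M A (Y i)) \<and> (\<exists>r. homotopy_inverse M (\<kappa> 0) r) \<and>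
     (\<forall>i<n. pushcat_step M A (Y i) (Y (Suc i)) (\<kappa> i) (\<kappa> (Suc i))) \<and>
     Y n = X \<and> homotopic M (\<kappa> n) \<iota>"
    then obtain Y \<kappa> r where y: "\<forall>i\<le>n. bifibrant M (Y i) \<and> \<kappa> i \<in> hom M A (Y i)" "homotopy_inverse M (\<kappa> 0) r"
     "\<forall>i<n. pushcat_step M A (Y i) (Y (Suc i)) (\<kappa> i) (\<kappa> (Suc i))"
     "Y n = X" "homotopic M (\<kappa> n) \<iota>" by blast
    have k: "\<kappa> n \<in> hom M A X" using y(1,4) by auto
    have z: "Idt M X \<in> hom M (Y n) X" "homotopic M (Idt M X \<cdot> \<kappa> n) \<iota>" using y k Idt_hom[OF A(1)] by (auto simp: cat)
    obtain g \<alpha> G l where g: "ganea M \<iota> n g \<alpha>" "g \<in> hom M G X" "bifibrant M G" "l \<in> hom M X G"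
      "homotopic M (g \<cdot> l) (Idt M X)" "homotopic M (l \<cdot> \<kappa> n) \<alpha>"
      using pushcat_ganea[OF b i y(1-3) order_refl z] unfolding y(4) by blast
    have l: "l \<cdot> \<kappa> n \<in> hom M A G" "l \<cdot> \<iota> \<in> hom M A G" using g k i by (auto simp: cat)
    have "homotopic M (l \<cdot> \<iota>) \<alpha>"
      by (rule homotopic_trans[OF homotopic_sym[OF homotopic_post[OF y(5) k g(4)]] g(6) l(2) A(2) fibrant_if_bifibrant[OF g(3)]])
    moreover have "Dom M g = G" using g by (simp add: in_hom)
    ultimately show "\<exists>g \<alpha>. ganea M \<iota> n g \<alpha> \<and> (\<exists>\<sigma>\<in>hom M X (Dom M g). homotopic M (g \<cdot> \<sigma>) (Idt M X) \<and> homotopic M (\<sigma> \<cdot> \<iota>) \<alpha>)"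
      using g by blast
  qed
qed

lemma Pushcat_le_Relcat:
  assumes A: "bifibrant M A" and i: "\<iota> \<in> hom M A X"
  shows "Pushcat M \<iota> \<le> Relcat M \<iota>"
proof -
  have d: "Dom M \<iota> = A" "Cod M \<iota> = X" using i by (auto simp: in_hom)
  show ?thesis
    unfolding Pushcat_def Relcat_def d pushcat_step_def[symmetric] relcat_step_def[symmetric]
  proof (rule Inf_superset_mono, rule image_mono, rule Collect_mono, rule impI, elim exE conjE, intro exI conjI)
    fix n Y \<kappa> r i
    assume S: "\<forall>i<n. relcat_step M A (Y i) (Y (Suc i)) (\<kappa> i) (\<kappa> (Suc i))"
    show "\<forall>i<n. pushcat_step M A (Y i) (Y (Suc i)) (\<kappa> i) (\<kappa> (Suc i))"
      using S relcat_step_pushcat_step[OF A] by blast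
  qed
qed

end

lemma (in cube_model_cat) Relcat_le_Suc_secat:
  assumes b: "bifibrant M A" "bifibrant M X" and i: "\<iota> \<in> hom M A X"
  shows "Relcat M \<iota> \<le> secat M \<iota> + 1"
proof -
  have d: "Dom M \<iota> = A" "Cod M \<iota> = X" using i by (auto simp: in_hom)
    have *: "Relcat M \<iota> \<le> enat (Suc n)"
      if ga: "ganea M \<iota> n g \<alpha>" and sg: "\<sigma> \<in> hom M X (Dom M g)" and hg: "homotopic M (g \<cdot> \<sigma>) (Idt M X)" for n g \<alpha> \<sigma>
    proof -
      obtain G where G: "g \<in> hom M G X" "\<alpha> \<in> hom M A G" "bifibrant M G" "rel_build M A n \<alpha>" "homotopic M (g \<cdot> \<alpha>) \<iota>"
        using ganea_rel_build[OF ga i b] by blast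
      have s: "\<sigma> \<in> hom M X G" "g \<cdot> \<alpha> \<in> hom M A X" using sg G by (auto simp: cat)
      have "rel_build M A (Suc n) (g \<cdot> \<alpha>)" by (rule rel_build_of_homotopy_section[OF G(4) b G(2,1) s(1) hg])
      from rel_build_sequence[OF this s(2) b(1)]
      have "enat (Suc n) \<in> enat ` {n. \<exists>X' \<kappa>.
     (\<forall>i\<le>n. bifibrant M (X' i) \<and> \<kappa> i \<in> hom M A (X' i)) \<and> (\<exists>r. homotopy_inverse M (\<kappa> 0) r) \<and>
     (\<forall>i<n. relcat_step M A (X' i) (X' (Suc i)) (\<kappa> i) (\<kappa> (Suc i))) \<and>
     X' n = X \<and> homotopic M (\<kappa> n) \<iota>}"
        using G(5) by (intro imageI, unfold mem_Collect_eq) (elim exE conjE, intro exI conjI, assumption+, simp)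
      then show ?thesis unfolding Relcat_def d relcat_step_def[symmetric] by (rule Inf_lower)
    qed
    show ?thesis
    proof (cases "secat M \<iota>")
      case (enat n)
      \<comment> \<open>A finite infimum of a set of extended natural numbers is attained.\<close>
      define S where "S = enat ` {n. \<exists>g \<alpha>. ganea M \<iota> n g \<alpha> \<and> (\<exists>\<sigma>\<in>hom M X (Dom M g). homotopic M (g \<cdot> \<sigma>) (Idt M X))}"
      have S: "secat M \<iota> = Inf S" unfolding secat_def S_def d ..
      then have "S \<noteq> {}" using enat by (auto simp: Inf_enat_def)
      then have "Inf S \<in> S" unfolding Inf_enat_def by (auto intro: LeastI)
      then have "enat n \<in> S" using enat S by simp
      then show ?thesis using * enat unfolding S_def by (auto simp: one_enat_def)
    qed simp
  qed

theorem theorem18: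
  fixes M :: "('o, 'a) model_structure" and A X :: 'o and \<iota> :: 'a
  assumes "cube_model_category M"
    and "bifibrant M A" and "bifibrant M X"
    and "\<iota> \<in> hom M A X"
  shows "secat M \<iota> \<le> relcat M \<iota> \<and> relcat M \<iota> \<le> Pushcat M \<iota> \<and>
         Pushcat M \<iota> \<le> Relcat M \<iota> \<and> Relcat M \<iota> \<le> secat M \<iota> + 1"
proof -
  interpret cube_model_cat M using assms(1) by (simp add: cube_model_cat_def)
  show ?thesis
    using secat_le_relcat relcat_le_Pushcat[OF assms(2-4)] Pushcat_le_Relcat[OF assms(2,4)]
      Relcat_le_Suc_secat[OF assms(2-4)] by blast
qed

end
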